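(* Let $\overline V$, over the ring $\overline R$, be the universal $2$-generated primitive axial algebra of Monster type $(2\beta,\beta)$ with generating axes $\mathbf a_0,\mathbf a_1$. Then $\overline V$ is spanned, as an $\overline R$-module, by the eight elements $$\mathbf a_{-2},\ \mathbf a_{-1},\ \mathbf a_0,\ \mathbf a_1,\ \mathbf a_2,\ \mathbf a_3,\ \mathbf s_{0,1},\ \mathbf s_{0,3}.$$
   Context: Let $\hat D=\mathbb Z[\tfrac12,\beta,\tfrac1\beta,\tfrac1{1-\beta},\tfrac1{1-2\beta}]$, with $\beta$ an indeterminate over $\mathbb Z$. Let $\alpha=2\beta$ and $\mathcal S=\{1,0,\alpha,\beta\}$. The fusion law $\mathcal M(\alpha,\beta)$ is the symmetric map $\star:\mathcal S\times\mathcal S\to2^{\mathcal S}$ with $1\star1=\{1\}$, $1\star0=\emptyset$, $1\star\alpha=\{\alpha\}$, $1\star\beta=\{\beta\}$, $0\star0=\{0\}$, $0\star\alpha=\{\alpha\}$, $0\star\beta=\{\beta\}$, $\alpha\star\alpha=\{1,0\}$, $\alpha\star\beta=\{\beta\}$, $\beta\star\beta=\{1,0,\alpha\}$. A $2$-generated primitive axial algebra of Monster type $(2\beta,\beta)$ here consists of a commutative associative unital $\hat D$-algebra $R$, a commutative non-associative $R$-algebra $V$ generated by two idempotents $a_0,a_1$ (axes), and $R$-linear maps $\lambda_{a_i}:V\to R$ ($i=0,1$) such that, for each axis $a\in\{a_0,a_1\}$, writing $V^a_\delta=\{v\in V: av=\delta v\}$: $\lambda_a(a)=1$; $V$ is the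 sum of the $V^a_\delta$, $\delta\in\mathcal S$; $v-\lambda_a(v)a\in V^a_0+V^a_\alpha+V^a_\beta$ for all $v\in V$ (so $V_1^a=Ra$); and $V^a_\lambda V^a_\mu\subseteq\sum_{\delta\in\lambda\star\mu}V^a_\delta$ for all $\lambda,\mu\in\mathcal S$. A morphism from $(R,V)$ to $(R',V')$ is a $\hat D$-algebra homomorphism $\varphi:R\to R'$ together with an additive, multiplicative, $\varphi$-semilinear map $\psi:V\to V'$ with $\psi(a_i)=a_i'$ and $\lambda_{a_i'}\circ\psi=\varphi\circ\lambda_{a_i}$. The universal algebra $(\overline R,\overline V)$, with axes $\mathbf a_0,\mathbf a_1$, is the initial object of this category. For an axis $a$, the Miyamoto involution $\tau_a$ is the $R$-linear algebra automorphism acting as $1$ on $V_1^a+V_0^a+V_\alpha^a$ and as $-1$ on $V_\beta^a$. Let $\tau_i=\tau_{\mathbf a_i}$ ($i=0,1$), $\rho=\tau_0\tau_1$ (maps act on the right), $\mathbf a_{2i}=\mathbf a_0^{\rho^i}$, $\mathbf a_{2i+1}=\mathbf a_1^{\rho^i}$ for $i\in\mathbb Z$, and $\mathbf s_{0,n}=\mathbf a_0\mathbf a_n-\beta(\mathbf a_0+\mathbf a_n)$. *)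

theory Defs
  imports
    "HOL-Algebra.Module"
    "HOL-Algebra.Generated_Rings"
    "HOL-Algebra.Bij"
    "HOL-Computational_Algebra.Polynomial"
    "HOL-Computational_Algebra.Fraction_Field"
    "HOL-Library.Infinite_Typeclass"
begin

section \<open>The coefficient ring\<close>

definition beta :: "int poly fract"
  where "beta = Fract [:0, 1:] 1"

definition fract_ring :: "int poly fract ring"
  where "fract_ring = \<lparr>carrier = UNIV, monoid.mult = (*), one = 1, zero = 0, add = (+)\<rparr>"

text \<open>The ring \<open>\<int>[1/2, \<beta>, 1/\<beta>, 1/(1 - \<beta>), 1/(1 - 2\<beta>)]\<close>, as a subring of the
  fraction field of \<open>\<int>[\<beta>]\<close>.\<close>

definition Dhat :: "int poly fract ring"
  where "Dhat = fract_ring\<lparr>carrier :=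
    generate_ring fract_ring
      {1 / 2, beta, 1 / beta, 1 / (1 - beta), 1 / (1 - 2 * beta)}\<rparr>"


section \<open>The fusion law\<close>

text \<open>The constructors name the four distinct elements \<open>1, 0, \<alpha> = 2\<beta>, \<beta>\<close>, whose values are
  given by \<open>eigenvalue\<close>.\<close>

datatype label = Ev1 | Ev0 | EvAlpha | EvBeta

fun eigenvalue :: "label \<Rightarrow> int poly fract" where
  "eigenvalue Ev1 = 1"
| "eigenvalue Ev0 = 0"
| "eigenvalue EvAlpha = 2 * beta"
| "eigenvalue EvBeta = beta"

fun fusion :: "label \<Rightarrow> label \<Rightarrow> label set" where
  "fusion Ev1 Ev1 = {Ev1}"
| "fusion Ev1 Ev0 = {}"
| "fusion Ev1 EvAlpha = {EvAlpha}"
| "fusion Ev1 EvBeta = {EvBeta}"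
| "fusion Ev0 Ev1 = {}"
| "fusion Ev0 Ev0 = {Ev0}"
| "fusion Ev0 EvAlpha = {EvAlpha}"
| "fusion Ev0 EvBeta = {EvBeta}"
| "fusion EvAlpha Ev1 = {EvAlpha}"
| "fusion EvAlpha Ev0 = {EvAlpha}"
| "fusion EvAlpha EvAlpha = {Ev1, Ev0}"
| "fusion EvAlpha EvBeta = {EvBeta}"
| "fusion EvBeta Ev1 = {EvBeta}"
| "fusion EvBeta Ev0 = {EvBeta}"
| "fusion EvBeta EvAlpha = {EvBeta}"
| "fusion EvBeta EvBeta = {Ev1, Ev0, EvAlpha}"


section \<open>Axial algebras\<close>

text \<open>The library record for modules extends the one for rings, so it already carries the
  product of a non-associative algebra; its component \<open>one\<close> is not used.\<close>

locale nonassoc_comm_algebra = module R V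
  for R :: "'r ring" and V :: "('r, 'v) module" +
  assumes mult_closed: "\<lbrakk>x \<in> carrier V; y \<in> carrier V\<rbrakk> \<Longrightarrow> x \<otimes>\<^bsub>V\<^esub> y \<in> carrier V"
    and mult_comm: "\<lbrakk>x \<in> carrier V; y \<in> carrier V\<rbrakk> \<Longrightarrow> x \<otimes>\<^bsub>V\<^esub> y = y \<otimes>\<^bsub>V\<^esub> x"
    and mult_distr: "\<lbrakk>x \<in> carrier V; y \<in> carrier V; z \<in> carrier V\<rbrakk> \<Longrightarrow>
      (x \<oplus>\<^bsub>V\<^esub> y) \<otimes>\<^bsub>V\<^esub> z = x \<otimes>\<^bsub>V\<^esub> z \<oplus>\<^bsub>V\<^esub> y \<otimes>\<^bsub>V\<^esub> z"
    and mult_smult: "\<lbrakk>r \<in> carrier R; x \<in> carrier V; y \<in> carrier V\<rbrakk> \<Longrightarrow>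
      (r \<odot>\<^bsub>V\<^esub> x) \<otimes>\<^bsub>V\<^esub> y = r \<odot>\<^bsub>V\<^esub> (x \<otimes>\<^bsub>V\<^esub> y)"

text \<open>The data of an object: the ring \<open>R\<close>, its structure map as an algebra over \<open>Dhat\<close>, the
  algebra \<open>V\<close>, the two axes and the two projections. Maps matter only on the carriers.\<close>

record ('r, 'v) axial_data =
  scal :: "'r ring"
  str :: "int poly fract \<Rightarrow> 'r"
  alg :: "('r, 'v) module"
  axis0 :: 'v
  axis1 :: 'v
  lam0 :: "'v \<Rightarrow> 'r"
  lam1 :: "'v \<Rightarrow> 'r"

definition subalgebra :: "'v set \<Rightarrow> 'r ring \<Rightarrow> ('r, 'v) module \<Rightarrow> bool"
  where "subalgebra W R V \<longleftrightarrow>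
    submodule W R V \<and> (\<forall>x\<in>W. \<forall>y\<in>W. x \<otimes>\<^bsub>V\<^esub> y \<in> W)"

definition eigenspace :: "('r, 'v) axial_data \<Rightarrow> 'v \<Rightarrow> label \<Rightarrow> 'v set"
  where "eigenspace X a d =
    {v \<in> carrier (alg X). a \<otimes>\<^bsub>alg X\<^esub> v = str X (eigenvalue d) \<odot>\<^bsub>alg X\<^esub> v}"

definition eigensum :: "('r, 'v) axial_data \<Rightarrow> 'v \<Rightarrow> label set \<Rightarrow> 'v set"
  where "eigensum X a T =
    {finsum (alg X) f T |f. \<forall>d\<in>T. f d \<in> eigenspace X a d}"

definition linear_form :: "'r ring \<Rightarrow> ('r, 'v) module \<Rightarrow> ('v \<Rightarrow> 'r) \<Rightarrow> bool"
  where "linear_form R V l \<longleftrightarrow>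
    (\<forall>v\<in>carrier V. l v \<in> carrier R) \<and>
    (\<forall>v\<in>carrier V. \<forall>w\<in>carrier V. l (v \<oplus>\<^bsub>V\<^esub> w) = l v \<oplus>\<^bsub>R\<^esub> l w) \<and>
    (\<forall>r\<in>carrier R. \<forall>v\<in>carrier V. l (r \<odot>\<^bsub>V\<^esub> v) = r \<otimes>\<^bsub>R\<^esub> l v)"

definition primitive_axis :: "('r, 'v) axial_data \<Rightarrow> 'v \<Rightarrow> ('v \<Rightarrow> 'r) \<Rightarrow> bool"
  where "primitive_axis X a l \<longleftrightarrow>
    a \<in> carrier (alg X) \<and> a \<otimes>\<^bsub>alg X\<^esub> a = a \<and>
    linear_form (scal X) (alg X) l \<and> l a = \<one>\<^bsub>scal X\<^esub> \<and>
    eigensum X a UNIV = carrier (alg X) \<and>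
    (\<forall>v\<in>carrier (alg X).
       v \<ominus>\<^bsub>alg X\<^esub> (l v \<odot>\<^bsub>alg X\<^esub> a) \<in> eigensum X a {Ev0, EvAlpha, EvBeta}) \<and>
    (\<forall>d e. \<forall>v\<in>eigenspace X a d. \<forall>w\<in>eigenspace X a e.
       v \<otimes>\<^bsub>alg X\<^esub> w \<in> eigensum X a (fusion d e))"

definition axial_algebra :: "('r, 'v) axial_data \<Rightarrow> bool"
  where "axial_algebra X \<longleftrightarrow>
    nonassoc_comm_algebra (scal X) (alg X) \<and>
    str X \<in> ring_hom Dhat (scal X) \<and>
    primitive_axis X (axis0 X) (lam0 X) \<and>
    primitive_axis X (axis1 X) (lam1 X) \<and>
    (\<forall>W. subalgebra W (scal X) (alg X) \<and> axis0 X \<in> W \<and> axis1 X \<in> W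
       \<longrightarrow> W = carrier (alg X))"


section \<open>The universal algebra\<close>

definition axial_morphism ::
    "('r, 'v) axial_data \<Rightarrow> ('s, 'w) axial_data \<Rightarrow> ('r \<Rightarrow> 's) \<Rightarrow> ('v \<Rightarrow> 'w) \<Rightarrow> bool"
  where "axial_morphism X Y \<phi> \<psi> \<longleftrightarrow>
    \<phi> \<in> ring_hom (scal X) (scal Y) \<and>
    (\<forall>d\<in>carrier Dhat. \<phi> (str X d) = str Y d) \<and>
    (\<forall>v\<in>carrier (alg X). \<psi> v \<in> carrier (alg Y)) \<and>
    (\<forall>v\<in>carrier (alg X). \<forall>w\<in>carrier (alg X).
       \<psi> (v \<oplus>\<^bsub>alg X\<^esub> w) = \<psi> v \<oplus>\<^bsub>alg Y\<^esub> \<psi> w \<and>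
       \<psi> (v \<otimes>\<^bsub>alg X\<^esub> w) = \<psi> v \<otimes>\<^bsub>alg Y\<^esub> \<psi> w) \<and>
    (\<forall>r\<in>carrier (scal X). \<forall>v\<in>carrier (alg X).
       \<psi> (r \<odot>\<^bsub>alg X\<^esub> v) = \<phi> r \<odot>\<^bsub>alg Y\<^esub> \<psi> v) \<and>
    \<psi> (axis0 X) = axis0 Y \<and> \<psi> (axis1 X) = axis1 Y \<and>
    (\<forall>v\<in>carrier (alg X).
       lam0 Y (\<psi> v) = \<phi> (lam0 X v) \<and> lam1 Y (\<psi> v) = \<phi> (lam1 X v))"

text \<open>Initiality is tested against the objects carried by the same pair of types. Up to
  isomorphism this is the initial object of the whole category: that object is generated by
  countably many elements and operations, hence is countable, hence has a copy carried by any two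
  infinite types, and initial objects on the same types are isomorphic. Infinite types lose nothing:
  the ring \<open>R = \<rat>(\<beta>)\<close> with \<open>V = R\<close> and both axes equal to \<open>1\<close> is an object, so both components of
  the initial object are infinite.\<close>

definition universal_algebra :: "('r::infinite, 'v::infinite) axial_data \<Rightarrow> bool"
  where "universal_algebra X \<longleftrightarrow>
    axial_algebra X \<and>
    (\<forall>Y :: ('r, 'v) axial_data. axial_algebra Y \<longrightarrow>
      (\<exists>\<phi> \<psi>. axial_morphism X Y \<phi> \<psi>) \<and>
      (\<forall>\<phi> \<psi> \<phi>' \<psi>'. axial_morphism X Y \<phi> \<psi> \<and> axial_morphism X Y \<phi>' \<psi>' \<longrightarrow>
        (\<forall>r\<in>carrier (scal X). \<phi> r = \<phi>' r) \<and> (\<forall>v\<in>carrier (alg X). \<psi> v = \<psi>' v)))"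


section \<open>Miyamoto involutions and the axes they generate\<close>

text \<open>Members of \<open>Bij S\<close> are undefined outside \<open>S\<close>, which makes the map below unique.\<close>

definition miyamoto :: "('r, 'v) axial_data \<Rightarrow> 'v \<Rightarrow> 'v \<Rightarrow> 'v"
  where "miyamoto X a = (THE t. t \<in> Bij (carrier (alg X)) \<and>
    (\<forall>v\<in>carrier (alg X). \<forall>w\<in>carrier (alg X).
       t (v \<oplus>\<^bsub>alg X\<^esub> w) = t v \<oplus>\<^bsub>alg X\<^esub> t w \<and>
       t (v \<otimes>\<^bsub>alg X\<^esub> w) = t v \<otimes>\<^bsub>alg X\<^esub> t w) \<and>
    (\<forall>r\<in>carrier (scal X). \<forall>v\<in>carrier (alg X).
       t (r \<odot>\<^bsub>alg X\<^esub> v) = r \<odot>\<^bsub>alg X\<^esub> t v) \<and>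
    (\<forall>v\<in>eigensum X a {Ev1, Ev0, EvAlpha}. t v = v) \<and>
    (\<forall>v\<in>eigenspace X a EvBeta. t v = \<ominus>\<^bsub>alg X\<^esub> v))"

text \<open>The product of \<open>BijGroup\<close> is composition of functions applied on the left, whereas
  \<open>\<rho> = \<tau>\<^sub>0 \<tau>\<^sub>1\<close> acts on the right (first \<open>\<tau>\<^sub>0\<close>, then \<open>\<tau>\<^sub>1\<close>); hence the order of the factors.\<close>

definition rho :: "('r, 'v) axial_data \<Rightarrow> 'v \<Rightarrow> 'v"
  where "rho X = miyamoto X (axis1 X) \<otimes>\<^bsub>BijGroup (carrier (alg X))\<^esub> miyamoto X (axis0 X)"

definition ax :: "('r, 'v) axial_data \<Rightarrow> int \<Rightarrow> 'v"
  where "ax X n = (rho X [^]\<^bsub>BijGroup (carrier (alg X))\<^esub> (n div 2))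
    (if even n then axis0 X else axis1 X)"

definition s0 :: "('r, 'v) axial_data \<Rightarrow> int \<Rightarrow> 'v"
  where "s0 X n = (axis0 X \<otimes>\<^bsub>alg X\<^esub> ax X n) \<ominus>\<^bsub>alg X\<^esub>
    (str X beta \<odot>\<^bsub>alg X\<^esub> (axis0 X \<oplus>\<^bsub>alg X\<^esub> ax X n))"

definition spans :: "'r ring \<Rightarrow> ('r, 'v) module \<Rightarrow> 'v set \<Rightarrow> bool"
  where "spans R V S \<longleftrightarrow> S \<subseteq> carrier V \<and>
    carrier V = {finsum V (\<lambda>x. c x \<odot>\<^bsub>V\<^esub> x) A |c A.
      finite A \<and> A \<subseteq> S \<and> (\<forall>x\<in>A. c x \<in> carrier R)}"

end

theory Submission
  imports Defs "HOL.Modules"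
begin

text \<open>Let \<open>\<tau>\<close> be the Miyamoto involution of an axis \<open>a\<close>, and let \<open>\<sigma>\<close> be the linear map that fixes
  \<open>V\<^sub>1 + V\<^sub>0\<close>, negates \<open>V\<^sub>\<alpha>\<close> and kills \<open>V\<^sub>\<beta>\<close>. On the elements fixed by \<open>\<tau>\<close> it is multiplicative, and since
  \<open>\<alpha> = 2 \<beta>\<close> it is given by \<open>v - (a v - \<lambda>(v) a) / \<beta>\<close> everywhere. For \<open>a = a\<^sub>0\<close> it interchanges
  \<open>a\<^sub>n + a\<^bsub>-n\<^esub>\<close> and a multiple of \<open>s\<^bsub>0,n\<^esub>\<close> modulo \<open>a\<^sub>0\<close>. The elements \<open>s\<^bsub>0,1\<^esub>\<close>, \<open>s\<^bsub>0,2\<^esub>\<close>, \<open>s\<^bsub>1,2\<^esub>\<close> are fixed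
  by all \<open>\<tau>\<^sub>i\<close>, so products with them can be computed with \<open>\<sigma>\<^sub>0\<close> and with \<open>\<sigma>\<^sub>1\<close>.
  The product \<open>s\<^bsub>0,1\<^esub> s\<^bsub>0,2\<^esub>\<close> is invariant under \<open>\<tau>\<^sub>0\<close>, but its expansion is not visibly so: this is a recursion
  of length seven for the \<open>a\<^sub>n\<close>, with invertible outer coefficients. Evaluating further products in two ways gives
  linear relations between \<open>s\<^bsub>0,2\<^esub>\<close> and \<open>s\<^bsub>1,2\<^esub>\<close> modulo the span of the \<open>a\<^sub>n\<close>, \<open>s\<^bsub>0,1\<^esub>\<close> and \<open>s\<^bsub>0,3\<^esub>\<close>. Their coefficients are
  polynomials in \<open>\<lambda>\<^bsub>a\<^sub>0\<^esub>(a\<^sub>1)\<close> and \<open>\<lambda>\<^bsub>a\<^sub>1\<^esub>(a\<^sub>0)\<close> that generate the unit ideal, so both elements lie in this span, which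
  is then closed under multiplication.\<close>

section \<open>Axes and their Miyamoto involutions\<close>

text \<open>The tool behind every computation: \<sigma> squares to the identity on the elements
  fixed by \<tau>, so a product of two such elements x, y equals \<sigma>(\<sigma>(x) \<sigma>(y)).
  Here \<sigma>_0 replaces s_{0,n} by a_n + a_{-n} modulo a_0, and products of axes only bring in
  elements s_{i,n} again. The obstacle is that no scalar built from the two form values can be
  divided by: R is an arbitrary ring, and these values satisfy no assumed relation. Linear relations
  therefore cannot be solved one after the other; the scalars that multiply s_{0,2} into the target
  span are collected in an ideal, which is shown to contain 1. An algebra need not have an
  automorphism exchanging its axes. What is symmetric is the set of hypotheses, under the reflection
  n -> 1 - n of the indices: each formula for a_0 has a mirror image for a_1, with the two form
  values exchanged, and most relations come in such pairs.\<close>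

text \<open>The ambient commutative ring is the square-zero extension \<open>R \<oplus> V\<close>, in which \<open>V\<close> is an ideal. Scalar
  multiplication is then ring multiplication and linear identities in \<open>V\<close> are ring identities. The constants are
  \<open>d = \<beta> / 2\<close> and \<open>c = 1 / \<beta>\<close>; halving \<open>\<beta>\<close> keeps the coefficients of all later formulas integral.\<close>

locale square_zero_algebra =
  fixes V :: "'e::comm_ring_1 set" and dot :: "'e \<Rightarrow> 'e \<Rightarrow> 'e" (infixl "\<bullet>" 70) and d c :: 'e
  assumes V_zero [simp]: "0 \<in> V"
    and V_add [simp]: "\<lbrakk>x \<in> V; y \<in> V\<rbrakk> \<Longrightarrow> x + y \<in> V"
    and V_mult [simp]: "x \<in> V \<Longrightarrow> r * x \<in> V"
    and dot_closed [simp]: "\<lbrakk>x \<in> V; y \<in> V\<rbrakk> \<Longrightarrow> x \<bullet> y \<in> V"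
    and dot_comm: "x \<bullet> y = y \<bullet> x"
    and dot_add_left: "(x + y) \<bullet> z = x \<bullet> z + y \<bullet> z"
    and dot_mult_left: "x \<in> V \<Longrightarrow> (r * x) \<bullet> y = r * (x \<bullet> y)"
    and inv_2d: "2 * d * c = 1"
    and unit_1_2d: "1 - 2 * d dvd 1"
    and unit_1_4d: "1 - 4 * d dvd 1"
begin

lemma V_uminus [simp]: "x \<in> V \<Longrightarrow> - x \<in> V"
  using V_mult[of x "-1"] by simp

lemma V_diff [simp]: "\<lbrakk>x \<in> V; y \<in> V\<rbrakk> \<Longrightarrow> x - y \<in> V"
  using V_add[of x "- y"] by simp

lemma dot_add_right: "x \<bullet> (y + z) = x \<bullet> y + x \<bullet> z"
  by (metis dot_comm dot_add_left)

lemma dot_mult_right: "y \<in> V \<Longrightarrow> x \<bullet> (r * y) = r * (x \<bullet> y)"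
  by (metis dot_comm dot_mult_left)

lemma dot_zero [simp]: "0 \<bullet> x = 0" "x \<bullet> 0 = 0"
  using dot_add_left[of 0 0 x] dot_add_right[of x 0 0] by auto

lemma dot_uminus: "(- x) \<bullet> y = - (x \<bullet> y)" "x \<bullet> (- y) = - (x \<bullet> y)"
  using dot_add_left[of "- x" x y] dot_add_right[of x "- y" y]
  by (simp_all add: eq_neg_iff_add_eq_0)

lemma dot_diff: "(x - y) \<bullet> z = x \<bullet> z - y \<bullet> z" "x \<bullet> (y - z) = x \<bullet> y - x \<bullet> z"
  using dot_add_left[of x "- y" z] dot_add_right[of x y "- z"] by (simp_all add: dot_uminus)

lemmas dot_simps = dot_add_left dot_add_right dot_diff dot_uminus dot_mult_left dot_mult_right

lemma unit_cancel:
  assumes "u dvd (1::'e)" "u * x = 0" shows "x = 0"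
proof -
  obtain k where "1 = u * k" using assms(1) by (elim dvdE)
  then have "x = k * (u * x)" by (metis mult.assoc mult.commute mult_1)
  then show ?thesis using assms(2) by simp
qed

lemma unit_2: "2 dvd (1::'e)" and unit_d: "d dvd 1"
  using inv_2d by (auto simp: dvd_def algebra_simps intro: exI[of _ "d * c"] exI[of _ "2 * c"])

lemma unit_mult: "\<lbrakk>u dvd (1::'e); v dvd 1\<rbrakk> \<Longrightarrow> u * v dvd 1"
  using mult_dvd_mono[of u 1 v 1] by simp

end

text \<open>The form \<open>l\<close> takes values in the extension, whose unit need not be that of \<open>R\<close> and whose elements have a
  component in \<open>V\<close>. So its normalisation and homogeneity are only required after multiplication by \<open>a\<close>.\<close>

locale axis = square_zero_algebra V dot d c
  for V :: "'e::comm_ring_1 set" and dot (infixl "\<bullet>" 70) and d c +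
  fixes a :: 'e and l :: "'e \<Rightarrow> 'e"
  assumes a_V [simp]: "a \<in> V" and a_idem: "a \<bullet> a = a"
    and l_add: "\<lbrakk>x \<in> V; y \<in> V\<rbrakk> \<Longrightarrow> l (x + y) = l x + l y"
    and l_mult: "x \<in> V \<Longrightarrow> l (r * x) * a = r * (l x * a)"
    and l_a: "l a * a = a"
    and decomposition: "v \<in> V \<Longrightarrow> \<exists>x\<in>V. \<exists>y\<in>V. \<exists>z\<in>V.
      a \<bullet> x = 0 \<and> a \<bullet> y = 4 * d * y \<and> a \<bullet> z = 2 * d * z \<and> v = l v * a + x + y + z"
    and fusion_0_0: "\<lbrakk>x \<in> V; x' \<in> V; a \<bullet> x = 0; a \<bullet> x' = 0\<rbrakk> \<Longrightarrow> a \<bullet> (x \<bullet> x') = 0"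
    and fusion_0_alpha: "\<lbrakk>x \<in> V; y \<in> V; a \<bullet> x = 0; a \<bullet> y = 4 * d * y\<rbrakk> \<Longrightarrow>
      a \<bullet> (x \<bullet> y) = 4 * d * (x \<bullet> y)"
    and fusion_0_beta: "\<lbrakk>x \<in> V; z \<in> V; a \<bullet> x = 0; a \<bullet> z = 2 * d * z\<rbrakk> \<Longrightarrow>
      a \<bullet> (x \<bullet> z) = 2 * d * (x \<bullet> z)"
    and fusion_alpha_alpha: "\<lbrakk>y \<in> V; y' \<in> V; a \<bullet> y = 4 * d * y; a \<bullet> y' = 4 * d * y'\<rbrakk> \<Longrightarrow>
      \<exists>t\<in>V. \<exists>x\<in>V. a \<bullet> t = t \<and> a \<bullet> x = 0 \<and> y \<bullet> y' = t + x"
    and fusion_alpha_beta: "\<lbrakk>y \<in> V; z \<in> V; a \<bullet> y = 4 * d * y; a \<bullet> z = 2 * d * z\<rbrakk> \<Longrightarrow>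
      a \<bullet> (y \<bullet> z) = 2 * d * (y \<bullet> z)"
    and fusion_beta_beta: "\<lbrakk>z \<in> V; z' \<in> V; a \<bullet> z = 2 * d * z; a \<bullet> z' = 2 * d * z'\<rbrakk> \<Longrightarrow>
      \<exists>t\<in>V. \<exists>x\<in>V. \<exists>y\<in>V. a \<bullet> t = t \<and> a \<bullet> x = 0 \<and> a \<bullet> y = 4 * d * y \<and> z \<bullet> z' = t + x + y"
begin

text \<open>All differences of the eigenvalues 1, 0, 4d, 2d are units. With T for multiplication by
  \<open>a\<close>, the polynomial T(T - 2d)(T - 4d) kills \<open>x\<close>, \<open>y\<close>,
  \<open>z\<close> and has the unit value (1 - 2d)(1 - 4d) at 1. Once \<open>t\<close> is gone, T(T
  - 2d), with value 8dd at 4d, isolates \<open>y\<close>.\<close>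

lemma eigen_independent:
  assumes V: "t \<in> V" "x \<in> V" "y \<in> V" "z \<in> V"
    and e: "a \<bullet> t = t" "a \<bullet> x = 0" "a \<bullet> y = 4 * d * y" "a \<bullet> z = 2 * d * z"
    and sum: "t + x + y + z = 0"
  shows "t = 0" "x = 0" "y = 0" "z = 0"
proof -
  have 1: "t + 4 * d * y + 2 * d * z = 0"
    using arg_cong[OF sum, of "\<lambda>v. a \<bullet> v"] V e by (simp add: dot_simps)
  have 2: "t + 4 * d * (4 * d * y) + 2 * d * (2 * d * z) = 0"
    using arg_cong[OF 1, of "\<lambda>v. a \<bullet> v"] V e by (simp add: dot_simps)
  have 3: "t + 4 * d * (4 * d * (4 * d * y)) + 2 * d * (2 * d * (2 * d * z)) = 0"
    using arg_cong[OF 2, of "\<lambda>v. a \<bullet> v"] V e by (simp add: dot_simps)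
  have "(1 - 2 * d) * ((1 - 4 * d) * t) =
      (t + 4 * d * (4 * d * (4 * d * y)) + 2 * d * (2 * d * (2 * d * z)))
      - 6 * d * (t + 4 * d * (4 * d * y) + 2 * d * (2 * d * z))
      + 8 * d * d * (t + 4 * d * y + 2 * d * z)"
    by (simp add: algebra_simps)
  then have "(1 - 2 * d) * ((1 - 4 * d) * t) = 0" unfolding 1 2 3 by simp
  then show t: "t = 0" using unit_cancel unit_1_2d unit_1_4d by blast
  have "(2 * d) * ((2 * (2 * d)) * y) =
      (t + 4 * d * (4 * d * y) + 2 * d * (2 * d * z)) - 2 * d * (t + 4 * d * y + 2 * d * z)
      - (1 - 2 * d) * t"
    by (simp add: algebra_simps)
  then have "(2 * d) * ((2 * (2 * d)) * y) = 0" unfolding 1 2 using t by simp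
  then show y: "y = 0" using unit_cancel unit_mult[OF unit_2 unit_d] unit_2 unit_mult by blast
  have "(2 * d) * z = 0" using 1 t y by simp
  then show z: "z = 0" using unit_cancel unit_mult[OF unit_2 unit_d] by blast
  show "x = 0" using sum t y z by simp
qed

text \<open>The axiom only says that some decomposition of \<open>v\<close> has 1-component
  \<open>l v * a\<close>. Subtracting the given decomposition from it yields a decomposition of 0,
  to which independence applies.\<close>

lemma l_zero_eigen:
  assumes "x \<in> V" "y \<in> V" "z \<in> V" "a \<bullet> x = 0" "a \<bullet> y = 4 * d * y" "a \<bullet> z = 2 * d * z"
  shows "l (x + y + z) * a = 0"
proof -
  let ?v = "x + y + z"
  have v: "?v \<in> V" using assms by simp
  obtain x' y' z' where "x' \<in> V" "y' \<in> V" "z' \<in> V" "a \<bullet> x' = 0" "a \<bullet> y' = 4 * d * y'"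
    "a \<bullet> z' = 2 * d * z'" "?v = l ?v * a + x' + y' + z'"
    using decomposition[OF v] by blast
  moreover from this(7) have "l ?v * a + (x' - x) + (y' - y) + (z' - z) = 0"
    by (simp add: algebra_simps)
  ultimately show ?thesis
    using assms eigen_independent(1)[of "l ?v * a" "x' - x" "y' - y" "z' - z"]
    by (simp add: dot_simps a_idem right_diff_distrib)
qed

text \<open>This is primitivity: the 1-eigenspace consists of multiples of \<open>a\<close>, because
  \<open>l t * a - t\<close> is the 1-component of a decomposition of 0.\<close>

lemma eigen_1:
  assumes "t \<in> V" "a \<bullet> t = t" shows "t = l t * a"
proof -
  obtain x y z where *: "x \<in> V" "y \<in> V" "z \<in> V" "a \<bullet> x = 0" "a \<bullet> y = 4 * d * y"
    "a \<bullet> z = 2 * d * z" "t = l t * a + x + y + z"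
    using decomposition[OF assms(1)] by blast
  have "l t * a - t + x + y + z = 0" using *(7) by (simp add: algebra_simps)
  then have "l t * a - t = 0"
    using eigen_independent(1)[of "l t * a - t" x y z] * assms by (simp add: dot_simps a_idem)
  then show ?thesis by simp
qed

lemma l_diff: "\<lbrakk>x \<in> V; y \<in> V\<rbrakk> \<Longrightarrow> l (x - y) = l x - l y"
  using l_add[of "x - y" y] by simp

text \<open>Acts as 0 on V_1 and V_0, as 2 on V_\<alpha> and as 1 on V_\<beta>; the value 2 is the
  quotient \<alpha> / \<beta>.\<close>

definition dev :: "'e \<Rightarrow> 'e"
  where "dev v = c * (a \<bullet> v - l v * a)"

definition sig :: "'e \<Rightarrow> 'e"
  where "sig v = v - dev v"

text \<open>The Miyamoto involution as a polynomial in T = \<open>dev\<close>: 1 - 4T + 2TT takes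
  the values 1, 1, -1 at T = 0, 2, 1. No eigencomponents have to be chosen, and linearity is
  inherited from \<open>dev\<close>.\<close>

definition tau :: "'e \<Rightarrow> 'e"
  where "tau v = v - 4 * dev v + 2 * dev (dev v)"

lemma dev_V [simp]: "v \<in> V \<Longrightarrow> dev v \<in> V"
  by (simp add: dev_def)

lemma sig_V [simp]: "v \<in> V \<Longrightarrow> sig v \<in> V" and tau_V [simp]: "v \<in> V \<Longrightarrow> tau v \<in> V"
  by (simp_all add: sig_def tau_def)

lemma dev_add: "\<lbrakk>x \<in> V; y \<in> V\<rbrakk> \<Longrightarrow> dev (x + y) = dev x + dev y"
  and dev_mult: "x \<in> V \<Longrightarrow> dev (r * x) = r * dev x"
proof -
  show "x \<in> V \<Longrightarrow> y \<in> V \<Longrightarrow> dev (x + y) = dev x + dev y"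
    by (simp add: dev_def dot_simps l_add algebra_simps)
  assume "x \<in> V"
  then have "dev (r * x) = c * (r * (a \<bullet> x) - r * (l x * a))"
    unfolding dev_def by (simp only: dot_mult_right l_mult)
  then show "dev (r * x) = r * dev x"
    by (simp add: dev_def algebra_simps)
qed

lemma sig_add: "\<lbrakk>x \<in> V; y \<in> V\<rbrakk> \<Longrightarrow> sig (x + y) = sig x + sig y"
  and tau_add: "\<lbrakk>x \<in> V; y \<in> V\<rbrakk> \<Longrightarrow> tau (x + y) = tau x + tau y"
  by (simp_all add: sig_def tau_def dev_add algebra_simps)

lemma sig_mult: "x \<in> V \<Longrightarrow> sig (r * x) = r * sig x"
  and tau_mult: "x \<in> V \<Longrightarrow> tau (r * x) = r * tau x"
  by (simp_all add: sig_def tau_def dev_mult algebra_simps)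

lemma sig_uminus: "x \<in> V \<Longrightarrow> sig (- x) = - sig x"
  and tau_uminus: "x \<in> V \<Longrightarrow> tau (- x) = - tau x"
  using sig_mult[of x "-1"] tau_mult[of x "-1"] by simp_all

lemma sig_diff: "\<lbrakk>x \<in> V; y \<in> V\<rbrakk> \<Longrightarrow> sig (x - y) = sig x - sig y"
  and tau_diff: "\<lbrakk>x \<in> V; y \<in> V\<rbrakk> \<Longrightarrow> tau (x - y) = tau x - tau y"
  using sig_add[of x "- y"] tau_add[of x "- y"] by (simp_all add: sig_uminus tau_uminus)

lemmas sig_linear = sig_add sig_diff sig_mult sig_uminus
lemmas tau_linear = tau_add tau_diff tau_mult tau_uminus

lemma c_cancel [simp]: "c * (2 * d * x) = x"
  using inv_2d by (metis mult.assoc mult.commute mult.left_neutral)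

lemma a_dot: "v \<in> V \<Longrightarrow> a \<bullet> v = l v * a + 2 * d * (v - sig v)"
proof -
  have "2 * d * (c * (a \<bullet> v - l v * a)) = a \<bullet> v - l v * a"
    by (metis inv_2d mult.assoc mult_1)
  then show ?thesis by (simp add: sig_def dev_def)
qed

lemma l_kernel:
  assumes "x \<in> V" "y \<in> V" "z \<in> V" "a \<bullet> x = 0" "a \<bullet> y = 4 * d * y" "a \<bullet> z = 2 * d * z"
  shows "l x * a = 0" "l y * a = 0" "l z * a = 0"
  using l_zero_eigen[of x 0 0] l_zero_eigen[of 0 y 0] l_zero_eigen[of 0 0 z] assms by simp_all

lemma sig_tau_eigen:
  assumes "x \<in> V" "y \<in> V" "z \<in> V" "a \<bullet> x = 0" "a \<bullet> y = 4 * d * y" "a \<bullet> z = 2 * d * z"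
  shows "sig x = x" "sig y = - y" "sig z = 0" "sig a = a"
    and "tau x = x" "tau y = y" "tau z = - z" "tau a = a"
proof -
  note l0 = l_kernel[OF assms]
  have "c * (4 * d * y) = 2 * y"
    using c_cancel[of "2 * y"] by (simp add: mult_ac)
  then have "dev x = 0" "dev y = 2 * y" "dev z = z" "dev a = 0"
    using assms l0 by (simp_all add: dev_def a_idem l_a)
  moreover have "dev 0 = 0" using dev_mult[of 0 0] by simp
  ultimately show "sig x = x" "sig y = - y" "sig z = 0" "sig a = a"
    "tau x = x" "tau y = y" "tau z = - z" "tau a = a"
    using assms by (simp_all add: sig_def tau_def dev_mult)
qed

lemma decomposition_sig_tau:
  assumes "v \<in> V"
  obtains x y z where "x \<in> V" "y \<in> V" "z \<in> V" "a \<bullet> x = 0" "a \<bullet> y = 4 * d * y" "a \<bullet> z = 2 * d * z"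
    "v = l v * a + x + y + z" "sig v = l v * a + x - y" "tau v = l v * a + x + y - z"
proof -
  obtain x y z where *: "x \<in> V" "y \<in> V" "z \<in> V" "a \<bullet> x = 0" "a \<bullet> y = 4 * d * y"
    "a \<bullet> z = 2 * d * z" "v = l v * a + x + y + z"
    using decomposition[OF assms] by blast
  define k where "k = l v"
  have v: "v = k * a + x + y + z" using *(7) by (simp add: k_def)
  have "sig v = k * a + x - y" "tau v = k * a + x + y - z"
    unfolding v using * sig_tau_eigen[OF *(1-6)] by (simp_all add: sig_linear tau_linear)
  then show ?thesis using that[of x y z] * unfolding k_def by blast
qed

text \<open>All five identities are read off from the eigencomponents. The last one says that the
  square of \<open>sig\<close>, with eigenvalues 1, 1, 1, 0, is the projection (1 +
  \<open>tau\<close>)/2 onto the elements fixed by \<open>tau\<close>.\<close>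

lemma tau_tau [simp]: "v \<in> V \<Longrightarrow> tau (tau v) = v"
  and sig_tau [simp]: "v \<in> V \<Longrightarrow> sig (tau v) = sig v"
  and l_sig: "v \<in> V \<Longrightarrow> l (sig v) * a = l v * a"
  and tau_sig [simp]: "v \<in> V \<Longrightarrow> tau (sig v) = sig v"
  and sig_sig: "v \<in> V \<Longrightarrow> 2 * sig (sig v) = v + tau v"
proof -
  assume "v \<in> V"
  then obtain x y z where *: "x \<in> V" "y \<in> V" "z \<in> V" "a \<bullet> x = 0" "a \<bullet> y = 4 * d * y" "a \<bullet> z = 2 * d * z"
    and vd: "v = l v * a + x + y + z" "sig v = l v * a + x - y" "tau v = l v * a + x + y - z"
    using decomposition_sig_tau by blast
  define k where "k = l v"
  note v = vd[folded k_def]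
  note e = sig_tau_eigen[OF *] l_kernel[OF *]
  show "tau (tau v) = v" unfolding v(3) by (subst v(1)) (simp add: tau_linear * e)
  show "sig (tau v) = sig v" unfolding v(2,3) by (simp add: sig_linear * e)
  show "tau (sig v) = sig v" unfolding v(2) by (simp add: tau_linear * e)
  have "2 * sig (sig v) = 2 * (k * a + x + y)" unfolding v(2) by (simp add: sig_linear * e)
  also have "\<dots> = v + tau v" unfolding v(3) by (subst v(1)) (simp add: algebra_simps)
  finally show "2 * sig (sig v) = v + tau v" .
  show "l (sig v) * a = l v * a"
    unfolding v(2) k_def[symmetric] by (simp add: l_add l_diff l_mult * e ring_distribs l_a)
qed

lemma sig_sig_fixed: "\<lbrakk>v \<in> V; tau v = v\<rbrakk> \<Longrightarrow> sig (sig v) = v"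
  using sig_sig[of v] unit_cancel[OF unit_2, of "sig (sig v) - v"] by (simp add: algebra_simps)

lemma tau_minus_eigen:
  assumes "v \<in> V" "tau v = - v" shows "a \<bullet> v = 2 * d * v"
proof -
  obtain x y z where *: "x \<in> V" "y \<in> V" "z \<in> V" "a \<bullet> x = 0" "a \<bullet> y = 4 * d * y" "a \<bullet> z = 2 * d * z"
    and vd: "v = l v * a + x + y + z" "tau v = l v * a + x + y - z"
    using decomposition_sig_tau[OF assms(1)] by blast
  have "2 * (v - z) = v + tau v" unfolding vd(2) by (subst (1 2) vd(1)) (simp add: algebra_simps)
  then have "2 * (v - z) = 0" using assms by simp
  then have "v - z = 0" using unit_cancel[OF unit_2] by blast
  then show ?thesis using * by simp
qed

lemma tau_plus_decomposition:
  assumes "v \<in> V" "tau v = v"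
  obtains k x y where "x \<in> V" "y \<in> V" "a \<bullet> x = 0" "a \<bullet> y = 4 * d * y" "v = k * a + x + y"
    "sig v = k * a + x - y"
proof -
  obtain x y z where *: "x \<in> V" "y \<in> V" "z \<in> V" "a \<bullet> x = 0" "a \<bullet> y = 4 * d * y" "a \<bullet> z = 2 * d * z"
    and vd: "v = l v * a + x + y + z" "sig v = l v * a + x - y" "tau v = l v * a + x + y - z"
    using decomposition_sig_tau[OF assms(1)] by blast
  have "2 * z = v - tau v" unfolding vd(3) by (subst vd(1)) simp
  then have "2 * z = 0" using assms by simp
  then have "z = 0" using unit_cancel[OF unit_2] by blast
  then show ?thesis using that[of x y "l v"] * vd by simp
qed

text \<open>The fusion law grades V_1 + V_0 + V_\<alpha> by the group of order two, with odd part
  V_\<alpha>; \<open>sig\<close> is the involution of this grading, hence multiplicative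
  there.\<close>

lemma dot_plus_plus:
  assumes "v \<in> V" "w \<in> V" "tau v = v" "tau w = w"
  shows "tau (v \<bullet> w) = v \<bullet> w" and "sig (v \<bullet> w) = sig v \<bullet> sig w"
proof -
  obtain k x y where v: "x \<in> V" "y \<in> V" "a \<bullet> x = 0" "a \<bullet> y = 4 * d * y" "v = k * a + x + y"
    "sig v = k * a + x - y"
    using tau_plus_decomposition[OF assms(1,3)] .
  obtain k' x' y' where w: "x' \<in> V" "y' \<in> V" "a \<bullet> x' = 0" "a \<bullet> y' = 4 * d * y'"
    "w = k' * a + x' + y'" "sig w = k' * a + x' - y'"
    using tau_plus_decomposition[OF assms(2,4)] .
  obtain t x'' where "t \<in> V" "a \<bullet> t = t" and t: "x'' \<in> V" "a \<bullet> x'' = 0" and "y \<bullet> y' = t + x''"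
    using fusion_alpha_alpha[OF v(2) w(2) v(4) w(4)] by blast
  \<comment> \<open>By primitivity the 1-component of \<open>y \<bullet> y'\<close> is a multiple of
    \<open>a\<close>, so the product again splits as a multiple of \<open>a\<close>, a 0-part and an
    \<alpha>-part.\<close>
  moreover define m where "m = l t"
  ultimately have yy: "y \<bullet> y' = m * a + x''" using eigen_1 by metis
  have comm: "x \<bullet> a = 0" "y \<bullet> a = 4 * d * y" using v dot_comm by metis+
  have vw: "v \<bullet> w = (k * k' + m) * a + (x \<bullet> x' + x'')
      + (4 * d * (k * y' + k' * y) + x \<bullet> y' + y \<bullet> x')"
    unfolding v(5) w(5) using v(1-4) w(1-4) comm t
    by (simp add: dot_simps yy a_idem) (simp add: algebra_simps)
  have X: "x \<bullet> x' + x'' \<in> V" "a \<bullet> (x \<bullet> x' + x'') = 0"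
    using v w t by (simp_all add: dot_add_right fusion_0_0)
  have yx: "a \<bullet> (y \<bullet> x') = 4 * d * (y \<bullet> x')"
    using fusion_0_alpha[of x' y] v w dot_comm by metis
  have Y: "4 * d * (k * y' + k' * y) + x \<bullet> y' + y \<bullet> x' \<in> V"
    "a \<bullet> (4 * d * (k * y' + k' * y) + x \<bullet> y' + y \<bullet> x') =
      4 * d * (4 * d * (k * y' + k' * y) + x \<bullet> y' + y \<bullet> x')"
    using v(1-4) w(1-4) by (simp_all add: dot_simps fusion_0_alpha yx) (simp add: algebra_simps)
  have "sig (r * a + p + q) = r * a + p - q" "tau (r * a + p + q) = r * a + p + q"
    if "p \<in> V" "q \<in> V" "a \<bullet> p = 0" "a \<bullet> q = 4 * d * q" for r p q
    using that sig_tau_eigen[of p q 0] by (simp_all add: sig_linear tau_linear)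
  note e = this[OF X(1) Y(1) X(2) Y(2)]
  show "tau (v \<bullet> w) = v \<bullet> w"
    unfolding vw by (rule e)
  have "sig (v \<bullet> w) = (k * k' + m) * a + (x \<bullet> x' + x'')
      - (4 * d * (k * y' + k' * y) + x \<bullet> y' + y \<bullet> x')"
    unfolding vw by (rule e)
  also have "\<dots> = sig v \<bullet> sig w"
    unfolding v(6) w(6) using v(1-4) w(1-4) comm t
    by (simp add: dot_simps yy a_idem) (simp add: algebra_simps)
  finally show "sig (v \<bullet> w) = sig v \<bullet> sig w" .
qed

lemma dot_plus_minus:
  assumes "v \<in> V" "w \<in> V" "tau v = v" "tau w = - w"
  shows "tau (v \<bullet> w) = - (v \<bullet> w)"
proof -
  obtain k x y where v: "x \<in> V" "y \<in> V" "a \<bullet> x = 0" "a \<bullet> y = 4 * d * y" "v = k * a + x + y"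
    using tau_plus_decomposition[OF assms(1,3)] by blast
  have w: "a \<bullet> w = 2 * d * w" using tau_minus_eigen assms by blast
  have "a \<bullet> (v \<bullet> w) = 2 * d * (v \<bullet> w)"
    unfolding v(5) using v(1-4) w assms(2)
    by (simp add: dot_simps fusion_0_beta fusion_alpha_beta) (simp add: algebra_simps)
  then show ?thesis
    using sig_tau_eigen(7)[of 0 0 "v \<bullet> w"] assms by simp
qed

lemma dot_minus_minus:
  assumes "v \<in> V" "w \<in> V" "tau v = - v" "tau w = - w"
  shows "tau (v \<bullet> w) = v \<bullet> w"
proof -
  have "a \<bullet> v = 2 * d * v" "a \<bullet> w = 2 * d * w" using tau_minus_eigen assms by blast+
  then obtain t x y where t: "t \<in> V" "x \<in> V" "y \<in> V" "a \<bullet> t = t" "a \<bullet> x = 0" "a \<bullet> y = 4 * d * y"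
    and vw: "v \<bullet> w = t + x + y"
    using fusion_beta_beta[OF assms(1,2)] by blast
  have "tau t = t"
    using eigen_1[OF t(1,4)] sig_tau_eigen(8)[of 0 0 0] tau_mult[of a "l t"] by simp
  then show ?thesis
    unfolding vw using t sig_tau_eigen(5,6)[of x y 0] by (simp add: tau_add)
qed

text \<open>The fusion law also grades V by the group of order two, with odd part V_\<beta>. The
  preceding lemmas treat the even and odd parts; multiplying everything by 4 avoids writing these
  parts with halves.\<close>

theorem tau_dot:
  assumes "v \<in> V" "w \<in> V" shows "tau (v \<bullet> w) = tau v \<bullet> tau w"
proof -
  define v1 v2 w1 w2 where "v1 = v + tau v" and "v2 = v - tau v"
    and "w1 = w + tau w" and "w2 = w - tau w"
  note defs = this
  have in_V: "v1 \<in> V" "v2 \<in> V" "w1 \<in> V" "w2 \<in> V" using assms by (simp_all add: defs)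
  have t: "tau v1 = v1" "tau v2 = - v2" "tau w1 = w1" "tau w2 = - w2"
    using assms by (simp_all add: defs tau_add tau_diff)
  have eq: "2 * v = v1 + v2" "2 * w = w1 + w2" "2 * tau v = v1 - v2" "2 * tau w = w1 - w2"
    by (simp_all add: defs)
  have "(2 * 2) * (v \<bullet> w) = (2 * v) \<bullet> (2 * w)" "(2 * 2) * (tau v \<bullet> tau w) = (2 * tau v) \<bullet> (2 * tau w)"
    using assms by (simp_all add: dot_mult_left dot_mult_right)
  then have l: "(2 * 2) * (v \<bullet> w) = v1 \<bullet> w1 + v1 \<bullet> w2 + (v2 \<bullet> w1 + v2 \<bullet> w2)"
    and r: "(2 * 2) * (tau v \<bullet> tau w) = v1 \<bullet> w1 - v1 \<bullet> w2 - (v2 \<bullet> w1 - v2 \<bullet> w2)"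
    by (simp_all only: eq dot_simps) simp_all
  have pm: "tau (v2 \<bullet> w1) = - (v2 \<bullet> w1)"
    using dot_plus_minus[of w1 v2] in_V t by (simp add: dot_comm)
  have "(2 * 2) * tau (v \<bullet> w) = tau ((2 * 2) * (v \<bullet> w))"
    using assms by (simp only: tau_mult dot_closed)
  also have "\<dots> = (2 * 2) * (tau v \<bullet> tau w)"
    unfolding l r using in_V t
    by (simp add: tau_add dot_plus_plus dot_plus_minus dot_minus_minus pm)
  finally have "(2 * 2) * (tau (v \<bullet> w) - tau v \<bullet> tau w) = 0" by (simp add: algebra_simps)
  then show ?thesis using unit_cancel[OF unit_mult[OF unit_2 unit_2]] by fastforce
qed

end

section \<open>The axes generated by two axes\<close>

text \<open>The composition of the two involutions shifts all indices by 2. A property preserved by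
  both involutions therefore has to be checked at the indices 0 and 1 only.\<close>

lemma int_parity_induct:
  assumes "P 0" "P 1" "\<And>i. P i \<Longrightarrow> P (i + 2)" "\<And>i. P i \<Longrightarrow> P (i - 2)"
  shows "P (n::int)"
proof -
  have "P (2 * k) \<and> P (2 * k + 1)" for k
  proof (induction k rule: int_induct[of _ 0])
    case base
    show ?case using assms(1,2) by simp
  next
    case (step1 i)
    then show ?case using assms(3)[of "2 * i"] assms(3)[of "2 * i + 1"] by (simp add: algebra_simps)
  next
    case (step2 i)
    then show ?case using assms(4)[of "2 * i"] assms(4)[of "2 * i + 1"] by (simp add: algebra_simps)
  qed
  from this[of "n div 2"] show ?thesis
    by (cases "even n") (simp_all add: even_two_times_div_two odd_two_times_div_two_succ)
qed

text \<open>The ring as a module over itself, so spans are ideals. In a square-zero extension the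
  ideal generated by elements of \<open>V\<close> is the submodule they span over the
  scalars.\<close>

global_interpretation ideal: Modules.module "(*) :: 'a::comm_ring_1 \<Rightarrow> 'a \<Rightarrow> 'a"
  by unfold_locales (simp_all add: algebra_simps)

declare ideal.scale_scale [simp del]

locale dihedral = square_zero_algebra V dot d c + A0: axis V dot d c "a 0" l0 + A1: axis V dot d c "a 1" l1
  for V :: "'e::comm_ring_1 set" and dot (infixl "\<bullet>" 70) and d c :: 'e
    and a :: "int \<Rightarrow> 'e" and l0 l1 :: "'e \<Rightarrow> 'e" +
  assumes a_V [simp]: "a n \<in> V"
    and tau0_a [simp]: "A0.tau (a n) = a (- n)" and tau1_a [simp]: "A1.tau (a n) = a (2 - n)"
begin

text \<open>The reflection n -> 1 - n exchanges the two axes and conjugates n -> -n into n -> 2 - n.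
  Every fact about \<open>a 0\<close> thereby has a counterpart about \<open>a 1\<close> with
  \<open>pp\<close> and \<open>qq\<close> exchanged.\<close>

lemma swap: "dihedral V (\<bullet>) d c (\<lambda>n. a (1 - n)) l1 l0"
proof -
  have "axis V (\<bullet>) d c (a (1 - 0)) l1" "axis V (\<bullet>) d c (a (1 - 1)) l0"
    using A1.axis_axioms A0.axis_axioms by simp_all
  then show ?thesis
    by (intro dihedral.intro dihedral_axioms.intro square_zero_algebra_axioms)
      (simp_all only: a_V tau0_a tau1_a, simp_all)
qed

text \<open>Here \<open>u i j\<close> is \<open>- 2 / \<beta>\<close> times \<open>a\<^sub>i a\<^sub>j - \<beta> (a\<^sub>i + a\<^sub>j)\<close>; it turns \<open>\<sigma>\<^sub>0\<close> into an exchange of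
  \<open>a\<^sub>n + a\<^bsub>-n\<^esub>\<close> and \<open>u 0 n\<close> up to multiples of \<open>a\<^sub>0\<close>. With \<open>pp\<close> the value of the form is \<open>\<beta> (1 + pp n / 2)\<close>.\<close>

definition u :: "int \<Rightarrow> int \<Rightarrow> 'e"
  where "u i j = 2 * (a i + a j) - 2 * c * (a i \<bullet> a j)"

definition pp :: "int \<Rightarrow> 'e"
  where "pp n = 2 * (c * l0 (a n) - 1)"

definition qq :: "int \<Rightarrow> 'e"
  where "qq n = 2 * (c * l1 (a (1 - n)) - 1)"

abbreviation "p \<equiv> pp 1"
abbreviation "q \<equiv> qq 1"
text \<open>Multiples of s_{0,1}, s_{0,2} and s_{1,2}, the last one written with the indices -1 and
  1, which \<open>A0.tau\<close> interchanges. \<open>Y\<close>, \<open>Z\<close> and the square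
  \<open>X\<close> are the unknowns to be eliminated.\<close>

abbreviation "U \<equiv> u 0 1"
abbreviation "Y \<equiv> u 0 2"
abbreviation "Z \<equiv> u (- 1) 1"
abbreviation "X \<equiv> U \<bullet> U"

section \<open>Action of the involutions and of \<open>A0.sig\<close> on the elements
  \<open>u i j\<close>\<close>

lemma u_V [simp]: "u i j \<in> V"
  by (simp add: u_def)

lemma u_sym: "u i j = u j i"
  by (simp add: u_def dot_comm add.commute)

lemma swap_simps: "dihedral.u (\<bullet>) c (\<lambda>n. a (1 - n)) i j = u (1 - i) (1 - j)"
  "dihedral.pp c (\<lambda>n. a (1 - n)) l1 n = qq n" "dihedral.qq c (\<lambda>n. a (1 - n)) l0 n = pp n"
  by (simp_all add: dihedral.u_def[OF swap] u_def dihedral.pp_def[OF swap] dihedral.qq_def[OF swap]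
      pp_def qq_def)

lemma range_swap: "range (\<lambda>n. a (1 - n)) = range a"
  by (auto intro: image_eqI[of _ _ "1 - n" for n])

lemma d2c: "d * (2 * c * x) = x"
  using inv_2d by (metis mult.assoc mult.commute mult_1)

lemma a_dot_a: "a i \<bullet> a j = 2 * d * (a i + a j) - d * u i j"
  unfolding u_def right_diff_distrib d2c by (simp add: algebra_simps)

lemma tau0_u: "A0.tau (u i j) = u (- i) (- j)"
  by (simp add: u_def A0.tau_linear A0.tau_dot)

lemma tau1_u: "A1.tau (u i j) = u (2 - i) (2 - j)"
  by (simp add: u_def A1.tau_linear A1.tau_dot)

lemma two_sig0_a: "2 * A0.sig (a n) = u 0 n + pp n * a 0"
  by (simp add: A0.sig_def A0.dev_def u_def pp_def algebra_simps)

lemma sig0_s: "A0.sig (a n + a (- n)) = u 0 n + pp n * a 0"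
  using two_sig0_a[of n] A0.sig_tau[of "a n"] by (simp add: A0.sig_add)

lemma u0_eq: "u 0 n = 2 * A0.sig (a n) - pp n * a 0"
  by (simp add: two_sig0_a)

text \<open>Up to a multiple of \<open>a 0\<close>, the element \<open>u 0 n\<close> is an image
  under \<open>A0.sig\<close>, and such images are fixed by \<open>A0.tau\<close>.\<close>

lemma tau0_u0 [simp]: "A0.tau (u 0 n) = u 0 n"
  unfolding u0_eq using A0.sig_tau_eigen(8)[of 0 0 0] by (simp add: A0.tau_linear)

lemma u0_minus: "u 0 (- n) = u 0 n"
  using tau0_u[of 0 n] by simp

text \<open>The converse half of the exchange: twice the square of \<open>A0.sig\<close> is 1 +
  \<open>A0.tau\<close>, which sends \<open>a n\<close> to \<open>a n + a (- n)\<close>.\<close>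

lemma sig0_u: "A0.sig (u 0 n) = a n + a (- n) - pp n * a 0"
  unfolding u0_eq using A0.sig_tau_eigen(4)[of 0 0 0] A0.sig_sig[of "a n"]
  by (simp add: A0.sig_linear)

lemma sig0_a0 [simp]: "A0.sig (a 0) = a 0"
  using A0.sig_tau_eigen(4)[of 0 0 0] by simp

lemma l0_a: "l0 (a n) = 2 * d + d * pp n"
  using d2c[of "l0 (a n)"] by (simp add: pp_def algebra_simps)

lemma a0_u: "a 0 \<bullet> u 0 n = 2 * d * u 0 n - 2 * d * (a n + a (- n)) + (4 * d + 4 * d * pp n - pp n) * a 0"
proof -
  have "l0 (u 0 n) * a 0 = 2 * (l0 (a n) * a 0) - pp n * a 0"
    unfolding u0_eq using A0.l_sig[of "a n"]
    by (simp add: A0.l_diff A0.l_mult left_diff_distrib mult.assoc A0.l_a)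
  then show ?thesis
    by (simp add: A0.a_dot sig0_u l0_a algebra_simps)
qed

lemma u1_reflect: "u 1 (1 - n) = u 1 (1 + n)"
  using dihedral.u0_minus[OF swap, of n] by (simp add: swap_simps)

lemma tau_U [simp]: "A0.tau U = U" "A1.tau U = U"
  using tau0_u0[of 1] dihedral.tau0_u0[OF swap, of 1] by (simp_all add: swap_simps u_sym[of 1 0])

lemma tau_Y [simp]: "A0.tau Y = Y" "A1.tau Y = Y"
  using tau0_u0[of 2] tau1_u[of 0 2] by (simp_all add: u_sym[of 2 0])

lemma Z_eq: "u 1 3 = Z" "u 1 (- 1) = Z"
  using u1_reflect[of 2] u_sym by simp_all

lemma tau_Z [simp]: "A0.tau Z = Z" "A1.tau Z = Z"
  using tau0_u[of "-1" 1] tau1_u[of "-1" 1] Z_eq by (simp_all add: u_sym[of 3 1])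

lemma tau_X [simp]: "A0.tau X = X" "A1.tau X = X"
  by (simp_all add: A0.tau_dot A1.tau_dot)

lemma a_shift: "A1.tau (A0.tau (a n)) = a (n + 2)" "A0.tau (A1.tau (a n)) = a (n - 2)"
  by (simp_all add: add.commute)

lemma a_idem: "a n \<bullet> a n = a n"
proof (induction n rule: int_parity_induct)
  case (3 i)
  then show ?case using a_shift(1)[of i] by (metis A0.tau_dot A1.tau_dot a_V A0.tau_V)
next
  case (4 i)
  then show ?case using a_shift(2)[of i] by (metis A0.tau_dot A1.tau_dot a_V A1.tau_V)
qed (simp_all add: A0.a_idem A1.a_idem)

lemma a0_dot_s: "a 0 \<bullet> (a n + a (- n)) = 2 * d * (2 * a 0 + (a n + a (- n))) - 2 * d * u 0 n"
  by (simp add: dot_add_right a_dot_a u0_minus algebra_simps)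

lemma s1_dot_s1: "(a 1 + a (- 1)) \<bullet> (a 1 + a (- 1)) = (1 + 4 * d) * (a 1 + a (- 1)) - 2 * d * Z"
  by (simp add: dot_simps a_idem a_dot_a[of 1 "-1"] a_dot_a[of "-1" 1] Z_eq algebra_simps)

text \<open>By multiplicativity this is the square of \<open>A0.sig U\<close>, a combination of
  axes; \<open>Z\<close> enters through the product of \<open>a 1\<close> and
  \<open>a (- 1)\<close>.\<close>

lemma sig0_X: "A0.sig X = (1 + 4 * d - 4 * d * p) * (a 1 + a (- 1)) - 2 * d * Z + 4 * d * p * U
    + (p * p - 8 * d * p) * a 0"
proof -
  let ?s = "a 1 + a (- 1)"
  have comm: "?s \<bullet> a 0 = a 0 \<bullet> ?s" by (rule dot_comm)
  have "A0.sig X = (?s - p * a 0) \<bullet> (?s - p * a 0)"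
    by (simp add: A0.dot_plus_plus sig0_u)
  also have "\<dots> = ?s \<bullet> ?s - 2 * p * (a 0 \<bullet> ?s) + p * p * a 0"
    by (simp only: dot_diff dot_mult_left dot_mult_right a_V V_add a_idem comm) (simp add: algebra_simps)
  also have "\<dots> = (1 + 4 * d - 4 * d * p) * ?s - 2 * d * Z + 4 * d * p * U + (p * p - 8 * d * p) * a 0"
    unfolding s1_dot_s1 a0_dot_s by (simp add: algebra_simps)
  finally show ?thesis .
qed

text \<open>Applying \<open>A0.sig\<close> once more to the formula for \<open>A0.sig X\<close>
  returns \<open>X\<close>, and \<open>A0.sig Z\<close> is the only image in it not yet
  known.\<close>

lemma sig0_Z: "2 * d * A0.sig Z = - X + (1 + 4 * d - 4 * d * p) * U + 4 * d * p * (a 1 + a (- 1))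
    + (p * (1 - 4 * d) + p * p * (1 - 8 * d)) * a 0"
proof -
  have "X = A0.sig (A0.sig X)" by (simp add: A0.sig_sig_fixed)
  also have "\<dots> = (1 + 4 * d - 4 * d * p) * (U + p * a 0) - 2 * d * A0.sig Z
      + 4 * d * p * (a 1 + a (- 1) - p * a 0) + (p * p - 8 * d * p) * a 0"
    unfolding sig0_X using sig0_s[of 1] by (simp add: A0.sig_linear sig0_u)
  finally show ?thesis by (simp add: algebra_simps)
qed


section \<open>Products with \<open>U\<close>, \<open>X\<close> and \<open>Y\<close>\<close>

lemma u_norm: "u 1 0 = U" "u 2 0 = Y" "u 1 (- 1) = Z" "u 1 3 = Z"
  by (simp_all add: u_sym[of 1 0] u_sym[of 2 0] Z_eq)

text \<open>The coefficient of \<open>a 0\<close> contains the form value of \<open>X\<close>, which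
  has no expression in \<open>p\<close> and \<open>q\<close> at this point, so it stays
  anonymous.\<close>

lemma a0_dot_X:
  obtains r where "a 0 \<bullet> X = 2 * d * X + 4 * d * d * Z - 2 * d * (1 + 4 * d - 4 * d * p) * (a 1 + a (- 1))
    - 8 * d * d * p * U + r * a 0"
proof
  show "a 0 \<bullet> X = 2 * d * X + 4 * d * d * Z - 2 * d * (1 + 4 * d - 4 * d * p) * (a 1 + a (- 1))
    - 8 * d * d * p * U + (l0 X - 2 * d * (p * p - 8 * d * p)) * a 0"
    using A0.a_dot[of X] by (simp add: sig0_X algebra_simps)
qed

lemma a2_dot_U: "a 2 \<bullet> U = 2 * d * U - 2 * d * (a 1 + a 3) + (4 * d + 4 * d * p - p) * a 2"
proof -
  have "a 2 \<bullet> U = A1.tau (a 0 \<bullet> U)" by (simp add: A1.tau_dot)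
  then show ?thesis unfolding a0_u by (simp add: A1.tau_linear add.commute[of "a 1"])
qed

lemma am2_dot_U: "a (- 2) \<bullet> U = 2 * d * U - 2 * d * (a (- 1) + a (- 3)) + (4 * d + 4 * d * p - p) * a (- 2)"
proof -
  have "a (- 2) \<bullet> U = A0.tau (a 2 \<bullet> U)" by (simp add: A0.tau_dot)
  then show ?thesis by (simp add: a2_dot_U A0.tau_linear)
qed

text \<open>The formula for \<open>a 0\<close> is a premise so that both formulas share the same
  \<open>r\<close>. It is transported by \<open>A1.tau\<close>, which fixes \<open>X\<close>,
  \<open>Z\<close> and \<open>U\<close>.\<close>

lemma a2_dot_X:
  assumes "a 0 \<bullet> X = 2 * d * X + 4 * d * d * Z - 2 * d * (1 + 4 * d - 4 * d * p) * (a 1 + a (- 1))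
    - 8 * d * d * p * U + r * a 0"
  shows "a 2 \<bullet> X = 2 * d * X + 4 * d * d * Z - 2 * d * (1 + 4 * d - 4 * d * p) * (a 1 + a 3)
    - 8 * d * d * p * U + r * a 2"
proof -
  have "a 2 \<bullet> X = A1.tau (a 0 \<bullet> X)" by (simp add: A1.tau_dot)
  then show ?thesis unfolding assms by (simp add: A1.tau_linear add.commute[of "a 1"])
qed

lemma sig1_U: "A1.sig U = a 0 + a 2 - q * a 1"
  using dihedral.sig0_u[OF swap, of 1] by (simp add: swap_simps u_norm)

lemma sig1_Z: "A1.sig Z = a (- 1) + a 3 - qq 2 * a 1"
  using dihedral.sig0_u[OF swap, of 2] by (simp add: swap_simps u_norm)

lemma sig1_s: "A1.sig (a 0 + a 2) = U + q * a 1" "A1.sig (a (- 1) + a 3) = Z + qq 2 * a 1"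
  using dihedral.sig0_s[OF swap, of 1] dihedral.sig0_s[OF swap, of 2] by (simp_all add: swap_simps u_norm)

lemma sig1_a1 [simp]: "A1.sig (a 1) = a 1"
  using dihedral.sig0_a0[OF swap] by simp

lemma sig1_X: "A1.sig X = (1 + 4 * d - 4 * d * q) * (a 0 + a 2) - 2 * d * Y + 4 * d * q * U
    + (q * q - 8 * d * q) * a 1"
  using dihedral.sig0_X[OF swap] by (simp add: swap_simps u_norm)

lemma sig1_Y: "2 * d * A1.sig Y = - X + (1 + 4 * d - 4 * d * q) * U + 4 * d * q * (a 0 + a 2)
    + (q * (1 - 4 * d) + q * q * (1 - 8 * d)) * a 1"
  using dihedral.sig0_Z[OF swap] by (simp add: swap_simps u_norm)

lemma a1_dot_U: "a 1 \<bullet> U = 2 * d * U - 2 * d * (a 0 + a 2) + (4 * d + 4 * d * q - q) * a 1"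
  using dihedral.a0_u[OF swap, of 1] by (simp add: swap_simps u_norm)

lemma a1_dot_Z: "a 1 \<bullet> Z = 2 * d * Z - 2 * d * (a (- 1) + a 3) + (4 * d + 4 * d * qq 2 - qq 2) * a 1"
  using dihedral.a0_u[OF swap, of 2] by (simp add: swap_simps u_norm)

lemma a1_dot_s: "a 1 \<bullet> (a 0 + a 2) = 2 * d * (2 * a 1 + (a 0 + a 2)) - 2 * d * U"
  using dihedral.a0_dot_s[OF swap, of 1] by (simp add: swap_simps u_norm)

lemma a1_dot_X:
  obtains r where "a 1 \<bullet> X = 2 * d * X + 4 * d * d * Y - 2 * d * (1 + 4 * d - 4 * d * q) * (a 0 + a 2)
    - 8 * d * d * q * U + r * a 1"
  using dihedral.a0_dot_X[OF swap] by (simp add: swap_simps u_norm) metis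

lemma s_dot_s: "(a 0 + a 2) \<bullet> (a 0 + a 2) = (1 + 4 * d) * (a 0 + a 2) - 2 * d * Y"
  by (simp add: dot_simps a_idem a_dot_a[of 0 2] a_dot_a[of 2 0] u_norm algebra_simps)

text \<open>Evaluated as \<open>A1.sig\<close> of \<open>A1.sig U \<bullet> A1.sig Y\<close>. Using
  the map of the axis \<open>a 1\<close> breaks the symmetry under \<open>A0.tau\<close>: the axes
  that appear are placed symmetrically around the index 1.\<close>

lemma U_dot_Y:
  obtains k0 k1 where "U \<bullet> Y = 2 * d * (2 - q) * Y + q * X + 4 * d * (q - p) * Z - 4 * d * (a 3 + a (- 1))
    + (8 * d * p - (1 - 4 * d) * (q + q * q)) * (a 0 + a 2) + k0 * U + k1 * a 1"
proof -
  obtain r where r: "a 0 \<bullet> X = 2 * d * X + 4 * d * d * Z - 2 * d * (1 + 4 * d - 4 * d * p) * (a 1 + a (- 1))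
    - 8 * d * d * p * U + r * a 0"
    by (rule a0_dot_X)
  obtain r1 where r1: "a 1 \<bullet> X = 2 * d * X + 4 * d * d * Y - 2 * d * (1 + 4 * d - 4 * d * q) * (a 0 + a 2)
    - 8 * d * d * q * U + r1 * a 1"
    by (rule a1_dot_X)
  define s where "s = a 0 + a 2"
  define t where "t = a (- 1) + a 3"
  have sV: "s \<in> V" and tV: "t \<in> V" by (simp_all add: s_def t_def)
  define k where "k = 1 + 4 * d - 4 * d * q"
  define m where "m = q * (1 - 4 * d) + q * q * (1 - 8 * d)"
  define e0 where "e0 = 4 * d + 4 * d * p - p"
  define e1 where "e1 = 4 * d + 4 * d * q - q"
  define w where "w = 8 * d * p + k * (2 - q) - m"
  have sX: "s \<bullet> X = 4 * d * X + 8 * d * d * Z - 2 * d * (1 + 4 * d - 4 * d * p) * (2 * a 1 + t)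
      - 16 * d * d * p * U + r * s"
    unfolding s_def t_def dot_add_left r a2_dot_X[OF r] by (simp add: algebra_simps)
  have sU: "s \<bullet> U = 4 * d * U - 2 * d * (2 * a 1 + t) + e0 * s"
    unfolding s_def t_def e0_def dot_add_left a0_u a2_dot_U by (simp add: algebra_simps)
  have ss: "s \<bullet> s = (1 + 4 * d) * s - 2 * d * Y"
    unfolding s_def by (rule s_dot_s)
  have a1s: "a 1 \<bullet> s = 2 * d * (2 * a 1 + s) - 2 * d * U" "s \<bullet> a 1 = 2 * d * (2 * a 1 + s) - 2 * d * U"
    unfolding s_def using a1_dot_s dot_comm by metis+
  have a1X: "a 1 \<bullet> X = 2 * d * X + 4 * d * d * Y - 2 * d * k * s - 8 * d * d * q * U + r1 * a 1"
    unfolding s_def k_def by (rule r1)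
  have a1U: "a 1 \<bullet> U = 2 * d * U - 2 * d * s + e1 * a 1"
    unfolding s_def e1_def by (rule a1_dot_U)
  \<comment> \<open>\<open>r0\<close> and \<open>r2\<close> collect the coefficients of
    \<open>s\<close> and \<open>a 1\<close>, including the anonymous \<open>r\<close> and
    \<open>r1\<close>. They need not be multiples of 2d, so dividing by 2d leaves factors
    \<open>c\<close>. The second \<open>A1.sig\<close> sends \<open>s\<close> to
    \<open>U + q * a 1\<close>, so the anonymous scalars end up only in \<open>k0\<close> and
    \<open>k1\<close>.\<close>
  define r0 where "r0 = - r + k * e0 + 4 * d * q * (1 + 4 * d) + 2 * d * m - 8 * d * d * q * q"
  define r2 where "r2 = 4 * d * (1 + 4 * d - 4 * d * p) - 4 * d * k + 4 * d * m + q * r1 - q * k * e1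
      - 16 * d * d * q * q - q * m"
  have "2 * d * A1.sig (U \<bullet> Y) = A1.sig U \<bullet> (2 * d * A1.sig Y)"
    by (simp add: A1.dot_plus_plus dot_mult_right)
  also have "\<dots> = (s - q * a 1) \<bullet> (- X + k * U + 4 * d * q * s + m * a 1)"
    unfolding sig1_Y sig1_U s_def k_def m_def ..
  also have "\<dots> = - (s \<bullet> X) + k * (s \<bullet> U) + 4 * d * q * (s \<bullet> s) + m * (s \<bullet> a 1)
      + q * (a 1 \<bullet> X) - q * k * (a 1 \<bullet> U) - 4 * d * q * q * (a 1 \<bullet> s) - q * m * a 1"
    by (simp add: dot_simps a_idem sV)
  also have "\<dots> = 2 * d * (- (2 - q) * X - 4 * d * Z - 2 * d * q * Y + 4 * d * (q - p) * t + w * U)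
      + r0 * s + r2 * a 1"
    unfolding sX sU ss a1s a1X a1U w_def r0_def r2_def by (simp add: k_def algebra_simps)
  finally have "c * (2 * d * A1.sig (U \<bullet> Y)) = c * (2 * d * (- (2 - q) * X - 4 * d * Z - 2 * d * q * Y
      + 4 * d * (q - p) * t + w * U)) + c * (r0 * s) + c * (r2 * a 1)"
    by (simp only: distrib_left)
  then have sig_UY: "A1.sig (U \<bullet> Y) = - (2 - q) * X - 4 * d * Z - 2 * d * q * Y
      + 4 * d * (q - p) * t + w * U + c * r0 * s + c * r2 * a 1"
    unfolding A0.c_cancel by (simp add: mult.assoc)
  have "U \<bullet> Y = A1.sig (A1.sig (U \<bullet> Y))"
    by (simp add: A1.sig_sig_fixed A1.tau_dot)
  also have "\<dots> = - (2 - q) * A1.sig X - 4 * d * A1.sig Z - 2 * d * q * A1.sig Y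
      + 4 * d * (q - p) * A1.sig t + w * A1.sig U + c * r0 * A1.sig s + c * r2 * a 1"
    unfolding sig_UY using sV tV by (simp add: A1.sig_linear)
  also have "\<dots> = - (2 - q) * A1.sig X - 4 * d * A1.sig Z - q * (2 * d * A1.sig Y)
      + 4 * d * (q - p) * A1.sig t + w * A1.sig U + c * r0 * A1.sig s + c * r2 * a 1"
    by (simp add: mult.left_commute mult.assoc)
  also have "\<dots> = 2 * d * (2 - q) * Y + q * X + 4 * d * (q - p) * Z - 4 * d * t
      + (8 * d * p - (1 - 4 * d) * (q + q * q)) * s
      + (c * r0 - q * k - (2 - q) * 4 * d * q) * U
      + (c * r2 + q * c * r0 - (2 - q) * (q * q - 8 * d * q) + 4 * d * qq 2 - q * m
        + 4 * d * (q - p) * qq 2 - w * q) * a 1"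
    unfolding sig1_X sig1_Y sig1_U t_def s_def sig1_s sig1_Z w_def m_def k_def
    by (simp add: algebra_simps)
  finally show ?thesis
    unfolding s_def t_def add.commute[of "a (- 1)" "a 3"] by (rule that)
qed


text \<open>\<open>X\<close>, \<open>Y\<close>, \<open>Z\<close> and \<open>U\<close> are fixed by
  \<open>A0.tau\<close> and cancel when the expansion of \<open>U \<bullet> Y\<close> is compared
  with its image. What remains involves axes only, and \<open>a 3 - a (- 3)\<close> has the unit
  coefficient -4d.\<close>

lemma a_recursion:
  obtains k k' where "a 3 = a (- 3) + k * (a 2 - a (- 2)) + k' * (a 1 - a (- 1))"
proof -
  define C where "C = 8 * d * p - (1 - 4 * d) * (q + q * q)"
  obtain k0 k1 where UY: "U \<bullet> Y = 2 * d * (2 - q) * Y + q * X + 4 * d * (q - p) * Z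
      - 4 * d * (a 3 + a (- 1)) + C * (a 0 + a 2) + k0 * U + k1 * a 1"
    unfolding C_def by (rule U_dot_Y)
  have "U \<bullet> Y = A0.tau (U \<bullet> Y)" by (simp add: A0.tau_dot)
  also have "\<dots> = 2 * d * (2 - q) * Y + q * X + 4 * d * (q - p) * Z
      - 4 * d * (a (- 3) + a 1) + C * (a 0 + a (- 2)) + k0 * U + k1 * a (- 1)"
    unfolding UY by (simp add: A0.tau_linear)
  finally have "2 * d * (2 * (a 3 + a (- 1) - a (- 3) - a 1)) = C * (a 2 - a (- 2)) + k1 * (a 1 - a (- 1))"
    unfolding UY by (simp add: algebra_simps)
  moreover define t where "t = a 3 + a (- 1) - a (- 3) - a 1"
  moreover define v where "v = C * (a 2 - a (- 2)) + k1 * (a 1 - a (- 1))"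
  ultimately have "2 * t = c * v"
    using A0.c_cancel[of "2 * t"] by simp
  moreover have "t = d * c * (2 * t)"
    using d2c[of t] by (simp add: mult_ac)
  ultimately have "t = d * c * (c * v)" by simp
  then have "a 3 = a (- 3) + d * c * c * C * (a 2 - a (- 2)) + (d * c * c * k1 + 1) * (a 1 - a (- 1))"
    unfolding t_def v_def by (simp add: algebra_simps)
  then show ?thesis by (rule that)
qed

lemma am1_dot_Y:
  assumes "a 1 \<bullet> Y = 2 * d * Y + X - (1 + 4 * d - 4 * d * q) * U - 4 * d * q * (a 0 + a 2) + r * a 1"
  shows "a (- 1) \<bullet> Y = 2 * d * Y + X - (1 + 4 * d - 4 * d * q) * U - 4 * d * q * (a 0 + a (- 2)) + r * a (- 1)"
proof -
  have "a (- 1) \<bullet> Y = A0.tau (a 1 \<bullet> Y)" by (simp add: A0.tau_dot)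
  then show ?thesis unfolding assms by (simp add: A0.tau_linear)
qed

lemma a1_dot_Y:
  obtains r where "a 1 \<bullet> Y = 2 * d * Y + X - (1 + 4 * d - 4 * d * q) * U - 4 * d * q * (a 0 + a 2) + r * a 1"
proof
  have "a 1 \<bullet> Y = l1 Y * a 1 + 2 * d * Y - 2 * d * A1.sig Y"
    using A1.a_dot[of Y] by (simp add: algebra_simps)
  then show "a 1 \<bullet> Y = 2 * d * Y + X - (1 + 4 * d - 4 * d * q) * U - 4 * d * q * (a 0 + a 2)
      + (l1 Y - (q * (1 - 4 * d) + q * q * (1 - 8 * d))) * a 1"
    unfolding sig1_Y by (simp add: algebra_simps)
qed

text \<open>\<open>A0.sig\<close> of \<open>U \<bullet> (a 2 + a (- 2))\<close> is evaluated twice.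
  Expanding the product first gives \<open>a 3 + a (- 3)\<close> and hence \<open>u 0 3\<close>;
  multiplying the images of the factors gives \<open>(a 1 + a (- 1)) \<bullet> Y\<close> and hence
  \<open>X\<close>.\<close>

lemma X_relation:
  obtains k0 k1 k2 where "2 * X + 2 * d * u 0 3 + p * (1 - 6 * d) * Y + 2 * d * (p - 2 * q) * (a 2 + a (- 2))
    = k0 * U + k1 * a 0 + k2 * (a 1 + a (- 1))"
proof -
  define s1 where "s1 = a 1 + a (- 1)"
  define s2 where "s2 = a 2 + a (- 2)"
  define s3 where "s3 = a 3 + a (- 3)"
  have sV: "s1 \<in> V" "s2 \<in> V" "s3 \<in> V" by (simp_all add: s1_def s2_def s3_def)
  define k where "k = 1 + 4 * d - 4 * d * q"
  define e where "e = 4 * d + 4 * d * p - p"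
  obtain r where r: "a 1 \<bullet> Y = 2 * d * Y + X - k * U - 4 * d * q * (a 0 + a 2) + r * a 1"
    unfolding k_def by (rule a1_dot_Y)
  have s1Y: "s1 \<bullet> Y = 4 * d * Y + 2 * X - 2 * k * U - 4 * d * q * (2 * a 0 + s2) + r * s1"
    unfolding s1_def s2_def dot_add_left r am1_dot_Y[OF r[unfolded k_def]] k_def
    by (simp add: algebra_simps)
  have s1a: "s1 \<bullet> a 0 = 2 * d * (2 * a 0 + s1) - 2 * d * U"
    unfolding s1_def using a0_dot_s[of 1] dot_comm by metis
  have a0Y: "a 0 \<bullet> Y = 2 * d * Y - 2 * d * s2 + (4 * d + 4 * d * pp 2 - pp 2) * a 0"
    unfolding s2_def by (rule a0_u)
  have "U \<bullet> s2 = a 2 \<bullet> U + a (- 2) \<bullet> U"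
    unfolding s2_def by (simp add: dot_add_right dot_comm)
  then have Us2: "U \<bullet> s2 = 4 * d * U - 2 * d * (s1 + s3) + e * s2"
    unfolding a2_dot_U am2_dot_U e_def s1_def s2_def s3_def by (simp add: algebra_simps)
  have "A0.tau s2 = s2" unfolding s2_def by (simp add: A0.tau_add add.commute)
  then have "A0.sig (U \<bullet> s2) = A0.sig U \<bullet> A0.sig s2"
    using sV by (simp add: A0.dot_plus_plus)
  moreover have "A0.sig (U \<bullet> s2) = 4 * d * A0.sig U - 2 * d * (A0.sig s1 + A0.sig s3) + e * A0.sig s2"
    unfolding Us2 using sV by (simp add: A0.sig_linear)
  moreover have "A0.sig U = s1 - p * a 0" "A0.sig s1 = U + p * a 0" "A0.sig s2 = Y + pp 2 * a 0"
    "A0.sig s3 = u 0 3 + pp 3 * a 0"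
    unfolding s1_def s2_def s3_def by (simp_all only: sig0_u sig0_s)
  ultimately have "4 * d * (s1 - p * a 0) - 2 * d * (U + p * a 0 + (u 0 3 + pp 3 * a 0)) + e * (Y + pp 2 * a 0)
      = (s1 - p * a 0) \<bullet> (Y + pp 2 * a 0)"
    by simp
  also have "\<dots> = s1 \<bullet> Y + pp 2 * (s1 \<bullet> a 0) - p * (a 0 \<bullet> Y) - p * pp 2 * a 0"
    using sV by (simp add: dot_simps a_idem)
  finally have "2 * X + 2 * d * u 0 3 + p * (1 - 6 * d) * Y + 2 * d * (p - 2 * q) * s2
    = (2 * k + 2 * d * pp 2 - 2 * d) * U + (8 * d * q - 4 * d * pp 2 + p * (4 * d + 4 * d * pp 2 - pp 2)
       + p * pp 2 - 4 * d * p - 2 * d * (p + pp 3) + e * pp 2) * a 0 + (4 * d - r - 2 * d * pp 2) * s1"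
    unfolding s1Y s1a a0Y e_def by (simp add: algebra_simps)
  then show ?thesis using that unfolding s1_def s2_def by blast
qed


section \<open>Relations modulo the span of \<open>U\<close> and all axes\<close>

abbreviation "M \<equiv> ideal.span (insert U (range a))"

lemma a_M: "a n \<in> M" and U_M: "U \<in> M"
  by (auto intro: ideal.span_base)

lemmas M_intros = ideal.span_add ideal.span_diff ideal.span_neg ideal.span_scale a_M U_M

lemma tau_M: assumes "x \<in> M" shows "A0.tau x \<in> M" "A1.tau x \<in> M"
proof -
  from assms have "x \<in> V \<and> A0.tau x \<in> M \<and> A1.tau x \<in> M"
  proof (induction rule: ideal.span_induct_alt)
    case base
    show ?case using A0.tau_mult[of 0 0] A1.tau_mult[of 0 0] by (simp add: ideal.span_zero)
  next
    case (step r x y)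
    then have "x \<in> V" "A0.tau x \<in> M" "A1.tau x \<in> M" by (auto intro: M_intros)
    with step show ?case by (auto simp: A0.tau_linear A1.tau_linear intro: M_intros)
  qed
  then show "A0.tau x \<in> M" "A1.tau x \<in> M" by simp_all
qed

lemma M_cancel: "2 * d * x \<in> M \<Longrightarrow> x \<in> M"
  using ideal.span_scale[of "2 * d * x" _ c] by simp

lemma M_swap: "ideal.span (insert (u 1 0) (range (\<lambda>n. a (1 - n)))) = M"
  by (simp add: u_norm range_swap)

text \<open>This is \<open>A0.sig\<close> applied to \<open>X_relation\<close>: \<open>X\<close>
  contributes \<open>Z\<close>, the sum \<open>a 2 + a (- 2)\<close> contributes \<open>Y\<close>,
  and all other terms land in \<open>M\<close>. The relation has to be exact before this step, since
  \<open>M\<close> is not visibly stable under \<open>A0.sig\<close>, which sends axes to elements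
  \<open>u 0 n\<close>.\<close>

lemma Z_relation: "(p - 2 * q) * Y - 2 * Z \<in> M"
proof -
  define s2 where "s2 = a 2 + a (- 2)"
  define s1 where "s1 = a 1 + a (- 1)"
  have sV: "s1 \<in> V" "s2 \<in> V" by (simp_all add: s1_def s2_def)
  obtain k0 k1 k2 where rel: "2 * X + 2 * d * u 0 3 + p * (1 - 6 * d) * Y + 2 * d * (p - 2 * q) * s2
    = k0 * U + k1 * a 0 + k2 * s1"
    unfolding s1_def s2_def by (rule X_relation)
  have "A0.sig (2 * X + 2 * d * u 0 3 + p * (1 - 6 * d) * Y + 2 * d * (p - 2 * q) * s2)
    = 2 * A0.sig X + 2 * d * A0.sig (u 0 3) + p * (1 - 6 * d) * A0.sig Y + 2 * d * (p - 2 * q) * A0.sig s2"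
    using sV by (simp add: A0.sig_linear)
  moreover have "A0.sig (k0 * U + k1 * a 0 + k2 * s1) = k0 * A0.sig U + k1 * a 0 + k2 * A0.sig s1"
    using sV by (simp add: A0.sig_linear)
  ultimately have eq: "2 * A0.sig X + 2 * d * A0.sig (u 0 3) + p * (1 - 6 * d) * A0.sig Y
      + 2 * d * (p - 2 * q) * A0.sig s2 = k0 * A0.sig U + k1 * a 0 + k2 * A0.sig s1"
    using rel by simp
  have "2 * d * ((p - 2 * q) * Y - 2 * Z) = k0 * A0.sig U + k1 * a 0 + k2 * A0.sig s1
      - 2 * ((1 + 4 * d - 4 * d * p) * s1 + 4 * d * p * U + (p * p - 8 * d * p) * a 0)
      - 2 * d * A0.sig (u 0 3) - p * (1 - 6 * d) * A0.sig Y - 2 * d * (p - 2 * q) * (pp 2 * a 0)"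
    using eq unfolding sig0_X s2_def sig0_s s1_def by (simp add: algebra_simps)
  also have "\<dots> \<in> M"
    unfolding sig0_u s1_def sig0_s by (intro M_intros)
  finally show ?thesis by (rule M_cancel)
qed

lemma X_relation_M: "2 * X + 2 * d * u 0 3 + p * (1 - 6 * d) * Y \<in> M"
proof -
  obtain k0 k1 k2 where "2 * X + 2 * d * u 0 3 + p * (1 - 6 * d) * Y + 2 * d * (p - 2 * q) * (a 2 + a (- 2))
    = k0 * U + k1 * a 0 + k2 * (a 1 + a (- 1))"
    by (rule X_relation)
  then have "2 * X + 2 * d * u 0 3 + p * (1 - 6 * d) * Y
    = k0 * U + k1 * a 0 + k2 * (a 1 + a (- 1)) - 2 * d * (p - 2 * q) * (a 2 + a (- 2))"
    by (simp add: algebra_simps)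
  also have "\<dots> \<in> M" by (intro M_intros)
  finally show ?thesis .
qed

text \<open>In the relation for \<open>X\<close>, the map \<open>A1.tau\<close> fixes
  \<open>X\<close> and \<open>Y\<close> and preserves \<open>M\<close>; it only moves
  \<open>u 0 3\<close>.\<close>

lemma u3_step0: "u 0 3 - u (- 1) 2 \<in> M"
proof -
  let ?v = "2 * X + 2 * d * u 0 3 + p * (1 - 6 * d) * Y"
  have "A1.tau ?v = 2 * X + 2 * d * u (- 1) 2 + p * (1 - 6 * d) * Y"
    by (simp add: A1.tau_linear tau1_u u_norm u_sym[of 2 "-1"])
  then have "2 * d * (u 0 3 - u (- 1) 2) = ?v - A1.tau ?v"
    by (simp add: algebra_simps)
  also have "\<dots> \<in> M"
    using X_relation_M tau_M by (intro ideal.span_diff)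
  finally show ?thesis by (rule M_cancel)
qed

lemma u_shift: "A1.tau (A0.tau (u i j)) = u (i + 2) (j + 2)" "A0.tau (A1.tau (u i j)) = u (i - 2) (j - 2)"
  by (simp_all add: tau0_u tau1_u add.commute)

text \<open>\<open>u3_step0\<close> is the instance at -1 up to sign and its mirror image the one at
  -2. A shift by 2 turns them into the base cases 1 and 0.\<close>

lemma u3_shift: "u n (n + 3) - u (n + 1) (n + 4) \<in> M"
proof -
  have up: "u (n + 2) (n + 5) - u (n + 3) (n + 6) \<in> M" if "u n (n + 3) - u (n + 1) (n + 4) \<in> M" for n
    using tau_M(2)[OF tau_M(1)[OF that]] by (simp add: A0.tau_linear A1.tau_linear u_shift add.commute[of n])
  have "u (- 1) 2 - u 0 3 \<in> M"
    using ideal.span_neg[OF u3_step0] by simp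
  from up[of "- 1"] this have 1: "u 1 4 - u 2 5 \<in> M" by simp
  have "u 1 (- 2) - u 2 (- 1) \<in> M"
    using dihedral.u3_step0[OF swap] by (simp add: swap_simps M_swap)
  then have "u (- 2) 1 - u (- 1) 2 \<in> M"
    using u_sym[of 1 "- 2"] u_sym[of 2 "- 1"] by simp
  from up[of "- 2"] this have 0: "u 0 3 - u 1 4 \<in> M" by simp
  show ?thesis
  proof (induction n rule: int_parity_induct)
    case (3 i)
    from up[OF 3] show ?case by (simp add: algebra_simps)
  next
    case (4 i)
    from tau_M(1)[OF tau_M(2)[OF 4]] show ?case
      by (simp add: A0.tau_linear A1.tau_linear u_shift algebra_simps)
  qed (simp_all add: 0 1)
qed

lemma u3_congruent: "u 0 3 - u n (n + 3) \<in> M"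
proof (induction n rule: int_induct[of _ 0])
  case base
  show ?case by (simp add: ideal.span_zero)
next
  case (step1 i)
  from ideal.span_add[OF step1(2) u3_shift[of i]] show ?case by (simp add: add.commute)
next
  case (step2 i)
  have "u (i - 1) (i - 1 + 3) - u i (i + 3) \<in> M"
    using u3_shift[of "i - 1"] by (simp add: add.commute)
  from ideal.span_diff[OF step2(2) this] show ?case by simp
qed

text \<open>\<open>A0.sig\<close> of \<open>2 * (U \<bullet> Y)\<close> is evaluated twice: from
  \<open>U_dot_Y\<close>, averaged with its image under \<open>A0.tau\<close> so that only symmetric
  sums of axes occur, and as the product of the images of \<open>U\<close> and \<open>Y\<close>. The
  elements at distance three cancel modulo \<open>M\<close>.\<close>

lemma Y_relation: "4 * d * (p * Y + q * Z) + 4 * (q - p) * X - (8 * d * p - (1 - 4 * d) * (q + q * q)) * Y \<in> M"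
proof -
  define s1 where "s1 = a 1 + a (- 1)"
  define s2 where "s2 = a 2 + a (- 2)"
  define s3 where "s3 = a 3 + a (- 3)"
  have sV: "s1 \<in> V" "s2 \<in> V" "s3 \<in> V" by (simp_all add: s1_def s2_def s3_def)
  have sM: "s1 \<in> M" "s2 \<in> M" "s3 \<in> M" unfolding s1_def s2_def s3_def by (intro M_intros)+
  have sig: "A0.sig U = s1 - p * a 0" "A0.sig Y = s2 - pp 2 * a 0" "A0.sig s1 = U + p * a 0"
    "A0.sig s2 = Y + pp 2 * a 0" "A0.sig s3 = u 0 3 + pp 3 * a 0"
    unfolding s1_def s2_def s3_def by (simp_all only: sig0_u sig0_s)
  define C where "C = 8 * d * p - (1 - 4 * d) * (q + q * q)"
  obtain k0 k1 where UY: "U \<bullet> Y = 2 * d * (2 - q) * Y + q * X + 4 * d * (q - p) * Z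
      - 4 * d * (a 3 + a (- 1)) + C * (a 0 + a 2) + k0 * U + k1 * a 1"
    unfolding C_def by (rule U_dot_Y)
  have "A0.tau (U \<bullet> Y) = U \<bullet> Y" by (simp add: A0.tau_dot)
  then have "2 * (U \<bullet> Y) = U \<bullet> Y + A0.tau (U \<bullet> Y)" by simp
  also have "\<dots> = 4 * d * (2 - q) * Y + 2 * q * X + 8 * d * (q - p) * Z - 4 * d * (s3 + s1)
      + C * (2 * a 0 + s2) + 2 * k0 * U + k1 * s1"
    unfolding UY s1_def s2_def s3_def by (simp add: A0.tau_linear) (simp add: algebra_simps)
  finally have "A0.sig (2 * (U \<bullet> Y)) = A0.sig (4 * d * (2 - q) * Y + 2 * q * X + 8 * d * (q - p) * Z
      - 4 * d * (s3 + s1) + C * (2 * a 0 + s2) + 2 * k0 * U + k1 * s1)"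
    by simp
  then have "2 * A0.sig (U \<bullet> Y) = 4 * d * (2 - q) * A0.sig Y + 2 * q * A0.sig X
      + 8 * d * (q - p) * A0.sig Z - 4 * d * (A0.sig s3 + A0.sig s1) + C * (2 * a 0 + A0.sig s2)
      + 2 * k0 * A0.sig U + k1 * A0.sig s1"
    using sV by (simp add: A0.sig_linear)
  also have "8 * d * (q - p) * A0.sig Z = 4 * (q - p) * (2 * d * A0.sig Z)"
    by (simp add: algebra_simps)
  finally have eq: "2 * A0.sig (U \<bullet> Y) = 4 * d * (2 - q) * (s2 - pp 2 * a 0)
      + 2 * q * ((1 + 4 * d - 4 * d * p) * s1 - 2 * d * Z + 4 * d * p * U + (p * p - 8 * d * p) * a 0)
      + 4 * (q - p) * (- X + (1 + 4 * d - 4 * d * p) * U + 4 * d * p * s1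
        + (p * (1 - 4 * d) + p * p * (1 - 8 * d)) * a 0)
      - 4 * d * (u 0 3 + pp 3 * a 0 + (U + p * a 0)) + C * (2 * a 0 + (Y + pp 2 * a 0))
      + 2 * k0 * (s1 - p * a 0) + k1 * (U + p * a 0)"
    unfolding sig0_Z sig0_X sig s1_def[symmetric] .
  have "u 1 2 = U" using u1_reflect[of 1] by (simp add: u_norm)
  moreover from this have "u (- 1) (- 2) = U" using tau0_u[of 1 2] by simp
  \<comment> \<open>Of the four products in \<open>s1 \<bullet> s2\<close>, two have distance one
    and give \<open>U\<close>; the other two have distance three and are brought to the form
    compared with \<open>u 0 3\<close>.\<close>
  ultimately have uu: "u 1 2 = U" "u (- 1) (- 2) = U" "u 2 1 = U" "u (- 2) (- 1) = U"
    "u 1 (- 2) = u (- 2) (- 2 + 3)" "u (- 2) 1 = u (- 2) (- 2 + 3)"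
    "u (- 1) 2 = u (- 1) (- 1 + 3)" "u 2 (- 1) = u (- 1) (- 1 + 3)"
    using u_sym[of 2 1] u_sym[of "-2" "-1"] u_sym[of 1 "-2"] u_sym[of 2 "-1"] by simp_all
  have s12: "s1 \<bullet> s2 = 4 * d * (s1 + s2) - 2 * d * U - d * (u (- 2) (- 2 + 3) + u (- 1) (- 1 + 3))"
    unfolding s1_def s2_def by (simp only: dot_simps a_dot_a uu) (simp add: algebra_simps)
  have s1a: "s1 \<bullet> a 0 = 2 * d * (2 * a 0 + s1) - 2 * d * U"
    unfolding s1_def using a0_dot_s[of 1] dot_comm by metis
  have a0s: "a 0 \<bullet> s2 = 2 * d * (2 * a 0 + s2) - 2 * d * Y"
    unfolding s2_def by (rule a0_dot_s)
  have "A0.sig (U \<bullet> Y) = A0.sig U \<bullet> A0.sig Y"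
    by (simp add: A0.dot_plus_plus)
  also have "\<dots> = s1 \<bullet> s2 - pp 2 * (s1 \<bullet> a 0) - p * (a 0 \<bullet> s2) + p * pp 2 * a 0"
    unfolding sig using sV by (simp add: dot_simps a_idem mult.assoc)
  finally have eq2: "A0.sig (U \<bullet> Y) = s1 \<bullet> s2 - pp 2 * (s1 \<bullet> a 0) - p * (a 0 \<bullet> s2) + p * pp 2 * a 0" .
  have "4 * d * (p * Y + q * Z) + 4 * (q - p) * X - C * Y =
      - 2 * d * ((u 0 3 - u (- 2) (- 2 + 3)) + (u 0 3 - u (- 1) (- 1 + 3)))
      + 4 * d * (2 - q) * (s2 - pp 2 * a 0)
      + 2 * q * ((1 + 4 * d - 4 * d * p) * s1 + 4 * d * p * U + (p * p - 8 * d * p) * a 0)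
      + 4 * (q - p) * ((1 + 4 * d - 4 * d * p) * U + 4 * d * p * s1
        + (p * (1 - 4 * d) + p * p * (1 - 8 * d)) * a 0)
      - 4 * d * (pp 3 * a 0 + (U + p * a 0)) + C * (2 * a 0 + pp 2 * a 0)
      + 2 * k0 * (s1 - p * a 0) + k1 * (U + p * a 0)
      - 8 * d * (s1 + s2) + 4 * d * U + 2 * pp 2 * (2 * d * (2 * a 0 + s1) - 2 * d * U)
      + 4 * d * p * (2 * a 0 + s2) - 2 * p * pp 2 * a 0"
    using eq unfolding eq2 s12 s1a a0s by (simp add: algebra_simps)
  also have "\<dots> \<in> M"
    by (intro M_intros u3_congruent sM)
  finally show ?thesis unfolding C_def .
qed

end

section \<open>The coefficient ideal\<close>

context square_zero_algebra
begin

lemma unit_mem: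
  assumes "ideal.subspace J" "u dvd (1::'e)" "u * x \<in> J" shows "x \<in> J"
proof -
  obtain k where "1 = u * k" using assms(2) by (elim dvdE)
  then have "k * (u * x) = x" by (metis mult.assoc mult.commute mult_1)
  then show ?thesis using ideal.subspace_scale[OF assms(1,3), of k] by simp
qed

text \<open>Modulo \<open>J\<close> the difference \<open>p - q\<close> is invertible. This forces \<open>6 d = 1\<close>, then \<open>p + q = 3\<close> and
  \<open>p - q = -1\<close>, and finally \<open>4 = 0\<close>.\<close>

lemma one_mem_ideal:
  assumes J: "ideal.subspace J"
    and j0: "4 - (p - 2 * q) * (q - 2 * p) \<in> J"
    and j1: "(1 - 6 * d) * (2 * p - q * (p - 2 * q)) \<in> J"
    and j2: "4 * d * p + 2 * d * q * (p - 2 * q) - 2 * (q - p) * (1 - 6 * d) * p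
      - (8 * d * p - (1 - 4 * d) * (q + q * q)) \<in> J"
    and j3: "(4 * d * q - 2 * (p - q) * (1 - 6 * d) * q - (8 * d * q - (1 - 4 * d) * (p + p * p))) * (p - 2 * q)
      + 8 * d * p \<in> J"
    and j4: "2 * d * (p - 2 * q) * (p - 2 * q) + 4 * d * (2 * p - q) - 3 * (p - q) * (1 - 6 * d) * p \<in> J"
  shows "1 \<in> J"
proof -
  note J_intros = ideal.subspace_add[OF J] ideal.subspace_diff[OF J] ideal.subspace_neg[OF J]
    ideal.subspace_scale[OF J]
  have unit_4: "4 dvd (1::'e)" using unit_mult[OF unit_2 unit_2] by simp
  have unit_2d: "2 * d dvd 1" by (rule unit_mult[OF unit_2 unit_d])
  have unit_4d: "4 * d dvd 1" by (rule unit_mult[OF unit_4 unit_d])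
  have unit_16u: "16 * ((1 - 4 * d) * (1 - 4 * d)) dvd 1"
    using unit_mult[OF unit_mult[OF unit_4 unit_4] unit_mult[OF unit_1_4d unit_1_4d]] by simp
  define C where "C = 1 - 6 * d"
  define s where "s = p + q"
  define t where "t = p - q"
  define A where "A = p - 2 * q"
  define B where "B = q - 2 * p"
  note defs = C_def s_def t_def A_def B_def
  note in_J = j0 j1 j2 j3 j4
  \<comment> \<open>Up to sign this is the mirror image of \<open>j1\<close> under the exchange of
    \<open>p\<close> and \<open>q\<close>. Multiplying \<open>j1\<close> by \<open>B\<close>
    produces it, since AB = 4 modulo \<open>J\<close> by \<open>j0\<close>.\<close>
  have i1: "C * (p * q - 2 * p * p - 2 * q) \<in> J"
  proof (rule unit_mem[OF J unit_2])
    have "2 * (C * (p * q - 2 * p * p - 2 * q)) =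
        B * ((1 - 6 * d) * (2 * p - q * (p - 2 * q))) - C * q * (4 - (p - 2 * q) * (q - 2 * p))"
      unfolding defs by (simp add: algebra_simps)
    also have "\<dots> \<in> J" by (intro J_intros in_J)
    finally show "2 * (C * (p * q - 2 * p * p - 2 * q)) \<in> J" .
  qed
  \<comment> \<open>\<open>k1\<close> and \<open>k2\<close> are mirror images: their sum is
    \<open>S\<close>, and their difference is \<open>t\<close> times the element of
    \<open>k3\<close>.\<close>
  have k1: "(1 - 8 * d) * q * (1 + p - q) + 4 * d * p \<in> J"
  proof -
    have "(1 - 8 * d) * q * (1 + p - q) + 4 * d * p = - (C * (p * q - 2 * p * p - 2 * q))
        - (4 * d * p + 2 * d * q * (p - 2 * q) - 2 * (q - p) * (1 - 6 * d) * p
          - (8 * d * p - (1 - 4 * d) * (q + q * q)))"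
      unfolding defs by (simp add: algebra_simps)
    also have "\<dots> \<in> J" by (intro J_intros in_J i1)
    finally show ?thesis .
  qed
  have k2: "(1 - 8 * d) * p * (1 + q - p) + 4 * d * q \<in> J"
  proof (rule unit_mem[OF J unit_4])
    let ?N = "4 * d * q - 2 * (p - q) * (1 - 6 * d) * q - (8 * d * q - (1 - 4 * d) * (p + p * p))"
    have "4 * ((1 - 8 * d) * p * (1 + q - p) + 4 * d * q) =
        4 * ((1 - 6 * d) * (2 * p - q * (p - 2 * q))) - B * (?N * (p - 2 * q) + 8 * d * p)
        - ?N * (4 - (p - 2 * q) * (q - 2 * p))"
      unfolding defs by (simp add: algebra_simps)
    also have "\<dots> \<in> J" by (intro J_intros in_J)
    finally show "4 * ((1 - 8 * d) * p * (1 + q - p) + 4 * d * q) \<in> J" .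
  qed
  have S: "(1 - 4 * d) * s - (1 - 8 * d) * t * t \<in> J"
  proof -
    have "(1 - 4 * d) * s - (1 - 8 * d) * t * t =
        ((1 - 8 * d) * q * (1 + p - q) + 4 * d * p) + ((1 - 8 * d) * p * (1 + q - p) + 4 * d * q)"
      unfolding defs by (simp add: algebra_simps)
    also have "\<dots> \<in> J" by (intro J_intros k1 k2)
    finally show ?thesis .
  qed
  \<comment> \<open>In terms of \<open>s\<close> and \<open>t\<close>, \<open>j0\<close> reads ss =
    16 + 9tt modulo \<open>J\<close>, while \<open>S\<close> expresses (1 - 4d)s as (1 - 8d)tt.
    Squaring the latter shows that the unit 16(1 - 4d)(1 - 4d) is a multiple of \<open>t\<close>
    modulo \<open>J\<close>.\<close>
  have t_cancel: "r \<in> J" if r: "t * r \<in> J" for r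
  proof (rule unit_mem[OF J unit_16u])
    let ?S = "(1 - 4 * d) * s - (1 - 8 * d) * t * t"
    have "16 * ((1 - 4 * d) * (1 - 4 * d)) * r =
        4 * r * (1 - 4 * d) * (1 - 4 * d) * (4 - (p - 2 * q) * (q - 2 * p))
        - 9 * (1 - 4 * d) * (1 - 4 * d) * t * (t * r)
        + r * (?S + 2 * (1 - 8 * d) * t * t) * ?S + (1 - 8 * d) * (1 - 8 * d) * t * t * t * (t * r)"
      unfolding defs by (simp add: algebra_simps)
    also have "\<dots> \<in> J" by (intro J_intros in_J r S)
    finally show "16 * ((1 - 4 * d) * (1 - 4 * d)) * r \<in> J" .
  qed
  have k3: "(1 - 12 * d) - (1 - 8 * d) * s \<in> J"
  proof (rule t_cancel)
    have "t * ((1 - 12 * d) - (1 - 8 * d) * s) =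
        ((1 - 8 * d) * p * (1 + q - p) + 4 * d * q) - ((1 - 8 * d) * q * (1 + p - q) + 4 * d * p)"
      unfolding defs by (simp add: algebra_simps)
    also have "\<dots> \<in> J" by (intro J_intros k1 k2)
    finally show "t * ((1 - 12 * d) - (1 - 8 * d) * s) \<in> J" .
  qed
  have Cs: "C * (1 - s) \<in> J"
  proof (rule t_cancel, rule unit_mem[OF J unit_2])
    have "2 * (t * (C * (1 - s))) = C * (p * q - 2 * p * p - 2 * q) + (1 - 6 * d) * (2 * p - q * (p - 2 * q))"
      unfolding defs by (simp add: algebra_simps)
    also have "\<dots> \<in> J" by (intro J_intros i1 in_J)
    finally show "2 * (t * (C * (1 - s))) \<in> J" .
  qed
  have C: "C \<in> J"
  proof (rule unit_mem[OF J unit_4d])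
    have "4 * d * C = (1 - 8 * d) * (C * (1 - s)) - C * ((1 - 12 * d) - (1 - 8 * d) * s)"
      by (simp add: algebra_simps)
    also have "\<dots> \<in> J" by (intro J_intros Cs k3)
    finally show "4 * d * C \<in> J" .
  qed
  have s3: "s - 3 \<in> J"
  proof -
    have "s - 3 = 3 * ((1 - 12 * d) - (1 - 8 * d) * s) + (4 * s - 6) * C"
      unfolding C_def by (simp add: algebra_simps)
    also have "\<dots> \<in> J" by (intro J_intros k3 C)
    finally show ?thesis .
  qed
  have st: "s + t * t \<in> J"
  proof -
    have "s + t * t = 3 * ((1 - 4 * d) * s - (1 - 8 * d) * t * t) + (4 * t * t - 2 * s) * C"
      unfolding C_def by (simp add: algebra_simps)
    also have "\<dots> \<in> J" by (intro J_intros S C)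
    finally show ?thesis .
  qed
  have A: "A * A - 2 * B \<in> J"
  proof (rule unit_mem[OF J unit_2d])
    have "2 * d * (A * A - 2 * B) = (2 * d * (p - 2 * q) * (p - 2 * q) + 4 * d * (2 * p - q)
        - 3 * (p - q) * (1 - 6 * d) * p) + 3 * t * p * C"
      unfolding defs by (simp add: algebra_simps)
    also have "\<dots> \<in> J" by (intro J_intros in_J C)
    finally show "2 * d * (A * A - 2 * B) \<in> J" .
  qed
  \<comment> \<open>Modulo \<open>J\<close>, s = 3 and tt = -3, and then 4(AA - 2B) = 9tt - 6t + 21
    becomes -6(1 + t).\<close>
  have t3: "3 * (1 + t) \<in> J"
  proof (rule unit_mem[OF J unit_2])
    have "2 * (3 * (1 + t)) = 9 * (s + t * t) + (s - 6 * t - 2) * (s - 3) - 4 * (A * A - 2 * B)"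
      unfolding defs by (simp add: algebra_simps)
    also have "\<dots> \<in> J" by (intro J_intros A s3 st)
    finally show "2 * (3 * (1 + t)) \<in> J" .
  qed
  \<comment> \<open>Modulo \<open>J\<close> the factor 3 has the inverse 2d, because 6d = 1.\<close>
  have t1: "1 + t \<in> J"
  proof -
    have "1 + t = 2 * d * (3 * (1 + t)) + (1 + t) * C"
      unfolding C_def by (simp add: algebra_simps)
    also have "\<dots> \<in> J" by (intro J_intros t3 C)
    finally show ?thesis .
  qed
  show "1 \<in> J"
  proof (rule unit_mem[OF J unit_4])
    have "4 * 1 = (s + t * t) - (s - 3) - (t - 1) * (1 + t)"
      by (simp add: algebra_simps)
    also have "\<dots> \<in> J" by (intro J_intros s3 st t1)
    finally show "4 * 1 \<in> J" .
  qed
qed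

end

section \<open>Elimination of \<open>Y\<close>, \<open>Z\<close> and \<open>X\<close>\<close>

context dihedral
begin

text \<open>The formula depends on the choice of \<open>a 0\<close>, whereas
  \<open>U \<bullet> X\<close> is symmetric in the two axes. Comparison with the mirror image gives
  the last relation needed below.\<close>

lemma U_dot_X: "U \<bullet> X - (1 + 8 * d - 6 * d * p) * X - 4 * d * d * u 0 3 + 8 * d * d * p * Y + 4 * d * d * p * Z \<in> M"
proof -
  define s1 where "s1 = a 1 + a (- 1)"
  define s2 where "s2 = a 2 + a (- 2)"
  define s3 where "s3 = a 3 + a (- 3)"
  have sV: "s1 \<in> V" "s2 \<in> V" "s3 \<in> V" by (simp_all add: s1_def s2_def s3_def)
  have sM: "s1 \<in> M" "s2 \<in> M" "s3 \<in> M" unfolding s1_def s2_def s3_def by (intro M_intros)+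
  have sig: "A0.sig U = s1 - p * a 0" "A0.sig Y = s2 - pp 2 * a 0" "A0.sig s1 = U + p * a 0"
    "A0.sig s2 = Y + pp 2 * a 0" "A0.sig s3 = u 0 3 + pp 3 * a 0"
    unfolding s1_def s2_def s3_def by (simp_all only: sig0_u sig0_s)
  define k where "k = 1 + 4 * d - 4 * d * p"
  define m where "m = p * (1 - 4 * d) + p * p * (1 - 8 * d)"
  define g where "g = p * p - 8 * d * p"
  define e1 where "e1 = 4 * d + 4 * d * q - q"
  define e2 where "e2 = 4 * d + 4 * d * qq 2 - qq 2"
  define e0 where "e0 = 4 * d + 4 * d * p - p"
  have sigX: "A0.sig X = k * s1 - 2 * d * Z + 4 * d * p * U + g * a 0"
    unfolding k_def g_def s1_def by (rule sig0_X)
  have sigZ: "2 * d * A0.sig Z = - X + k * U + 4 * d * p * s1 + m * a 0"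
    unfolding k_def m_def s1_def by (rule sig0_Z)
  have "a (- 1) \<bullet> Z = A0.tau (a 1 \<bullet> Z)" "a (- 1) \<bullet> U = A0.tau (a 1 \<bullet> U)"
    by (simp_all add: A0.tau_dot)
  then have am1: "a (- 1) \<bullet> Z = 2 * d * Z - 2 * d * (a 1 + a (- 3)) + e2 * a (- 1)"
    "a (- 1) \<bullet> U = 2 * d * U - 2 * d * (a 0 + a (- 2)) + e1 * a (- 1)"
    unfolding a1_dot_Z a1_dot_U e1_def e2_def by (simp_all add: A0.tau_linear)
  have s1Z: "s1 \<bullet> Z = 4 * d * Z - 2 * d * (s1 + s3) + e2 * s1"
    unfolding s1_def dot_add_left am1 unfolding a1_dot_Z e2_def s3_def by (simp add: algebra_simps)
  have s1U: "s1 \<bullet> U = 4 * d * U - 2 * d * (2 * a 0 + s2) + e1 * s1"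
    unfolding s1_def dot_add_left am1 unfolding a1_dot_U e1_def s2_def by (simp add: algebra_simps)
  have s1s1: "s1 \<bullet> s1 = (1 + 4 * d) * s1 - 2 * d * Z"
    unfolding s1_def by (rule s1_dot_s1)
  have a0s: "a 0 \<bullet> s1 = 2 * d * (2 * a 0 + s1) - 2 * d * U" "s1 \<bullet> a 0 = 2 * d * (2 * a 0 + s1) - 2 * d * U"
    unfolding s1_def using a0_dot_s[of 1] dot_comm by metis+
  have a0U: "a 0 \<bullet> U = 2 * d * U - 2 * d * s1 + e0 * a 0"
    unfolding e0_def s1_def by (rule a0_u)
  have "a 0 \<bullet> Z = l0 Z * a 0 + 2 * d * Z - 2 * d * A0.sig Z"
    using A0.a_dot[of Z] by (simp add: algebra_simps)
  then have a0Z: "a 0 \<bullet> Z = 2 * d * Z + X - k * U - 4 * d * p * s1 + (l0 Z - m) * a 0"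
    unfolding sigZ by (simp add: algebra_simps)
  \<comment> \<open>\<open>x0\<close>, \<open>x1\<close> and \<open>xU\<close> belong to
    \<open>a 0\<close>, \<open>s1\<close> and \<open>U\<close>, which \<open>A0.sig\<close> maps
    into \<open>M\<close>; their values do not influence the result modulo \<open>M\<close>.\<close>
  define x0 where "x0 = - 16 * d * d * p + 4 * d * g - 4 * d * p * k + 2 * d * p * (l0 Z - m) - 4 * d * p * p * e0 - p * g"
  define x1 where "x1 = k * (1 + 4 * d) + 4 * d * d - 2 * d * e2 + 4 * d * p * e1 + 2 * d * g
      - 2 * d * p * k - 8 * d * d * p * p + 8 * d * d * p * p"
  define xU where "xU = 16 * d * d * p - 2 * d * g + 2 * d * p * k - 2 * d * p * k - 8 * d * d * p * p"
  have "A0.sig (U \<bullet> X) = A0.sig U \<bullet> A0.sig X"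
    by (simp add: A0.dot_plus_plus)
  also have "\<dots> = (s1 - p * a 0) \<bullet> (k * s1 - 2 * d * Z + 4 * d * p * U + g * a 0)"
    unfolding sigX sig ..
  also have "\<dots> = k * (s1 \<bullet> s1) - 2 * d * (s1 \<bullet> Z) + 4 * d * p * (s1 \<bullet> U) + g * (s1 \<bullet> a 0)
      - p * (k * (a 0 \<bullet> s1) - 2 * d * (a 0 \<bullet> Z) + 4 * d * p * (a 0 \<bullet> U) + g * a 0)"
    using sV by (simp add: dot_simps a_idem) (simp add: algebra_simps)
  also have "\<dots> = 2 * d * p * X + (4 * d * d * p - 8 * d * d - 2 * d * k) * Z + 4 * d * d * s3
      - 8 * d * d * p * s2 + x1 * s1 + xU * U + x0 * a 0"
    unfolding s1s1 s1Z s1U a0s a0Z a0U x0_def x1_def xU_def by (simp add: algebra_simps)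
  finally have eq: "A0.sig (U \<bullet> X) = 2 * d * p * X + (4 * d * d * p - 8 * d * d - 2 * d * k) * Z + 4 * d * d * s3
      - 8 * d * d * p * s2 + x1 * s1 + xU * U + x0 * a 0" .
  have "U \<bullet> X = A0.sig (A0.sig (U \<bullet> X))"
    by (simp add: A0.sig_sig_fixed A0.tau_dot)
  also have "\<dots> = 2 * d * p * A0.sig X + (4 * d * d * p - 8 * d * d - 2 * d * k) * A0.sig Z + 4 * d * d * A0.sig s3
      - 8 * d * d * p * A0.sig s2 + x1 * A0.sig s1 + xU * A0.sig U + x0 * a 0"
    unfolding eq using sV by (simp add: A0.sig_linear)
  also have "(4 * d * d * p - 8 * d * d - 2 * d * k) * A0.sig Z = (2 * d * p - 4 * d - k) * (2 * d * A0.sig Z)"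
    by (simp add: algebra_simps)
  finally have "U \<bullet> X - (1 + 8 * d - 6 * d * p) * X - 4 * d * d * u 0 3 + 8 * d * d * p * Y + 4 * d * d * p * Z
      = 2 * d * p * (k * s1 + 4 * d * p * U + g * a 0)
      + (2 * d * p - 4 * d - k) * (k * U + 4 * d * p * s1 + m * a 0) + 4 * d * d * (pp 3 * a 0)
      - 8 * d * d * p * (pp 2 * a 0) + x1 * (U + p * a 0) + xU * (s1 - p * a 0) + x0 * a 0"
    unfolding sigX sigZ sig by (simp add: k_def algebra_simps)
  also have "\<dots> \<in> M" by (intro M_intros sM)
  finally show ?thesis .
qed

abbreviation "L \<equiv> ideal.span (insert (u 0 3) (insert U (range a)))"

lemma M_L: "x \<in> M \<Longrightarrow> x \<in> L"
  by (meson ideal.span_mono subsetD subset_insertI)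

lemma L_subspace: "ideal.subspace L"
  by (rule ideal.subspace_span)

lemma u3_L: "u 0 3 \<in> L"
  by (simp add: ideal.span_base)

text \<open>Modulo \<open>L\<close>, both 2Z and 2X are multiples of \<open>Y\<close>, by
  \<open>fZ\<close> and \<open>fX\<close>. Hence every further relation turns into a scalar
  \<open>r\<close> with \<open>r * Y \<in> L\<close>, that is, into an element of the ideal
  \<open>J\<close>.\<close>

lemma Y_L: "Y \<in> L"
proof -
  note L_intros = ideal.span_add ideal.span_diff ideal.span_neg ideal.span_scale
  define C where "C = 1 - 6 * d"
  define A where "A = p - 2 * q"
  define B where "B = q - 2 * p"
  have fZ: "A * Y - 2 * Z \<in> L" unfolding A_def by (rule M_L[OF Z_relation])
  have fY: "B * Z - 2 * Y \<in> L"
    using M_L[OF dihedral.Z_relation[OF swap, unfolded swap_simps, simplified u_norm range_swap diff_self diff_0_right]]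
    unfolding B_def by (simp add: u_norm range_swap)
  have X_M': "2 * X + 2 * d * u 1 (- 2) + q * C * Z \<in> M"
    using dihedral.X_relation_M[OF swap] unfolding C_def by (simp add: swap_simps u_norm range_swap)
  have uM: "u 0 3 - u 1 (- 2) \<in> M"
    using u3_congruent[of "-2"] u_sym[of 1 "-2"] by simp
  have fX: "2 * X + p * C * Y \<in> L"
  proof -
    have "2 * X + p * C * Y = (2 * X + 2 * d * u 0 3 + p * (1 - 6 * d) * Y) - 2 * d * u 0 3"
      unfolding C_def by simp
    also have "\<dots> \<in> L" by (intro L_intros M_L[OF X_relation_M] u3_L)
    finally show ?thesis .
  qed
  have fX': "2 * X + q * C * Z \<in> L"
  proof -
    have "2 * X + q * C * Z = (2 * X + 2 * d * u 1 (- 2) + q * C * Z) + 2 * d * (u 0 3 - u 1 (- 2)) - 2 * d * u 0 3"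
      by (simp add: algebra_simps)
    also have "\<dots> \<in> L" by (intro L_intros M_L[OF X_M'] M_L[OF uM] u3_L)
    finally show ?thesis .
  qed
  have E: "4 * d * (p * Y + q * Z) + 4 * (q - p) * X - (8 * d * p - (1 - 4 * d) * (q + q * q)) * Y \<in> L"
    by (rule M_L[OF Y_relation])
  have E': "4 * d * (q * Z + p * Y) + 4 * (p - q) * X - (8 * d * q - (1 - 4 * d) * (p + p * p)) * Z \<in> L"
    using M_L dihedral.Y_relation[OF swap] by (simp add: swap_simps u_norm range_swap)
  \<comment> \<open>The difference of \<open>U_dot_X\<close> and its mirror image:
    \<open>U \<bullet> X\<close> cancels, the elements at distance three agree modulo
    \<open>M\<close>, and the rest is divisible by 2d.\<close>
  have G: "3 * (p - q) * X + 2 * d * (2 * p - q) * Y + 2 * d * A * Z \<in> L"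
  proof (rule M_L, rule M_cancel)
    have G': "U \<bullet> X - (1 + 8 * d - 6 * d * q) * X - 4 * d * d * u 1 (- 2) + 8 * d * d * q * Z + 4 * d * d * q * Y \<in> M"
      using dihedral.U_dot_X[OF swap] by (simp add: swap_simps u_norm range_swap)
    have "2 * d * (3 * (p - q) * X + 2 * d * (2 * p - q) * Y + 2 * d * A * Z) =
      (U \<bullet> X - (1 + 8 * d - 6 * d * p) * X - 4 * d * d * u 0 3 + 8 * d * d * p * Y + 4 * d * d * p * Z)
      - (U \<bullet> X - (1 + 8 * d - 6 * d * q) * X - 4 * d * d * u 1 (- 2) + 8 * d * d * q * Z + 4 * d * d * q * Y)
      + 4 * d * d * (u 0 3 - u 1 (- 2))"
      unfolding A_def by (simp add: algebra_simps)
    also have "\<dots> \<in> M" by (intro M_intros U_dot_X G' uM)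
    finally show "2 * d * (3 * (p - q) * X + 2 * d * (2 * p - q) * Y + 2 * d * A * Z) \<in> M" .
  qed
  define J where "J = {r. r * Y \<in> L}"
  have J: "ideal.subspace J"
    by (rule ideal.subspaceI) (auto simp: J_def distrib_right mult.assoc intro: L_intros ideal.span_zero)
  have "1 \<in> J"
  proof (rule one_mem_ideal[OF J])
    have "(4 - (p - 2 * q) * (q - 2 * p)) * Y = - (B * (A * Y - 2 * Z)) - 2 * (B * Z - 2 * Y)"
      unfolding A_def B_def by (simp add: algebra_simps)
    also have "\<dots> \<in> L" by (intro L_intros fZ fY)
    finally show "4 - (p - 2 * q) * (q - 2 * p) \<in> J" by (simp add: J_def)
  next
    have "(1 - 6 * d) * (2 * p - q * (p - 2 * q)) * Y =
        2 * (2 * X + p * C * Y) - 2 * (2 * X + q * C * Z) - C * q * (A * Y - 2 * Z)"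
      unfolding A_def C_def by (simp add: algebra_simps)
    also have "\<dots> \<in> L" by (intro L_intros fX fX' fZ)
    finally show "(1 - 6 * d) * (2 * p - q * (p - 2 * q)) \<in> J" by (simp add: J_def)
  next
    have "(4 * d * p + 2 * d * q * (p - 2 * q) - 2 * (q - p) * (1 - 6 * d) * p
      - (8 * d * p - (1 - 4 * d) * (q + q * q))) * Y =
      (4 * d * (p * Y + q * Z) + 4 * (q - p) * X - (8 * d * p - (1 - 4 * d) * (q + q * q)) * Y)
      - 2 * (q - p) * (2 * X + p * C * Y) + 2 * d * q * (A * Y - 2 * Z)"
      unfolding A_def C_def by (simp add: algebra_simps)
    also have "\<dots> \<in> L" by (intro L_intros E fX fZ)
    finally show "4 * d * p + 2 * d * q * (p - 2 * q) - 2 * (q - p) * (1 - 6 * d) * p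
      - (8 * d * p - (1 - 4 * d) * (q + q * q)) \<in> J" by (simp add: J_def)
  next
    let ?N = "4 * d * q - 2 * (p - q) * (1 - 6 * d) * q - (8 * d * q - (1 - 4 * d) * (p + p * p))"
    have "(?N * (p - 2 * q) + 8 * d * p) * Y =
      2 * (4 * d * (q * Z + p * Y) + 4 * (p - q) * X - (8 * d * q - (1 - 4 * d) * (p + p * p)) * Z)
      - 4 * (p - q) * (2 * X + q * C * Z) + ?N * (A * Y - 2 * Z)"
      unfolding A_def C_def by (simp add: algebra_simps)
    also have "\<dots> \<in> L" by (intro L_intros E' fX' fZ)
    finally show "?N * (p - 2 * q) + 8 * d * p \<in> J" by (simp add: J_def)
  next
    have "(2 * d * (p - 2 * q) * (p - 2 * q) + 4 * d * (2 * p - q) - 3 * (p - q) * (1 - 6 * d) * p) * Y =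
      2 * (3 * (p - q) * X + 2 * d * (2 * p - q) * Y + 2 * d * A * Z)
      - 3 * (p - q) * (2 * X + p * C * Y) + 2 * d * A * (A * Y - 2 * Z)"
      unfolding A_def C_def by (simp add: algebra_simps)
    also have "\<dots> \<in> L" by (intro L_intros G fX fZ)
    finally show "2 * d * (p - 2 * q) * (p - 2 * q) + 4 * d * (2 * p - q) - 3 * (p - q) * (1 - 6 * d) * p \<in> J"
      by (simp add: J_def)
  qed
  then show ?thesis by (simp add: J_def)
qed

lemma Z_L: "Z \<in> L"
proof (rule unit_mem[OF L_subspace unit_2])
  have "2 * Z = (p - 2 * q) * Y - ((p - 2 * q) * Y - 2 * Z)" by simp
  also have "\<dots> \<in> L" by (intro ideal.span_diff ideal.span_scale Y_L M_L[OF Z_relation])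
  finally show "2 * Z \<in> L" .
qed

lemma X_L: "X \<in> L"
proof (rule unit_mem[OF L_subspace unit_2])
  have "2 * X = (2 * X + 2 * d * u 0 3 + p * (1 - 6 * d) * Y) - 2 * d * u 0 3 - p * (1 - 6 * d) * Y"
    by simp
  also have "\<dots> \<in> L" by (intro ideal.span_diff ideal.span_scale Y_L u3_L M_L[OF X_relation_M])
  finally show "2 * X \<in> L" .
qed

end

section \<open>Closure under multiplication\<close>

context dihedral
begin

lemma u_1: "u i (i + 1) = U"
proof (induction i rule: int_parity_induct)
  case 2
  show ?case using u1_reflect[of 1] by (simp add: u_norm)
next
  case (3 i)
  then show ?case using u_shift(1)[of i "i + 1"] by (simp add: add.commute)
next
  case (4 i)
  then show ?case using u_shift(2)[of i "i + 1"] by (simp add: algebra_simps)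
qed simp

lemma u_2: "u i (i + 2) \<in> {Y, Z}"
proof (induction i rule: int_parity_induct)
  case (3 i)
  then show ?case using u_shift(1)[of i "i + 2"] by (auto simp: add.commute)
next
  case (4 i)
  then show ?case using u_shift(2)[of i "i + 2"] by (auto simp: algebra_simps)
qed (simp_all add: u_norm)

lemma recursion: "\<exists>k k'. a (i + 3) = a (i - 3) + k * (a (i + 2) - a (i - 2)) + k' * (a (i + 1) - a (i - 1))"
proof (induction i rule: int_parity_induct)
  case 1
  show ?case using a_recursion by (metis add_0 diff_0)
next
  case 2
  \<comment> \<open>The mirror image of the recursion centred at 0 is centred at 1 and runs
    backwards; it is solved for its other end.\<close>
  obtain k k' where "a (- 2) = a 4 + k * (a (- 1) - a 3) + k' * (a 0 - a 2)"
    using dihedral.a_recursion[OF swap] by auto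
  then have "a 4 = a (- 2) + k * (a 3 - a (- 1)) + k' * (a 2 - a 0)"
    by (simp add: algebra_simps)
  then show ?case by auto
next
  case (3 i)
  then obtain k k' where r: "a (i + 3) = a (i - 3) + k * (a (i + 2) - a (i - 2)) + k' * (a (i + 1) - a (i - 1))"
    by blast
  have "a (i + 2 + 3) = A1.tau (A0.tau (a (i + 3)))" by (simp add: algebra_simps)
  also have "\<dots> = a (i + 2 - 3) + k * (a (i + 2 + 2) - a (i + 2 - 2)) + k' * (a (i + 2 + 1) - a (i + 2 - 1))"
    unfolding r by (simp add: A0.tau_linear A1.tau_linear algebra_simps)
  finally show ?case by blast
next
  case (4 i)
  then obtain k k' where r: "a (i + 3) = a (i - 3) + k * (a (i + 2) - a (i - 2)) + k' * (a (i + 1) - a (i - 1))"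
    by blast
  have "a (i - 2 + 3) = A0.tau (A1.tau (a (i + 3)))" by (simp add: algebra_simps)
  also have "\<dots> = a (i - 2 - 3) + k * (a (i - 2 + 2) - a (i - 2 - 2)) + k' * (a (i - 2 + 1) - a (i - 2 - 1))"
    unfolding r by (simp add: A0.tau_linear A1.tau_linear algebra_simps)
  finally show ?case by blast
qed

text \<open>The outer coefficients of the recursion are 1, so a window of six consecutive axes can
  be moved by one in either direction without leaving the span.\<close>

lemma a_in_span: "a n \<in> ideal.span {a (- 2), a (- 1), a 0, a 1, a 2, a 3}"
proof -
  let ?S = "ideal.span {a (- 2), a (- 1), a 0, a 1, a 2, a 3}"
  note S_intros = ideal.span_add ideal.span_diff ideal.span_scale
  have "{a i, a (i + 1), a (i + 2), a (i + 3), a (i + 4), a (i + 5)} \<subseteq> ?S" for i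
  proof (induction i rule: int_induct[of _ "- 2"])
    case base
    then show ?case by (auto intro: ideal.span_base)
  next
    case (step1 i)
    obtain k k' where "a (i + 3 + 3) = a (i + 3 - 3) + k * (a (i + 3 + 2) - a (i + 3 - 2))
        + k' * (a (i + 3 + 1) - a (i + 3 - 1))"
      using recursion by blast
    then have "a (i + 6) = a i + k * (a (i + 5) - a (i + 1)) + k' * (a (i + 4) - a (i + 2))"
      by (simp add: add.commute[of i])
    also have "\<dots> \<in> ?S" using step1(2) by (intro S_intros) auto
    finally show ?case using step1(2) by (simp add: add.commute[of i])
  next
    case (step2 i)
    obtain k k' where "a (i + 2 + 3) = a (i + 2 - 3) + k * (a (i + 2 + 2) - a (i + 2 - 2))
        + k' * (a (i + 2 + 1) - a (i + 2 - 1))"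
      using recursion by blast
    then have "a (i - 1) = a (i + 5) - k * (a (i + 4) - a i) - k' * (a (i + 3) - a (i + 1))"
      by (simp add: algebra_simps)
    also have "\<dots> \<in> ?S" using step2(2) by (intro S_intros) auto
    finally show ?case using step2(2) by (simp add: algebra_simps)
  qed
  then show ?thesis by blast
qed

lemmas L_intros = ideal.span_add ideal.span_diff ideal.span_neg ideal.span_scale

lemma a_L: "a n \<in> L"
  by (rule M_L[OF a_M])

text \<open>Induction on the distance n of the indices. Up to distance three the product is
  expressed by some \<open>u i j\<close>. Beyond that, the recursion centred at i + n - 3 leaves the
  distances n - 1, n - 2, n - 4, n - 5, n - 6; the last two may be negative, so the induction
  hypothesis is first extended to absolute values.\<close>

lemma a_dot_a_L: "a i \<bullet> a j \<in> L"
proof -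
  have u_L: "a i \<bullet> a j \<in> L" if "u i j \<in> L" for i j
    unfolding a_dot_a using that by (intro L_intros a_L)
  have main: "a i \<bullet> a (i + int n) \<in> L" for n i
  proof (induction n arbitrary: i rule: less_induct)
    case (less n)
    consider "n = 0" | "n = 1" | "n = 2" | "n = 3" | "n \<ge> 4" by linarith
    then show ?case
    proof cases
      case 1
      then show ?thesis by (simp add: a_idem a_L)
    next
      case 2
      then show ?thesis using u_L[of i "i + 1"] M_L[OF U_M] by (simp add: u_1)
    next
      case 3
      then show ?thesis using u_L[of i "i + 2"] u_2[of i] Y_L Z_L by auto
    next
      case 4
      have "u i (i + 3) = u 0 3 - (u 0 3 - u i (i + 3))" by simp
      also have "\<dots> \<in> L" by (intro L_intros u3_L M_L[OF u3_congruent])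
      finally show ?thesis using u_L[of i "i + 3"] 4 by simp
    next
      case 5
      have IH: "a i \<bullet> a (i + m) \<in> L" if "\<bar>m\<bar> < int n" for m i
      proof (cases "m \<ge> 0")
        case True
        then show ?thesis using less[of "nat m" i] that by simp
      next
        case False
        then show ?thesis using less[of "nat (- m)" "i + m"] that by (simp add: dot_comm)
      qed
      define j where "j = i + int n - 3"
      obtain k k' where r: "a (j + 3) = a (j - 3) + k * (a (j + 2) - a (j - 2)) + k' * (a (j + 1) - a (j - 1))"
        using recursion by blast
      have "a i \<bullet> a (i + int n) = a i \<bullet> a (j + 3)" by (simp add: j_def)
      also have "\<dots> = a i \<bullet> a (i + (int n - 6)) + k * (a i \<bullet> a (i + (int n - 1)) - a i \<bullet> a (i + (int n - 5)))
          + k' * (a i \<bullet> a (i + (int n - 2)) - a i \<bullet> a (i + (int n - 4)))"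
        unfolding r by (simp add: dot_simps) (simp add: j_def algebra_simps)
      also have "\<dots> \<in> L" using 5 by (intro L_intros IH) auto
      finally show ?thesis .
    qed
  qed
  show ?thesis
  proof (cases "i \<le> j")
    case True
    then show ?thesis using main[of i "nat (j - i)"] by simp
  next
    case False
    then show ?thesis using main[of j "nat (i - j)"] by (simp add: dot_comm)
  qed
qed

lemma a_dot_U_M: "a i \<bullet> U \<in> M"
proof (induction i rule: int_parity_induct)
  case 1
  show ?case unfolding a0_u by (intro M_intros)
next
  case 2
  show ?case unfolding a1_dot_U by (intro M_intros)
next
  case (3 i)
  from tau_M(2)[OF tau_M(1)[OF 3]] show ?case
    by (simp add: A0.tau_dot A1.tau_dot add.commute)
next
  case (4 i)
  from tau_M(1)[OF tau_M(2)[OF 4]] show ?case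
    by (simp add: A0.tau_dot A1.tau_dot)
qed

lemma a_dot_M: "x \<in> M \<Longrightarrow> a i \<bullet> x \<in> L"
proof (induction rule: ideal.span_induct_alt)
  case base
  show ?case by (simp add: ideal.span_zero)
next
  case (step r x y)
  moreover have "a i \<bullet> x \<in> L" using step(1) M_L[OF a_dot_U_M] a_dot_a_L by auto
  moreover have "x \<in> V" using step(1) by auto
  ultimately show ?case by (simp add: dot_add_right dot_mult_right) (intro L_intros)
qed

lemma tau_L:
  assumes "x \<in> L" shows "A0.tau x \<in> L" "A1.tau x \<in> L"
proof -
  have "A0.tau (u 0 3) \<in> L" using u3_L by simp
  have "u 2 (- 1) = u 0 3 - (u 0 3 - u (- 1) 2)" by (simp add: u_sym[of 2])
  also have "\<dots> \<in> L" by (intro L_intros u3_L M_L[OF u3_step0])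
  finally have u3: "A1.tau (u 0 3) \<in> L" by (simp add: tau1_u)
  from assms have "x \<in> V \<and> A0.tau x \<in> L \<and> A1.tau x \<in> L"
  proof (induction rule: ideal.span_induct_alt)
    case base
    show ?case using A0.tau_mult[of 0 0] A1.tau_mult[of 0 0] by (simp add: ideal.span_zero)
  next
    case (step r x y)
    then have "x \<in> V" "A0.tau x \<in> L" "A1.tau x \<in> L"
      using u3 u3_L M_L[OF U_M] by (auto intro: a_L)
    with step show ?case by (auto simp: A0.tau_linear A1.tau_linear intro: L_intros)
  qed
  then show "A0.tau x \<in> L" "A1.tau x \<in> L" by simp_all
qed

lemma L_V: "x \<in> L \<Longrightarrow> x \<in> V"
  by (induction rule: ideal.span_induct_alt) auto

text \<open>The product formula requires the axis to be an end of \<open>u\<close>. As all elements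
  at distance three agree modulo \<open>M\<close>, each axis can be given the representative
  starting at its own index.\<close>

lemma a_dot_u3: "a i \<bullet> u i (i + 3) \<in> L"
proof (induction i rule: int_parity_induct)
  case 1
  have "a 0 \<bullet> u 0 3 \<in> L" unfolding a0_u by (intro L_intros a_L u3_L)
  then show ?case by simp
next
  case 2
  have "u 1 (- 2) = u 0 3 - (u 0 3 - u (- 2) (- 2 + 3))" by (simp add: u_sym[of 1])
  also have "\<dots> \<in> L" by (intro L_intros u3_L M_L[OF u3_congruent])
  finally have u_L: "u 1 (- 2) \<in> L" .
  have "a 1 \<bullet> u 1 (1 + 3) = a 1 \<bullet> u 1 (- 2)" using u1_reflect[of 3] by simp
  also have "\<dots> = 2 * d * u 1 (- 2) - 2 * d * (a (- 2) + a 4) + (4 * d + 4 * d * qq 3 - qq 3) * a 1"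
    using dihedral.a0_u[OF swap, of 3] by (simp add: swap_simps)
  also have "\<dots> \<in> L" by (intro L_intros a_L u_L)
  finally show ?case .
next
  case (3 i)
  from tau_L(2)[OF tau_L(1)[OF 3]] show ?case
    by (simp add: A0.tau_dot A1.tau_dot tau0_u tau1_u add.commute)
next
  case (4 i)
  from tau_L(1)[OF tau_L(2)[OF 4]] show ?case
    by (simp add: A0.tau_dot A1.tau_dot tau0_u tau1_u algebra_simps)
qed

lemma a_dot_L: "x \<in> L \<Longrightarrow> a i \<bullet> x \<in> L"
proof (induction rule: ideal.span_induct_alt)
  case base
  show ?case by (simp add: ideal.span_zero)
next
  case (step r x y)
  have "a i \<bullet> u 0 3 = a i \<bullet> u i (i + 3) + a i \<bullet> (u 0 3 - u i (i + 3))"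
    by (simp add: dot_diff)
  also have "\<dots> \<in> L" by (intro L_intros a_dot_u3 a_dot_M u3_congruent)
  finally have "a i \<bullet> x \<in> L" using step(1) M_L[OF a_dot_U_M] a_dot_a_L by auto
  moreover have "x \<in> V" using step(1) by auto
  ultimately show ?case using step by (simp add: dot_add_right dot_mult_right) (intro L_intros)
qed

text \<open>\<open>A0.sig\<close> is built from multiplication by \<open>a 0\<close>, under which
  \<open>L\<close> is now known to be closed.\<close>

lemma sig0_L: "x \<in> L \<Longrightarrow> A0.sig x \<in> L"
  unfolding A0.sig_def A0.dev_def by (intro L_intros a_dot_L a_L)

text \<open>The product is \<open>A0.sig\<close> of the product of the images. One image is a
  combination of axes, and \<open>L\<close> is closed under multiplication by axes and under
  \<open>A0.sig\<close>.\<close>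

lemma fixed_dot_fixed_L:
  assumes "x \<in> V" "y \<in> V" "A0.tau x = x" "A0.tau y = y"
    and "A0.sig x \<in> ideal.span (range a)" "A0.sig y \<in> L"
  shows "x \<bullet> y \<in> L"
proof -
  have "z \<bullet> A0.sig y \<in> L" if "z \<in> ideal.span (range a)" for z
    using that
  proof (induction rule: ideal.span_induct_alt)
    case (step r x z)
    then have "x \<in> V" "x \<bullet> A0.sig y \<in> L" using assms(6) a_dot_L by auto
    with step show ?case by (simp add: dot_add_left dot_mult_left) (intro L_intros)
  qed (simp add: ideal.span_zero)
  from sig0_L[OF this[OF assms(5)]] have "A0.sig (A0.sig (x \<bullet> y)) \<in> L"
    using assms by (simp add: A0.dot_plus_plus)
  then show ?thesis
    using assms by (simp add: A0.sig_sig_fixed A0.dot_plus_plus)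
qed

lemma u_dot_u_L: "U \<bullet> u 0 3 \<in> L" "u 0 3 \<bullet> u 0 3 \<in> L"
proof -
  have "A0.sig (u 0 n) \<in> ideal.span (range a)" for n
    unfolding sig0_u by (intro L_intros ideal.span_base) auto
  then show "U \<bullet> u 0 3 \<in> L" "u 0 3 \<bullet> u 0 3 \<in> L"
    using fixed_dot_fixed_L[of "u 0 _" "u 0 3"] sig0_L[OF u3_L] by simp_all
qed

theorem L_dot:
  assumes "x \<in> L" "y \<in> L" shows "x \<bullet> y \<in> L"
  using assms(1)
proof (induction rule: ideal.span_induct_alt)
  case (step r x z)
  have gen: "U \<bullet> y \<in> L \<and> u 0 3 \<bullet> y \<in> L" using assms(2)
  proof (induction rule: ideal.span_induct_alt)
    case (step r x y)
    then have "x \<in> V" "U \<bullet> x \<in> L" "u 0 3 \<bullet> x \<in> L"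
      using X_L u_dot_u_L a_dot_L[OF u3_L] M_L[OF a_dot_U_M] dot_comm[of _ "a _"] dot_comm[of "u 0 3" U]
      by auto
    with step show ?case by (simp add: dot_add_right dot_mult_right) (intro conjI L_intros; simp)
  qed (simp add: ideal.span_zero)
  have "x \<in> V" "x \<bullet> y \<in> L" using step(1) gen a_dot_L[OF assms(2)] by auto
  with step show ?case by (simp add: dot_add_left dot_mult_left) (intro L_intros)
qed (simp add: ideal.span_zero)

text \<open>With 2d = \<beta>, the element s_{0,n} is \<open>- d * u 0 n\<close>, and
  \<open>d\<close> is a unit.\<close>

lemma L_eq: "L = ideal.span {a (- 2), a (- 1), a 0, a 1, a 2, a 3, a 0 \<bullet> a 1 - 2 * d * (a 0 + a 1),
    a 0 \<bullet> a 3 - 2 * d * (a 0 + a 3)}" (is "_ = ideal.span ?B")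
proof (rule antisym)
  have u_B: "u 0 n \<in> ideal.span ?B" if "a 0 \<bullet> a n - 2 * d * (a 0 + a n) \<in> ?B" for n
  proof (rule unit_mem[OF ideal.subspace_span unit_d])
    have eq: "d * u 0 n = - (a 0 \<bullet> a n - 2 * d * (a 0 + a n))" by (simp add: a_dot_a)
    show "d * u 0 n \<in> ideal.span ?B"
      unfolding eq by (rule ideal.span_neg[OF ideal.span_base[OF that]])
  qed
  have "a n \<in> ideal.span ?B" for n
    by (rule subsetD[OF ideal.span_mono a_in_span]) auto
  then show "L \<subseteq> ideal.span ?B"
    by (intro ideal.span_minimal ideal.subspace_span) (auto intro: u_B)
  show "ideal.span ?B \<subseteq> L"
    by (intro ideal.span_minimal ideal.subspace_span)
      (auto intro: a_L L_intros a_dot_a_L)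
qed

end

section \<open>The product of all axial algebras\<close>

text \<open>The square-zero extension of the product of all axial algebras on the given types. Its elements form a type, so
  that the ring structure can be a class instance. The first factor only provides \<open>0 \<noteq> 1\<close>.\<close>

typedef ('r, 'v) ext = "(UNIV :: int poly fract set) \<times>
    (\<Pi>\<^sub>E X \<in> Collect axial_algebra. carrier (scal X) \<times> carrier (alg (X :: ('r, 'v) axial_data)))"
proof -
  let ?f = "\<lambda>X\<in>Collect axial_algebra. (\<zero>\<^bsub>scal X\<^esub>, \<zero>\<^bsub>alg (X :: ('r, 'v) axial_data)\<^esub>)"
  have "?f \<in> (\<Pi>\<^sub>E X \<in> Collect axial_algebra. carrier (scal X) \<times> carrier (alg X))"
  proof (rule restrict_PiE_iff[THEN iffD2], intro ballI)
    fix X :: "('r, 'v) axial_data" assume "X \<in> Collect axial_algebra"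
    then interpret nonassoc_comm_algebra "scal X" "alg X" by (simp add: axial_algebra_def)
    show "(\<zero>\<^bsub>scal X\<^esub>, \<zero>\<^bsub>alg X\<^esub>) \<in> carrier (scal X) \<times> carrier (alg X)" by simp
  qed
  then have "(0, ?f) \<in> UNIV \<times> (\<Pi>\<^sub>E X \<in> Collect axial_algebra. carrier (scal X) \<times> carrier (alg X))"
    by (rule SigmaI[OF UNIV_I])
  then show ?thesis by blast
qed

section \<open>Components and ring structure of the extension\<close>

definition pad :: "('r, 'v) ext \<Rightarrow> int poly fract"
  where "pad f = fst (Rep_ext f)"

definition sc :: "('r, 'v) ext \<Rightarrow> ('r, 'v) axial_data \<Rightarrow> 'r"
  where "sc f X = fst (snd (Rep_ext f) X)"

definition ve :: "('r, 'v) ext \<Rightarrow> ('r, 'v) axial_data \<Rightarrow> 'v"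
  where "ve f X = snd (snd (Rep_ext f) X)"

definition mk :: "int poly fract \<Rightarrow> (('r, 'v) axial_data \<Rightarrow> 'r) \<Rightarrow> (('r, 'v) axial_data \<Rightarrow> 'v) \<Rightarrow> ('r, 'v) ext"
  where "mk k r v = Abs_ext (k, \<lambda>X\<in>Collect axial_algebra. (r X, v X))"

lemma sc_closed [simp, intro]: "axial_algebra X \<Longrightarrow> sc f X \<in> carrier (scal X)"
  and ve_closed [simp, intro]: "axial_algebra X \<Longrightarrow> ve f X \<in> carrier (alg X)"
proof -
  assume "axial_algebra X"
  then have "snd (Rep_ext f) X \<in> carrier (scal X) \<times> carrier (alg X)"
    using Rep_ext[of f] by (auto simp: PiE_iff)
  then show "sc f X \<in> carrier (scal X)" "ve f X \<in> carrier (alg X)"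
    by (auto simp: sc_def ve_def)
qed

lemma mk_simps:
  assumes "\<And>X. axial_algebra X \<Longrightarrow> r X \<in> carrier (scal X)" "\<And>X. axial_algebra X \<Longrightarrow> v X \<in> carrier (alg X)"
  shows "pad (mk k r v) = k"
    and "axial_algebra X \<Longrightarrow> sc (mk k r v) X = r X" and "axial_algebra X \<Longrightarrow> ve (mk k r v) X = v X"
proof -
  have "Rep_ext (mk k r v) = (k, \<lambda>X\<in>Collect axial_algebra. (r X, v X))"
    unfolding mk_def by (rule Abs_ext_inverse) (use assms in auto)
  then show "pad (mk k r v) = k" "axial_algebra X \<Longrightarrow> sc (mk k r v) X = r X"
    "axial_algebra X \<Longrightarrow> ve (mk k r v) X = v X"
    by (simp_all add: pad_def sc_def ve_def)
qed

lemma ext_eqI: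
  fixes f g :: "('r, 'v) ext"
  assumes "pad f = pad g" "\<And>X. axial_algebra X \<Longrightarrow> sc f X = sc g X"
    "\<And>X. axial_algebra X \<Longrightarrow> ve f X = ve g X"
  shows "f = g"
proof -
  have mem: "snd (Rep_ext h) \<in> (\<Pi>\<^sub>E X \<in> Collect axial_algebra. carrier (scal X) \<times> carrier (alg X))"
    for h :: "('r, 'v) ext"
    using Rep_ext[of h] by (rule SigmaE) simp
  have "snd (Rep_ext f) = snd (Rep_ext g)"
  proof (rule PiE_ext[OF mem mem])
    show "snd (Rep_ext f) X = snd (Rep_ext g) X" if "X \<in> Collect axial_algebra" for X
      using assms(2,3)[of X] that by (simp add: sc_def ve_def prod_eq_iff)
  qed
  then have "Rep_ext f = Rep_ext g"
    using assms(1) by (simp add: pad_def prod_eq_iff)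
  then show ?thesis by (simp add: Rep_ext_inject)
qed

lemma axial_algebraD:
  "axial_algebra X \<Longrightarrow> nonassoc_comm_algebra (scal X) (alg X)"
  "axial_algebra X \<Longrightarrow> str X \<in> ring_hom Dhat (scal X)"
  "axial_algebra X \<Longrightarrow> primitive_axis X (axis0 X) (lam0 X)"
  "axial_algebra X \<Longrightarrow> primitive_axis X (axis1 X) (lam1 X)"
  by (simp_all add: axial_algebra_def)

lemma axial_module: "axial_algebra X \<Longrightarrow> module (scal X) (alg X)"
  using axial_algebraD(1) by (auto simp: nonassoc_comm_algebra_def)

lemma axial_closed:
  assumes "axial_algebra X"
  shows "\<zero>\<^bsub>scal X\<^esub> \<in> carrier (scal X)" "\<one>\<^bsub>scal X\<^esub> \<in> carrier (scal X)"
    and "\<lbrakk>r \<in> carrier (scal X); s \<in> carrier (scal X)\<rbrakk> \<Longrightarrow> r \<oplus>\<^bsub>scal X\<^esub> s \<in> carrier (scal X)"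
    and "r \<in> carrier (scal X) \<Longrightarrow> \<ominus>\<^bsub>scal X\<^esub> r \<in> carrier (scal X)"
    and "\<lbrakk>r \<in> carrier (scal X); s \<in> carrier (scal X)\<rbrakk> \<Longrightarrow> r \<otimes>\<^bsub>scal X\<^esub> s \<in> carrier (scal X)"
    and "\<zero>\<^bsub>alg X\<^esub> \<in> carrier (alg X)"
    and "\<lbrakk>v \<in> carrier (alg X); w \<in> carrier (alg X)\<rbrakk> \<Longrightarrow> v \<oplus>\<^bsub>alg X\<^esub> w \<in> carrier (alg X)"
    and "v \<in> carrier (alg X) \<Longrightarrow> \<ominus>\<^bsub>alg X\<^esub> v \<in> carrier (alg X)"
    and "\<lbrakk>r \<in> carrier (scal X); v \<in> carrier (alg X)\<rbrakk> \<Longrightarrow> r \<odot>\<^bsub>alg X\<^esub> v \<in> carrier (alg X)"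
    and "\<lbrakk>v \<in> carrier (alg X); w \<in> carrier (alg X)\<rbrakk> \<Longrightarrow> v \<otimes>\<^bsub>alg X\<^esub> w \<in> carrier (alg X)"
proof -
  interpret nonassoc_comm_algebra "scal X" "alg X" by (rule axial_algebraD(1)[OF assms])
  show "\<zero>\<^bsub>scal X\<^esub> \<in> carrier (scal X)" "\<one>\<^bsub>scal X\<^esub> \<in> carrier (scal X)"
    "\<lbrakk>r \<in> carrier (scal X); s \<in> carrier (scal X)\<rbrakk> \<Longrightarrow> r \<oplus>\<^bsub>scal X\<^esub> s \<in> carrier (scal X)"
    "r \<in> carrier (scal X) \<Longrightarrow> \<ominus>\<^bsub>scal X\<^esub> r \<in> carrier (scal X)"
    "\<lbrakk>r \<in> carrier (scal X); s \<in> carrier (scal X)\<rbrakk> \<Longrightarrow> r \<otimes>\<^bsub>scal X\<^esub> s \<in> carrier (scal X)"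
    "\<zero>\<^bsub>alg X\<^esub> \<in> carrier (alg X)"
    "\<lbrakk>v \<in> carrier (alg X); w \<in> carrier (alg X)\<rbrakk> \<Longrightarrow> v \<oplus>\<^bsub>alg X\<^esub> w \<in> carrier (alg X)"
    "v \<in> carrier (alg X) \<Longrightarrow> \<ominus>\<^bsub>alg X\<^esub> v \<in> carrier (alg X)"
    "\<lbrakk>r \<in> carrier (scal X); v \<in> carrier (alg X)\<rbrakk> \<Longrightarrow> r \<odot>\<^bsub>alg X\<^esub> v \<in> carrier (alg X)"
    "\<lbrakk>v \<in> carrier (alg X); w \<in> carrier (alg X)\<rbrakk> \<Longrightarrow> v \<otimes>\<^bsub>alg X\<^esub> w \<in> carrier (alg X)"
    by (simp_all add: mult_closed)
qed

instantiation ext :: (type, type) comm_ring_1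
begin

definition zero_ext where "0 = mk 0 (\<lambda>X. \<zero>\<^bsub>scal X\<^esub>) (\<lambda>X. \<zero>\<^bsub>alg X\<^esub>)"

definition one_ext where "1 = mk 1 (\<lambda>X. \<one>\<^bsub>scal X\<^esub>) (\<lambda>X. \<zero>\<^bsub>alg X\<^esub>)"

definition plus_ext where
  "f + g = mk (pad f + pad g) (\<lambda>X. sc f X \<oplus>\<^bsub>scal X\<^esub> sc g X) (\<lambda>X. ve f X \<oplus>\<^bsub>alg X\<^esub> ve g X)"

definition uminus_ext where
  "- f = mk (- pad f) (\<lambda>X. \<ominus>\<^bsub>scal X\<^esub> sc f X) (\<lambda>X. \<ominus>\<^bsub>alg X\<^esub> ve f X)"

definition minus_ext where "f - g = f + (- g :: ('a, 'b) ext)"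

definition times_ext where
  "f * g = mk (pad f * pad g) (\<lambda>X. sc f X \<otimes>\<^bsub>scal X\<^esub> sc g X)
    (\<lambda>X. sc f X \<odot>\<^bsub>alg X\<^esub> ve g X \<oplus>\<^bsub>alg X\<^esub> sc g X \<odot>\<^bsub>alg X\<^esub> ve f X)"

lemma ext_ops:
  fixes X :: "('a, 'b) axial_data" and f g :: "('a, 'b) ext"
  shows "pad (0 :: ('a, 'b) ext) = 0" "axial_algebra X \<Longrightarrow> sc 0 X = \<zero>\<^bsub>scal X\<^esub>"
    "axial_algebra X \<Longrightarrow> ve 0 X = \<zero>\<^bsub>alg X\<^esub>"
    "pad (1 :: ('a, 'b) ext) = 1" "axial_algebra X \<Longrightarrow> sc 1 X = \<one>\<^bsub>scal X\<^esub>"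
    "axial_algebra X \<Longrightarrow> ve 1 X = \<zero>\<^bsub>alg X\<^esub>"
    "pad (f + g) = pad f + pad g" "axial_algebra X \<Longrightarrow> sc (f + g) X = sc f X \<oplus>\<^bsub>scal X\<^esub> sc g X"
    "axial_algebra X \<Longrightarrow> ve (f + g) X = ve f X \<oplus>\<^bsub>alg X\<^esub> ve g X"
    "pad (- f) = - pad f" "axial_algebra X \<Longrightarrow> sc (- f) X = \<ominus>\<^bsub>scal X\<^esub> sc f X"
    "axial_algebra X \<Longrightarrow> ve (- f) X = \<ominus>\<^bsub>alg X\<^esub> ve f X"
    "pad (f * g) = pad f * pad g" "axial_algebra X \<Longrightarrow> sc (f * g) X = sc f X \<otimes>\<^bsub>scal X\<^esub> sc g X"
    "axial_algebra X \<Longrightarrow>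
      ve (f * g) X = sc f X \<odot>\<^bsub>alg X\<^esub> ve g X \<oplus>\<^bsub>alg X\<^esub> sc g X \<odot>\<^bsub>alg X\<^esub> ve f X"
proof -
  show "pad (0 :: ('a, 'b) ext) = 0" "axial_algebra X \<Longrightarrow> sc 0 X = \<zero>\<^bsub>scal X\<^esub>"
    "axial_algebra X \<Longrightarrow> ve 0 X = \<zero>\<^bsub>alg X\<^esub>"
    unfolding zero_ext_def by (rule mk_simps; simp add: axial_closed)+
  show "pad (1 :: ('a, 'b) ext) = 1" "axial_algebra X \<Longrightarrow> sc 1 X = \<one>\<^bsub>scal X\<^esub>"
    "axial_algebra X \<Longrightarrow> ve 1 X = \<zero>\<^bsub>alg X\<^esub>"
    unfolding one_ext_def by (rule mk_simps; simp add: axial_closed)+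
  show "pad (f + g) = pad f + pad g" "axial_algebra X \<Longrightarrow> sc (f + g) X = sc f X \<oplus>\<^bsub>scal X\<^esub> sc g X"
    "axial_algebra X \<Longrightarrow> ve (f + g) X = ve f X \<oplus>\<^bsub>alg X\<^esub> ve g X"
    unfolding plus_ext_def by (rule mk_simps; simp add: axial_closed)+
  show "pad (- f) = - pad f" "axial_algebra X \<Longrightarrow> sc (- f) X = \<ominus>\<^bsub>scal X\<^esub> sc f X"
    "axial_algebra X \<Longrightarrow> ve (- f) X = \<ominus>\<^bsub>alg X\<^esub> ve f X"
    unfolding uminus_ext_def by (rule mk_simps; simp add: axial_closed)+
  show "pad (f * g) = pad f * pad g" "axial_algebra X \<Longrightarrow> sc (f * g) X = sc f X \<otimes>\<^bsub>scal X\<^esub> sc g X"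
    "axial_algebra X \<Longrightarrow>
      ve (f * g) X = sc f X \<odot>\<^bsub>alg X\<^esub> ve g X \<oplus>\<^bsub>alg X\<^esub> sc g X \<odot>\<^bsub>alg X\<^esub> ve f X"
    unfolding times_ext_def by (rule mk_simps; simp add: axial_closed)+
qed

instance
proof
  fix f g h :: "('a, 'b) ext"
  note M = axial_module(1)
  show "f * g * h = f * (g * h)"
  proof (rule ext_eqI)
    fix X :: "('a, 'b) axial_data" assume X: "axial_algebra X"
    interpret module "scal X" "alg X" by (rule M[OF X])
    show "sc (f * g * h) X = sc (f * (g * h)) X"
      using X by (simp add: ext_ops R.m_assoc)
    show "ve (f * g * h) X = ve (f * (g * h)) X"
      using X by (simp add: ext_ops smult_r_distr smult_assoc1[symmetric] R.m_comm M.a_ac)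
  qed (simp add: ext_ops)
  show "f * g = g * f"
  proof (rule ext_eqI)
    fix X :: "('a, 'b) axial_data" assume X: "axial_algebra X"
    interpret module "scal X" "alg X" by (rule M[OF X])
    show "sc (f * g) X = sc (g * f) X" "ve (f * g) X = ve (g * f) X"
      using X by (simp_all add: ext_ops R.m_comm M.a_comm)
  qed (simp add: ext_ops)
  show "1 * f = f"
  proof (rule ext_eqI)
    fix X :: "('a, 'b) axial_data" assume X: "axial_algebra X"
    interpret module "scal X" "alg X" by (rule M[OF X])
    show "sc (1 * f) X = sc f X" "ve (1 * f) X = ve f X"
      using X by (simp_all add: ext_ops smult_r_null)
  qed (simp add: ext_ops)
  show "f + g + h = f + (g + h)"
  proof (rule ext_eqI)
    fix X :: "('a, 'b) axial_data" assume X: "axial_algebra X"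
    interpret module "scal X" "alg X" by (rule M[OF X])
    show "sc (f + g + h) X = sc (f + (g + h)) X" "ve (f + g + h) X = ve (f + (g + h)) X"
      using X by (simp_all add: ext_ops R.a_assoc M.a_assoc)
  qed (simp add: ext_ops)
  show "f + g = g + f"
  proof (rule ext_eqI)
    fix X :: "('a, 'b) axial_data" assume X: "axial_algebra X"
    interpret module "scal X" "alg X" by (rule M[OF X])
    show "sc (f + g) X = sc (g + f) X" "ve (f + g) X = ve (g + f) X"
      using X by (simp_all add: ext_ops R.a_comm M.a_comm)
  qed (simp add: ext_ops)
  show "0 + f = f"
  proof (rule ext_eqI)
    fix X :: "('a, 'b) axial_data" assume X: "axial_algebra X"
    interpret module "scal X" "alg X" by (rule M[OF X])
    show "sc (0 + f) X = sc f X" "ve (0 + f) X = ve f X"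
      using X by (simp_all add: ext_ops)
  qed (simp add: ext_ops)
  show "- f + f = 0"
  proof (rule ext_eqI)
    fix X :: "('a, 'b) axial_data" assume X: "axial_algebra X"
    interpret module "scal X" "alg X" by (rule M[OF X])
    show "sc (- f + f) X = sc 0 X" "ve (- f + f) X = ve 0 X"
      using X by (simp_all add: ext_ops R.l_neg M.l_neg)
  qed (simp add: ext_ops)
  show "f - g = f + - g" by (simp add: minus_ext_def)
  show "(f + g) * h = f * h + g * h"
  proof (rule ext_eqI)
    fix X :: "('a, 'b) axial_data" assume X: "axial_algebra X"
    interpret module "scal X" "alg X" by (rule M[OF X])
    show "sc ((f + g) * h) X = sc (f * h + g * h) X"
      using X by (simp add: ext_ops R.l_distr)
    show "ve ((f + g) * h) X = ve (f * h + g * h) X"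
      using X by (simp add: ext_ops smult_l_distr smult_r_distr M.a_ac)
  qed (simp add: ext_ops distrib_right)
  show "(0 :: ('a, 'b) ext) \<noteq> 1"
    using ext_ops(1,4) by (metis zero_neq_one)
qed

end

lemma ext_minus [simp]:
  fixes X :: "('r, 'v) axial_data"
  shows "pad (f - g) = pad f - pad g"
    "axial_algebra X \<Longrightarrow> sc (f - g) X = sc f X \<ominus>\<^bsub>scal X\<^esub> sc g X"
    "axial_algebra X \<Longrightarrow> ve (f - g) X = ve f X \<ominus>\<^bsub>alg X\<^esub> ve g X"
  unfolding minus_ext_def a_minus_def by (simp_all only: ext_ops diff_conv_add_uminus)

section \<open>Scalars from \<open>Dhat\<close> and the ideal of vectors\<close>

lemma fract_ring_uminus: "\<ominus>\<^bsub>fract_ring\<^esub> x = - x"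
  unfolding a_inv_def m_inv_def fract_ring_def
  by (rule the_equality) (auto simp: eq_neg_iff_add_eq_0 add.commute)

lemma Dhat_closed:
  shows "1 \<in> carrier Dhat" "1 / 2 \<in> carrier Dhat" "beta \<in> carrier Dhat" "1 / beta \<in> carrier Dhat"
    "1 / (1 - beta) \<in> carrier Dhat" "1 / (1 - 2 * beta) \<in> carrier Dhat"
    and "\<lbrakk>x \<in> carrier Dhat; y \<in> carrier Dhat\<rbrakk> \<Longrightarrow> x + y \<in> carrier Dhat"
    and "\<lbrakk>x \<in> carrier Dhat; y \<in> carrier Dhat\<rbrakk> \<Longrightarrow> x * y \<in> carrier Dhat"
    and "x \<in> carrier Dhat \<Longrightarrow> - x \<in> carrier Dhat"
    and "\<lbrakk>x \<in> carrier Dhat; y \<in> carrier Dhat\<rbrakk> \<Longrightarrow> x - y \<in> carrier Dhat"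
proof -
  let ?G = "generate_ring fract_ring {1 / 2, beta, 1 / beta, 1 / (1 - beta), 1 / (1 - 2 * beta)}"
  have D: "carrier Dhat = ?G" by (simp add: Dhat_def)
  show "1 \<in> carrier Dhat" using generate_ring.one[of fract_ring] by (simp add: D fract_ring_def)
  show "1 / 2 \<in> carrier Dhat" "beta \<in> carrier Dhat" "1 / beta \<in> carrier Dhat"
    "1 / (1 - beta) \<in> carrier Dhat" "1 / (1 - 2 * beta) \<in> carrier Dhat"
    unfolding D by (auto intro: generate_ring.incl)
  show add: "\<lbrakk>x \<in> carrier Dhat; y \<in> carrier Dhat\<rbrakk> \<Longrightarrow> x + y \<in> carrier Dhat" for x y
    using generate_ring.eng_add[of x fract_ring _ y] by (simp add: D) (simp add: fract_ring_def)
  show "\<lbrakk>x \<in> carrier Dhat; y \<in> carrier Dhat\<rbrakk> \<Longrightarrow> x * y \<in> carrier Dhat"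
    using generate_ring.eng_mult[of x fract_ring _ y] by (simp add: D) (simp add: fract_ring_def)
  show um: "x \<in> carrier Dhat \<Longrightarrow> - x \<in> carrier Dhat" for x
    using generate_ring.a_inv[of x fract_ring] by (simp add: D fract_ring_uminus)
  show "\<lbrakk>x \<in> carrier Dhat; y \<in> carrier Dhat\<rbrakk> \<Longrightarrow> x - y \<in> carrier Dhat"
    using add[of x "- y"] um by simp
qed

text \<open>Division in the field of fractions is total, so the quotients generating
  \<open>Dhat\<close> are inverses only because these denominators are nonzero.\<close>

lemma beta_units: "(2 :: int poly fract) \<noteq> 0" "beta \<noteq> 0" "1 - beta \<noteq> 0" "1 - 2 * beta \<noteq> 0"
proof -
  have two: "(2 :: int poly fract) = Fract 2 1" by (metis Fract_of_nat_eq of_nat_numeral)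
  show "(2 :: int poly fract) \<noteq> 0" unfolding two Zero_fract_def by (simp add: eq_fract)
  show "beta \<noteq> 0" unfolding beta_def Zero_fract_def by (simp add: eq_fract)
  have "1 - beta = Fract (1 - [:0, 1:]) 1" unfolding beta_def One_fract_def by simp
  then show "1 - beta \<noteq> 0" unfolding Zero_fract_def by (simp add: eq_fract one_pCons)
  have "1 - 2 * beta = Fract (1 - 2 * [:0, 1:]) 1" unfolding beta_def One_fract_def two by simp
  then show "1 - 2 * beta \<noteq> 0" unfolding Zero_fract_def by (simp add: eq_fract one_pCons numeral_poly)
qed

lemma str_hom:
  assumes "axial_algebra X"
  shows "k \<in> carrier Dhat \<Longrightarrow> str X k \<in> carrier (scal X)"
    and "\<lbrakk>k \<in> carrier Dhat; m \<in> carrier Dhat\<rbrakk> \<Longrightarrow> str X (k + m) = str X k \<oplus>\<^bsub>scal X\<^esub> str X m"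
    and "\<lbrakk>k \<in> carrier Dhat; m \<in> carrier Dhat\<rbrakk> \<Longrightarrow> str X (k * m) = str X k \<otimes>\<^bsub>scal X\<^esub> str X m"
    and "str X 1 = \<one>\<^bsub>scal X\<^esub>"
  using axial_algebraD(2)[OF assms]
  by (auto simp: ring_hom_def Dhat_def fract_ring_def Pi_iff)

text \<open>The first component is \<open>k\<close> itself: the units of \<open>Dhat\<close> have to
  be units in every factor of the extension, and the field of fractions provides this in the first
  one.\<close>

definition emb :: "int poly fract \<Rightarrow> ('r, 'v) ext"
  where "emb k = mk k (\<lambda>X. str X k) (\<lambda>X. \<zero>\<^bsub>alg X\<^esub>)"

lemma emb_simps:
  assumes "k \<in> carrier Dhat"
  shows "pad (emb k) = k" "axial_algebra X \<Longrightarrow> sc (emb k) X = str X k" "axial_algebra X \<Longrightarrow> ve (emb k) X = \<zero>\<^bsub>alg X\<^esub>"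
  unfolding emb_def by (rule mk_simps; simp add: axial_closed str_hom assms)+

lemma emb_add: "\<lbrakk>k \<in> carrier Dhat; m \<in> carrier Dhat\<rbrakk> \<Longrightarrow> emb (k + m) = emb k + (emb m :: ('r, 'v) ext)"
  and emb_mult: "\<lbrakk>k \<in> carrier Dhat; m \<in> carrier Dhat\<rbrakk> \<Longrightarrow> emb (k * m) = emb k * (emb m :: ('r, 'v) ext)"
  and emb_one: "emb 1 = (1 :: ('r, 'v) ext)"
proof -
  have zero: "\<zero>\<^bsub>alg X\<^esub> \<oplus>\<^bsub>alg X\<^esub> \<zero>\<^bsub>alg X\<^esub> = \<zero>\<^bsub>alg X\<^esub>"
    "r \<in> carrier (scal X) \<Longrightarrow> r \<odot>\<^bsub>alg X\<^esub> \<zero>\<^bsub>alg X\<^esub> = \<zero>\<^bsub>alg X\<^esub>"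
    if "axial_algebra X" for X :: "('r, 'v) axial_data" and r
  proof -
    interpret module "scal X" "alg X" by (rule axial_module[OF that])
    show "\<zero>\<^bsub>alg X\<^esub> \<oplus>\<^bsub>alg X\<^esub> \<zero>\<^bsub>alg X\<^esub> = \<zero>\<^bsub>alg X\<^esub>"
      "r \<in> carrier (scal X) \<Longrightarrow> r \<odot>\<^bsub>alg X\<^esub> \<zero>\<^bsub>alg X\<^esub> = \<zero>\<^bsub>alg X\<^esub>"
      by (simp_all add: smult_r_null)
  qed
  show "emb 1 = (1 :: ('r, 'v) ext)"
    by (rule ext_eqI) (simp_all add: emb_simps Dhat_closed ext_ops str_hom)
  assume D: "k \<in> carrier Dhat" "m \<in> carrier Dhat"
  show "emb (k + m) = emb k + (emb m :: ('r, 'v) ext)"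
    using D by (intro ext_eqI) (simp_all add: emb_simps Dhat_closed ext_ops str_hom zero)
  show "emb (k * m) = emb k * (emb m :: ('r, 'v) ext)"
    using D by (intro ext_eqI) (simp_all add: emb_simps Dhat_closed ext_ops str_hom zero)
qed

definition vectors :: "('r, 'v) ext set"
  where "vectors = {f. pad f = 0 \<and> (\<forall>X. axial_algebra X \<longrightarrow> sc f X = \<zero>\<^bsub>scal X\<^esub>)}"

definition vec :: "(('r, 'v) axial_data \<Rightarrow> 'v) \<Rightarrow> ('r, 'v) ext"
  where "vec v = mk 0 (\<lambda>X. \<zero>\<^bsub>scal X\<^esub>) v"

definition dotx :: "('r, 'v) ext \<Rightarrow> ('r, 'v) ext \<Rightarrow> ('r, 'v) ext"
  where "dotx f g = vec (\<lambda>X. ve f X \<otimes>\<^bsub>alg X\<^esub> ve g X)"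

definition half_beta :: "('r, 'v) ext"
  where "half_beta = emb (beta * (1 / 2))"

definition inv_beta :: "('r, 'v) ext"
  where "inv_beta = emb (1 / beta)"

lemma vec_in [simp]:
  fixes v :: "('r, 'v) axial_data \<Rightarrow> 'v"
  assumes "\<And>X. axial_algebra X \<Longrightarrow> v X \<in> carrier (alg X)"
  shows "vec v \<in> vectors" and "axial_algebra X \<Longrightarrow> ve (vec v) X = v X"
proof -
  have "pad (vec v) = 0" "axial_algebra X \<Longrightarrow> sc (vec v) X = \<zero>\<^bsub>scal X\<^esub>"
    "axial_algebra X \<Longrightarrow> ve (vec v) X = v X" for X
    unfolding vec_def by (rule mk_simps; simp add: axial_closed assms)+
  then show "vec v \<in> vectors" and "axial_algebra X \<Longrightarrow> ve (vec v) X = v X"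
    by (simp_all add: vectors_def)
qed

lemma vectors_eqI:
  assumes "f \<in> vectors" "g \<in> vectors" "\<And>X. axial_algebra X \<Longrightarrow> ve f X = ve g X"
  shows "f = g"
  using assms by (intro ext_eqI) (simp_all add: vectors_def)

lemma dotx_in [simp]: "dotx f g \<in> vectors"
  and ve_dotx: "axial_algebra X \<Longrightarrow> ve (dotx f g) X = ve f X \<otimes>\<^bsub>alg X\<^esub> ve g X"
  unfolding dotx_def by (simp_all add: axial_closed)

lemma ve_times:
  assumes "f \<in> vectors" "axial_algebra X"
  shows "ve (r * f) X = sc r X \<odot>\<^bsub>alg X\<^esub> ve f X"
proof -
  interpret module "scal X" "alg X" by (rule axial_module[OF assms(2)])
  show ?thesis using assms by (simp add: ext_ops vectors_def smult_l_null)
qed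

lemma vectors_closed:
  fixes f g r :: "('r, 'v) ext"
  shows "0 \<in> vectors" "\<lbrakk>f \<in> vectors; g \<in> vectors\<rbrakk> \<Longrightarrow> f + g \<in> vectors" "f \<in> vectors \<Longrightarrow> r * f \<in> vectors"
proof -
  show "0 \<in> vectors" by (simp add: vectors_def ext_ops)
  have "\<zero>\<^bsub>scal X\<^esub> \<oplus>\<^bsub>scal X\<^esub> \<zero>\<^bsub>scal X\<^esub> = \<zero>\<^bsub>scal X\<^esub>"
    "s \<in> carrier (scal X) \<Longrightarrow> s \<otimes>\<^bsub>scal X\<^esub> \<zero>\<^bsub>scal X\<^esub> = \<zero>\<^bsub>scal X\<^esub>"
    if "axial_algebra X" for X :: "('r, 'v) axial_data" and s
  proof -
    interpret module "scal X" "alg X" by (rule axial_module[OF that])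
    show "\<zero>\<^bsub>scal X\<^esub> \<oplus>\<^bsub>scal X\<^esub> \<zero>\<^bsub>scal X\<^esub> = \<zero>\<^bsub>scal X\<^esub>"
      "s \<in> carrier (scal X) \<Longrightarrow> s \<otimes>\<^bsub>scal X\<^esub> \<zero>\<^bsub>scal X\<^esub> = \<zero>\<^bsub>scal X\<^esub>"
      by simp_all
  qed
  then show "\<lbrakk>f \<in> vectors; g \<in> vectors\<rbrakk> \<Longrightarrow> f + g \<in> vectors" "f \<in> vectors \<Longrightarrow> r * f \<in> vectors"
    by (simp_all add: vectors_def ext_ops)
qed

lemma two_half_beta: "2 * half_beta = (emb beta :: ('r, 'v) ext)"
  and four_half_beta: "4 * half_beta = (emb (2 * beta) :: ('r, 'v) ext)"
proof -
  have b: "beta * (1 / 2) + beta * (1 / 2) = beta" using beta_units(1) by (simp add: field_simps)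
  have "2 * half_beta = half_beta + (half_beta :: ('r, 'v) ext)" by (rule mult_2)
  also have "\<dots> = emb beta"
    unfolding half_beta_def by (subst emb_add[symmetric]) (simp_all only: Dhat_closed b)
  finally show 2: "2 * half_beta = (emb beta :: ('r, 'v) ext)" .
  have "4 * half_beta = 2 * half_beta + 2 * (half_beta :: ('r, 'v) ext)" by (simp add: algebra_simps)
  also have "\<dots> = emb (2 * beta)"
    unfolding 2 by (subst emb_add[symmetric]) (simp_all only: Dhat_closed mult_2)
  finally show "4 * half_beta = (emb (2 * beta) :: ('r, 'v) ext)" .
qed

global_interpretation ext: square_zero_algebra "vectors :: ('r, 'v) ext set" dotx half_beta inv_beta
proof
  fix x y z r :: "('r, 'v) ext"
  show "0 \<in> (vectors :: ('r, 'v) ext set)" "x \<in> vectors \<Longrightarrow> y \<in> vectors \<Longrightarrow> x + y \<in> vectors"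
    "x \<in> vectors \<Longrightarrow> r * x \<in> vectors" "dotx x y \<in> vectors"
    by (simp_all add: vectors_closed)
  note A = axial_algebraD(1)
  show "dotx x y = dotx y x"
    by (rule vectors_eqI) (simp_all add: ve_dotx nonassoc_comm_algebra.mult_comm[OF A])
  show "dotx (x + y) z = dotx x z + dotx y z"
    by (rule vectors_eqI)
      (simp_all add: vectors_closed ve_dotx ext_ops nonassoc_comm_algebra.mult_distr[OF A])
  show "dotx (r * x) y = r * dotx x y" if "x \<in> vectors"
    by (rule vectors_eqI)
      (simp_all add: vectors_closed that ve_dotx ve_times nonassoc_comm_algebra.mult_smult[OF A])
  have "2 * half_beta * inv_beta = (emb (beta * (1 / beta)) :: ('r, 'v) ext)"
    unfolding two_half_beta inv_beta_def by (simp only: emb_mult Dhat_closed)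
  then show "2 * half_beta * inv_beta = (1 :: ('r, 'v) ext)"
    using beta_units(2) by (simp add: emb_one)
  have diff: "1 - emb k = (emb (1 - k) :: ('r, 'v) ext)" if "k \<in> carrier Dhat" for k
  proof -
    have "emb (1 - k + k) = emb (1 - k) + (emb k :: ('r, 'v) ext)"
      by (rule emb_add) (simp_all add: Dhat_closed that)
    then show ?thesis by (simp add: emb_one eq_diff_eq diff_eq_eq)
  qed
  have "1 = (1 - 2 * half_beta) * (emb (1 / (1 - beta)) :: ('r, 'v) ext)"
    unfolding two_half_beta diff[OF Dhat_closed(3)] using beta_units(3)
    by (subst emb_mult[symmetric]) (simp_all add: Dhat_closed emb_one)
  then show "1 - 2 * half_beta dvd (1 :: ('r, 'v) ext)" by (rule dvdI)
  have 2: "2 * beta \<in> carrier Dhat" by (simp only: mult_2 Dhat_closed)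
  have "1 = (1 - 4 * half_beta) * (emb (1 / (1 - 2 * beta)) :: ('r, 'v) ext)"
    unfolding four_half_beta diff[OF 2] using beta_units(4)
    by (subst emb_mult[symmetric]) (simp_all add: Dhat_closed 2 emb_one)
  then show "1 - 4 * half_beta dvd (1 :: ('r, 'v) ext)" by (rule dvdI)
qed

lemma eigenvalue_Dhat: "eigenvalue e \<in> carrier Dhat"
  using Dhat_closed(10)[OF Dhat_closed(1,1)] Dhat_closed(7)[OF Dhat_closed(3,3)]
  by (cases e) (simp_all add: Dhat_closed)

lemma emb_eigenvalue: "emb (eigenvalue Ev1) = (1 :: ('r, 'v) ext)" "emb (eigenvalue Ev0) = (0 :: ('r, 'v) ext)"
  "emb (eigenvalue EvAlpha) = 4 * (half_beta :: ('r, 'v) ext)"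
  "emb (eigenvalue EvBeta) = 2 * (half_beta :: ('r, 'v) ext)"
proof -
  have "0 \<in> carrier Dhat" using eigenvalue_Dhat[of Ev0] by simp
  from emb_add[OF this this] show "emb (eigenvalue Ev0) = (0 :: ('r, 'v) ext)" by simp
qed (simp_all add: emb_one four_half_beta two_half_beta)

lemma ve_sum:
  assumes "finite T" "axial_algebra X"
  shows "ve (sum F T) X = finsum (alg X) (\<lambda>e. ve (F e) X) T"
proof -
  interpret module "scal X" "alg X" by (rule axial_module[OF assms(2)])
  show ?thesis using assms(1)
    by (induction rule: finite_induct) (simp_all add: ext_ops assms(2) Pi_iff)
qed

instance label :: finite
proof
  have "UNIV = {Ev1, Ev0, EvAlpha, EvBeta}" using label.exhaust by auto
  then show "finite (UNIV :: label set)" by (metis finite.emptyI finite_insert)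
qed

lemma UNIV_label: "UNIV = {Ev1, Ev0, EvAlpha, EvBeta}"
  using label.exhaust by auto

section \<open>Axes of the product, assembled from one axis in each algebra\<close>

locale axis_family =
  fixes A :: "('r, 'v) axial_data \<Rightarrow> 'v" and l :: "('r, 'v) axial_data \<Rightarrow> 'v \<Rightarrow> 'r"
  assumes primitive: "axial_algebra X \<Longrightarrow> primitive_axis X (A X) (l X)"
begin

definition form :: "('r, 'v) ext \<Rightarrow> ('r, 'v) ext"
  where "form f = mk 0 (\<lambda>X. l X (ve f X)) (\<lambda>X. \<zero>\<^bsub>alg X\<^esub>)"

lemma A_closed [simp]: "axial_algebra X \<Longrightarrow> A X \<in> carrier (alg X)"
  using primitive by (simp add: primitive_axis_def)

lemma l_linear: "axial_algebra X \<Longrightarrow> linear_form (scal X) (alg X) (l X)"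
  using primitive by (simp add: primitive_axis_def)

lemma form_simps: "pad (form f) = 0" "axial_algebra X \<Longrightarrow> sc (form f) X = l X (ve f X)"
  "axial_algebra X \<Longrightarrow> ve (form f) X = \<zero>\<^bsub>alg X\<^esub>"
proof -
  have "axial_algebra X \<Longrightarrow> l X (ve f X) \<in> carrier (scal X)" for X
    using l_linear[of X] ve_closed[of X f] by (auto simp: linear_form_def)
  then show "pad (form f) = 0" "axial_algebra X \<Longrightarrow> sc (form f) X = l X (ve f X)"
    "axial_algebra X \<Longrightarrow> ve (form f) X = \<zero>\<^bsub>alg X\<^esub>"
    unfolding form_def by (rule mk_simps; simp add: axial_closed)+
qed

lemma eigen_iff:
  assumes "f \<in> vectors"
  shows "dotx (vec A) f = emb (eigenvalue e) * f \<longleftrightarrow>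
    (\<forall>X. axial_algebra X \<longrightarrow> ve f X \<in> eigenspace X (A X) e)"
proof -
  have "dotx (vec A) f = emb (eigenvalue e) * f \<longleftrightarrow>
    (\<forall>X. axial_algebra X \<longrightarrow> ve (dotx (vec A) f) X = ve (emb (eigenvalue e) * f) X)"
    using assms by (metis vectors_eqI dotx_in vectors_closed(3))
  then show ?thesis
    using assms by (auto simp: ve_dotx ve_times emb_simps eigenvalue_Dhat eigenspace_def)
qed

text \<open>Eigencomponents are chosen in every factor, and those with the same label are assembled
  into one vector. The labels are the same in all factors, so the sum remains finite.\<close>

lemma ext_eigensum:
  assumes f: "f \<in> vectors" and sum: "\<And>X. axial_algebra X \<Longrightarrow> ve f X \<in> eigensum X (A X) T"
  obtains F where "\<And>e. e \<in> T \<Longrightarrow> F e \<in> vectors"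
    "\<And>e. e \<in> T \<Longrightarrow> dotx (vec A) (F e) = emb (eigenvalue e) * F e" "f = sum F T"
proof -
  have "\<exists>g. axial_algebra X \<longrightarrow> ve f X = finsum (alg X) g T \<and> (\<forall>d\<in>T. g d \<in> eigenspace X (A X) d)" for X
    using sum[of X] by (auto simp: eigensum_def)
  then obtain g where g: "axial_algebra X \<Longrightarrow> ve f X = finsum (alg X) (g X) T"
    "axial_algebra X \<Longrightarrow> d \<in> T \<Longrightarrow> g X d \<in> eigenspace X (A X) d" for X d
    by metis
  define F where "F e = vec (\<lambda>X. g X e)" for e
  have gc: "axial_algebra X \<Longrightarrow> e \<in> T \<Longrightarrow> g X e \<in> carrier (alg X)" for X e
    using g(2)[of X e] by (simp add: eigenspace_def)
  have FV: "F e \<in> vectors" and Fv: "\<And>X. axial_algebra X \<Longrightarrow> ve (F e) X = g X e" if "e \<in> T" for e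
    using gc that by (simp_all add: F_def)
  have sumV: "sum F T \<in> vectors"
    using finite[of T] FV by (induction T rule: finite_induct) (simp_all add: vectors_closed)
  show ?thesis
  proof
    fix e assume "e \<in> T"
    then show "F e \<in> vectors" "dotx (vec A) (F e) = emb (eigenvalue e) * F e"
      using g FV Fv by (simp_all add: eigen_iff)
  next
    show "f = sum F T"
    proof (rule vectors_eqI[OF f sumV])
      fix X :: "('r, 'v) axial_data" assume X: "axial_algebra X"
      interpret module "scal X" "alg X" by (rule axial_module[OF X])
      have "finsum (alg X) (\<lambda>e. ve (F e) X) T = finsum (alg X) (g X) T"
        using gc[OF X] Fv[OF _ X] by (intro M.finsum_cong') auto
      then show "ve f X = ve (sum F T) X" using g(1)[OF X] X by (simp add: ve_sum)
    qed
  qed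
qed

lemma fusion_eigensum:
  assumes "f \<in> vectors" "g \<in> vectors" "dotx (vec A) f = emb (eigenvalue d) * f"
    "dotx (vec A) g = emb (eigenvalue e) * g"
  obtains F where "\<And>e'. e' \<in> fusion d e \<Longrightarrow> F e' \<in> vectors"
    "\<And>e'. e' \<in> fusion d e \<Longrightarrow> dotx (vec A) (F e') = emb (eigenvalue e') * F e'"
    "dotx f g = sum F (fusion d e)"
proof (rule ext_eigensum[of "dotx f g" "fusion d e"])
  fix X :: "('r, 'v) axial_data" assume X: "axial_algebra X"
  then have "ve f X \<in> eigenspace X (A X) d" "ve g X \<in> eigenspace X (A X) e"
    using assms by (simp_all add: eigen_iff)
  then show "ve (dotx f g) X \<in> eigensum X (A X) (fusion d e)"
    using primitive[OF X] X by (simp add: primitive_axis_def ve_dotx)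
qed (use that in auto)

lemma fusion_single:
  assumes "f \<in> vectors" "g \<in> vectors" "dotx (vec A) f = emb (eigenvalue d) * f"
    "dotx (vec A) g = emb (eigenvalue e) * g" "fusion d e = {e'}"
  shows "dotx (vec A) (dotx f g) = emb (eigenvalue e') * dotx f g"
proof -
  obtain F where "\<And>e'. e' \<in> fusion d e \<Longrightarrow> dotx (vec A) (F e') = emb (eigenvalue e') * F e'"
    "dotx f g = sum F (fusion d e)"
    using fusion_eigensum[OF assms(1-4)] by metis
  then show ?thesis using assms(5) by simp
qed

sublocale axis vectors dotx half_beta inv_beta "vec A" form
proof
  note [simp] = vectors_closed
  show A: "vec A \<in> vectors" by simp
  show "dotx (vec A) (vec A) = vec A"
    using primitive by (intro vectors_eqI) (simp_all add: ve_dotx primitive_axis_def)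
  show "form (f + g) = form f + form g" if "f \<in> vectors" "g \<in> vectors" for f g
  proof (rule ext_eqI)
    fix X :: "('r, 'v) axial_data" assume X: "axial_algebra X"
    interpret module "scal X" "alg X" by (rule axial_module[OF X])
    show "sc (form (f + g)) X = sc (form f + form g) X"
      using l_linear[OF X] X by (simp add: form_simps ext_ops linear_form_def)
    show "ve (form (f + g)) X = ve (form f + form g) X"
      using X by (simp add: form_simps ext_ops)
  qed (simp add: form_simps ext_ops)
  show "form (r * f) * vec A = r * (form f * vec A)" if f: "f \<in> vectors" for r f
  proof (rule vectors_eqI)
    fix X :: "('r, 'v) axial_data" assume X: "axial_algebra X"
    interpret module "scal X" "alg X" by (rule axial_module[OF X])
    have "sc (form f) X \<in> carrier (scal X)" using X by simp
    then show "ve (form (r * f) * vec A) X = ve (r * (form f * vec A)) X"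
      using l_linear[OF X] X f by (simp add: form_simps ve_times linear_form_def smult_assoc1)
  qed simp_all
  show "form (vec A) * vec A = vec A"
  proof (rule vectors_eqI)
    fix X :: "('r, 'v) axial_data" assume X: "axial_algebra X"
    interpret module "scal X" "alg X" by (rule axial_module[OF X])
    show "ve (form (vec A) * vec A) X = ve (vec A) X"
      using primitive[OF X] X by (simp add: ve_times form_simps primitive_axis_def)
  qed simp_all
  fix x x' y y' z z' v :: "('r, 'v) ext"
  show "\<exists>x\<in>vectors. \<exists>y\<in>vectors. \<exists>z\<in>vectors. dotx (vec A) x = 0 \<and> dotx (vec A) y = 4 * half_beta * y \<and>
    dotx (vec A) z = 2 * half_beta * z \<and> v = form v * vec A + x + y + z" if v: "v \<in> vectors"
  proof -
    have "v - form v * vec A \<in> vectors" using v by (simp add: ext.V_diff)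
    moreover have "ve (v - form v * vec A) X \<in> eigensum X (A X) {Ev0, EvAlpha, EvBeta}"
      if X: "axial_algebra X" for X
      using primitive[OF X] X by (simp add: primitive_axis_def ve_times form_simps)
    ultimately obtain F where F: "\<And>e. e \<in> {Ev0, EvAlpha, EvBeta} \<Longrightarrow> F e \<in> vectors"
      "\<And>e. e \<in> {Ev0, EvAlpha, EvBeta} \<Longrightarrow> dotx (vec A) (F e) = emb (eigenvalue e) * F e"
      "v - form v * vec A = sum F {Ev0, EvAlpha, EvBeta}"
      using ext_eigensum by metis
    have "v = form v * vec A + F Ev0 + F EvAlpha + F EvBeta" using F(3) by (simp add: algebra_simps)
    then show ?thesis
      using F(1)[of Ev0] F(1)[of EvAlpha] F(1)[of EvBeta] F(2)[of Ev0] F(2)[of EvAlpha] F(2)[of EvBeta]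
      unfolding emb_eigenvalue by (intro bexI[of _ "F Ev0"] bexI[of _ "F EvAlpha"] bexI[of _ "F EvBeta"]) simp_all
  qed
  note single = fusion_single[of _ _ Ev0 Ev0 Ev0, unfolded emb_eigenvalue]
    fusion_single[of _ _ Ev0 EvAlpha EvAlpha, unfolded emb_eigenvalue]
    fusion_single[of _ _ Ev0 EvBeta EvBeta, unfolded emb_eigenvalue]
    fusion_single[of _ _ EvAlpha EvBeta EvBeta, unfolded emb_eigenvalue]
  show "dotx (vec A) (dotx x x') = 0"
    if "x \<in> vectors" "x' \<in> vectors" "dotx (vec A) x = 0" "dotx (vec A) x' = 0"
    using single(1) that by simp
  show "dotx (vec A) (dotx x y) = 4 * half_beta * dotx x y"
    if "x \<in> vectors" "y \<in> vectors" "dotx (vec A) x = 0" "dotx (vec A) y = 4 * half_beta * y"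
    using single(2) that by simp
  show "dotx (vec A) (dotx x z) = 2 * half_beta * dotx x z"
    if "x \<in> vectors" "z \<in> vectors" "dotx (vec A) x = 0" "dotx (vec A) z = 2 * half_beta * z"
    using single(3) that by simp
  show "dotx (vec A) (dotx y z) = 2 * half_beta * dotx y z"
    if "y \<in> vectors" "z \<in> vectors" "dotx (vec A) y = 4 * half_beta * y" "dotx (vec A) z = 2 * half_beta * z"
    using single(4) that by simp
  show "\<exists>t\<in>vectors. \<exists>x\<in>vectors. dotx (vec A) t = t \<and> dotx (vec A) x = 0 \<and> dotx y y' = t + x"
    if "y \<in> vectors" "y' \<in> vectors" "dotx (vec A) y = 4 * half_beta * y" "dotx (vec A) y' = 4 * half_beta * y'"
  proof (rule fusion_eigensum[of y y' EvAlpha EvAlpha])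
    fix F assume "\<And>e'. e' \<in> fusion EvAlpha EvAlpha \<Longrightarrow> F e' \<in> vectors"
      "\<And>e'. e' \<in> fusion EvAlpha EvAlpha \<Longrightarrow> dotx (vec A) (F e') = emb (eigenvalue e') * F e'"
      "dotx y y' = sum F (fusion EvAlpha EvAlpha)"
    from this(1)[of Ev1] this(1)[of Ev0] this(2)[of Ev1] this(2)[of Ev0] this(3) show ?thesis
      unfolding emb_eigenvalue by (intro bexI[of _ "F Ev1"] bexI[of _ "F Ev0"]) simp_all
  qed (use that in \<open>simp_all only: emb_eigenvalue\<close>)
  show "\<exists>t\<in>vectors. \<exists>x\<in>vectors. \<exists>y\<in>vectors. dotx (vec A) t = t \<and> dotx (vec A) x = 0 \<and>
      dotx (vec A) y = 4 * half_beta * y \<and> dotx z z' = t + x + y"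
    if "z \<in> vectors" "z' \<in> vectors" "dotx (vec A) z = 2 * half_beta * z" "dotx (vec A) z' = 2 * half_beta * z'"
  proof (rule fusion_eigensum[of z z' EvBeta EvBeta])
    fix F assume "\<And>e'. e' \<in> fusion EvBeta EvBeta \<Longrightarrow> F e' \<in> vectors"
      "\<And>e'. e' \<in> fusion EvBeta EvBeta \<Longrightarrow> dotx (vec A) (F e') = emb (eigenvalue e') * F e'"
      "dotx z z' = sum F (fusion EvBeta EvBeta)"
    from this(1)[of Ev1] this(1)[of Ev0] this(1)[of EvAlpha] this(2)[of Ev1] this(2)[of Ev0] this(2)[of EvAlpha]
      this(3) show ?thesis
      unfolding emb_eigenvalue
      by (intro bexI[of _ "F Ev1"] bexI[of _ "F Ev0"] bexI[of _ "F EvAlpha"]) (simp_all add: add.assoc)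
  qed (use that in \<open>simp_all only: emb_eigenvalue\<close>)
qed

end

section \<open>Comparison with the Miyamoto involutions of a single algebra\<close>

context axis_family
begin

text \<open>Zero in the other factors, since zero satisfies every eigenvalue equation; an
  eigenvector of one algebra therefore lifts to an eigenvector of the product.\<close>

definition lift :: "('r, 'v) axial_data \<Rightarrow> 'v \<Rightarrow> ('r, 'v) ext"
  where "lift X v = vec (\<lambda>Y. if Y = X then v else \<zero>\<^bsub>alg Y\<^esub>)"

lemma lift_simps:
  assumes "v \<in> carrier (alg X)"
  shows "lift X v \<in> vectors" and "axial_algebra X \<Longrightarrow> ve (lift X v) X = v"
  using assms by (simp_all add: lift_def axial_closed)

text \<open>\<open>tau\<close> acts factor by factor: \<open>i\<close> is the idempotent that cuts
  out the factor \<open>X\<close>, and \<open>tau\<close> commutes with multiplication by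
  \<open>i\<close>.\<close>

lemma ve_tau_cong:
  assumes "f \<in> vectors" "g \<in> vectors" "axial_algebra X" "ve f X = ve g X"
  shows "ve (tau f) X = ve (tau g) X"
proof -
  define i :: "('r, 'v) ext" where
    "i = mk 0 (\<lambda>Y. if Y = X then \<one>\<^bsub>scal Y\<^esub> else \<zero>\<^bsub>scal Y\<^esub>) (\<lambda>Y. \<zero>\<^bsub>alg Y\<^esub>)"
  have i: "axial_algebra Y \<Longrightarrow> sc i Y = (if Y = X then \<one>\<^bsub>scal Y\<^esub> else \<zero>\<^bsub>scal Y\<^esub>)" for Y
    unfolding i_def by (rule mk_simps) (auto simp: axial_closed)
  have "i * f = i * g"
  proof (rule vectors_eqI)
    fix Y :: "('r, 'v) axial_data" assume Y: "axial_algebra Y"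
    interpret module "scal Y" "alg Y" by (rule axial_module[OF Y])
    show "ve (i * f) Y = ve (i * g) Y"
      using assms Y by (simp add: ve_times i smult_l_null)
  qed (simp_all add: assms vectors_closed)
  then have "i * tau f = i * tau g"
    using assms by (simp flip: tau_mult)
  moreover have "ve (i * h) X = ve h X" if "h \<in> vectors" for h
  proof -
    interpret module "scal X" "alg X" by (rule axial_module[OF assms(3)])
    show ?thesis using that assms(3) by (simp add: ve_times i)
  qed
  ultimately show ?thesis using assms by (metis tau_V)
qed

text \<open>The map that \<open>tau\<close> induces on the factor \<open>X\<close> has all the
  properties demanded of the Miyamoto involution. It is the only such map, because the eigenspaces
  span the algebra and the action on each of them is prescribed.\<close>

lemma miyamoto_ext:
  assumes X: "axial_algebra X"
  shows "miyamoto X (A X) \<in> Bij (carrier (alg X))"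
    and "f \<in> vectors \<Longrightarrow> miyamoto X (A X) (ve f X) = ve (tau f) X"
proof -
  interpret module "scal X" "alg X" by (rule axial_module[OF X])
  let ?C = "carrier (alg X)"
  define t where "t = (\<lambda>v\<in>?C. ve (tau (lift X v)) X)"
  have t_ve: "t (ve f X) = ve (tau f) X" if "f \<in> vectors" for f
    using that X by (simp add: t_def) (intro ve_tau_cong, simp_all add: lift_simps)
  have rep: "\<exists>f\<in>vectors. v = ve f X" if "v \<in> ?C" for v
    using lift_simps[OF that] X by (intro bexI[of _ "lift X v"]) auto
  have t_add: "t (v \<oplus>\<^bsub>alg X\<^esub> w) = t v \<oplus>\<^bsub>alg X\<^esub> t w" if v: "v \<in> ?C" and w: "w \<in> ?C" for v w
  proof -
    from rep[OF v] rep[OF w] obtain f g where "f \<in> vectors" "g \<in> vectors" "v = ve f X" "w = ve g X" by auto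
    then show ?thesis using X t_ve[of "f + g"] t_ve[of f] t_ve[of g]
      by (simp add: ext_ops tau_add)
  qed
  have t_mult: "t (v \<otimes>\<^bsub>alg X\<^esub> w) = t v \<otimes>\<^bsub>alg X\<^esub> t w" if v: "v \<in> ?C" and w: "w \<in> ?C" for v w
  proof -
    from rep[OF v] rep[OF w] obtain f g where "f \<in> vectors" "g \<in> vectors" "v = ve f X" "w = ve g X" by auto
    then show ?thesis using X t_ve[of "dotx f g"] t_ve[of f] t_ve[of g]
      by (simp add: ve_dotx tau_dot)
  qed
  have t_smult: "t (r \<odot>\<^bsub>alg X\<^esub> v) = r \<odot>\<^bsub>alg X\<^esub> t v" if r: "r \<in> carrier (scal X)" and v: "v \<in> ?C" for r v
  proof -
    define k :: "('r, 'v) ext" where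
      "k = mk 0 (\<lambda>Y. if Y = X then r else \<zero>\<^bsub>scal Y\<^esub>) (\<lambda>Y. \<zero>\<^bsub>alg Y\<^esub>)"
    have k: "sc k X = r"
      unfolding k_def using r X by (subst mk_simps) (auto simp: axial_closed)
    from rep[OF v] obtain f where "f \<in> vectors" "v = ve f X" by auto
    then show ?thesis using X t_ve[of "k * f"] t_ve[of f] k
      by (simp add: ve_times tau_mult)
  qed
  have eig: "\<exists>f\<in>vectors. v = ve f X \<and> dotx (vec A) f = emb (eigenvalue e) * f"
    if v: "v \<in> eigenspace X (A X) e" for v e
  proof (intro bexI conjI)
    have vC: "v \<in> ?C" using v by (simp add: eigenspace_def)
    show L: "lift X v \<in> vectors" and "v = ve (lift X v) X" using lift_simps[OF vC] X by auto
    have "\<zero>\<^bsub>alg Y\<^esub> \<in> eigenspace Y (A Y) e" if Y: "axial_algebra Y" for Y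
    proof -
      interpret Y: nonassoc_comm_algebra "scal Y" "alg Y" by (rule axial_algebraD(1)[OF Y])
      have "\<zero>\<^bsub>alg Y\<^esub> \<otimes>\<^bsub>alg Y\<^esub> A Y = \<zero>\<^bsub>scal Y\<^esub> \<odot>\<^bsub>alg Y\<^esub> (A Y \<otimes>\<^bsub>alg Y\<^esub> A Y)"
        using Y.mult_smult[of "\<zero>\<^bsub>scal Y\<^esub>" "A Y" "A Y"] Y by (simp add: Y.smult_l_null)
      then have "A Y \<otimes>\<^bsub>alg Y\<^esub> \<zero>\<^bsub>alg Y\<^esub> = \<zero>\<^bsub>alg Y\<^esub>"
        using Y Y.mult_comm[of "A Y" "\<zero>\<^bsub>alg Y\<^esub>"] by (simp add: Y.smult_l_null Y.mult_closed)
      then show ?thesis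
        using str_hom(1)[OF Y eigenvalue_Dhat] by (simp add: eigenspace_def Y.smult_r_null)
    qed
    then show "dotx (vec A) (lift X v) = emb (eigenvalue e) * lift X v"
      unfolding eigen_iff[OF L] using v vC by (auto simp: lift_def axial_closed)
  qed
  have t_eig: "t v = v" if v: "v \<in> eigenspace X (A X) e" and e: "e \<noteq> EvBeta" for v e
  proof -
    obtain f where f: "f \<in> vectors" "v = ve f X" "dotx (vec A) f = emb (eigenvalue e) * f"
      using eig[OF v] by blast
    have "tau f = f"
    proof (cases e)
      case Ev1
      then have "f = form f * vec A" using eigen_1[OF f(1)] f(3) by (simp only: emb_eigenvalue) simp
      moreover have "tau (form f * vec A) = form f * vec A"
        using sig_tau_eigen(8)[of 0 0 0] by (simp add: tau_mult)
      ultimately show ?thesis by simp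
    next
      case Ev0
      then show ?thesis using f sig_tau_eigen(5)[of f 0 0] by (simp only: emb_eigenvalue) simp
    next
      case EvAlpha
      then show ?thesis using f sig_tau_eigen(6)[of 0 f 0] by (simp only: emb_eigenvalue) simp
    qed (use e in simp)
    then show ?thesis using t_ve[OF f(1)] f(2) by simp
  qed
  have t_beta: "t v = \<ominus>\<^bsub>alg X\<^esub> v" if v: "v \<in> eigenspace X (A X) EvBeta" for v
  proof -
    obtain f where f: "f \<in> vectors" "v = ve f X" "dotx (vec A) f = emb (eigenvalue EvBeta) * f"
      using eig[OF v] by blast
    have "tau f = - f" using f sig_tau_eigen(7)[of 0 0 f] by (simp only: emb_eigenvalue) simp
    then show ?thesis using t_ve[OF f(1)] f(2) X by (simp add: ext_ops)
  qed
  have eC: "v \<in> ?C" if "v \<in> eigenspace X (A X) e" for v e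
    using that by (simp add: eigenspace_def)
  have t_plus: "t v = v" if "v \<in> eigensum X (A X) {Ev1, Ev0, EvAlpha}" for v
  proof -
    from that obtain g where g: "g Ev1 \<in> eigenspace X (A X) Ev1" "g Ev0 \<in> eigenspace X (A X) Ev0"
      "g EvAlpha \<in> eigenspace X (A X) EvAlpha" "v = finsum (alg X) g {Ev1, Ev0, EvAlpha}"
      by (auto simp: eigensum_def)
    then have "v = g Ev1 \<oplus>\<^bsub>alg X\<^esub> (g Ev0 \<oplus>\<^bsub>alg X\<^esub> g EvAlpha)"
      using eC by (simp add: Pi_iff)
    then show ?thesis using g eC by (simp add: t_add t_eig)
  qed
  have tC: "t v \<in> ?C" if "v \<in> ?C" for v
    using that X by (simp add: t_def)
  have tt: "t (t v) = v" if v: "v \<in> ?C" for v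
  proof -
    from rep[OF v] obtain f where "f \<in> vectors" "v = ve f X" by auto
    then show ?thesis using t_ve[of f] t_ve[of "tau f"] by simp
  qed
  have tBij: "t \<in> Bij ?C"
    unfolding Bij_def using tC tt by (auto simp: t_def intro!: bij_betw_byWitness[of _ t])
  have "miyamoto X (A X) = t"
    unfolding miyamoto_def
  proof (rule the_equality)
    show "t \<in> Bij ?C \<and>
      (\<forall>v\<in>?C. \<forall>w\<in>?C. t (v \<oplus>\<^bsub>alg X\<^esub> w) = t v \<oplus>\<^bsub>alg X\<^esub> t w \<and> t (v \<otimes>\<^bsub>alg X\<^esub> w) = t v \<otimes>\<^bsub>alg X\<^esub> t w) \<and>
      (\<forall>r\<in>carrier (scal X). \<forall>v\<in>?C. t (r \<odot>\<^bsub>alg X\<^esub> v) = r \<odot>\<^bsub>alg X\<^esub> t v) \<and>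
      (\<forall>v\<in>eigensum X (A X) {Ev1, Ev0, EvAlpha}. t v = v) \<and>
      (\<forall>v\<in>eigenspace X (A X) EvBeta. t v = \<ominus>\<^bsub>alg X\<^esub> v)"
      using tBij t_add t_mult t_smult t_plus t_beta by simp
  next
    fix t'
    assume t': "t' \<in> Bij ?C \<and>
      (\<forall>v\<in>?C. \<forall>w\<in>?C. t' (v \<oplus>\<^bsub>alg X\<^esub> w) = t' v \<oplus>\<^bsub>alg X\<^esub> t' w \<and> t' (v \<otimes>\<^bsub>alg X\<^esub> w) = t' v \<otimes>\<^bsub>alg X\<^esub> t' w) \<and>
      (\<forall>r\<in>carrier (scal X). \<forall>v\<in>?C. t' (r \<odot>\<^bsub>alg X\<^esub> v) = r \<odot>\<^bsub>alg X\<^esub> t' v) \<and>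
      (\<forall>v\<in>eigensum X (A X) {Ev1, Ev0, EvAlpha}. t' v = v) \<and>
      (\<forall>v\<in>eigenspace X (A X) EvBeta. t' v = \<ominus>\<^bsub>alg X\<^esub> v)"
    show "t' = t"
    proof (rule extensionalityI[of _ ?C])
      show "t' \<in> extensional ?C" "t \<in> extensional ?C" using t' tBij by (simp_all add: Bij_def)
      fix v assume v: "v \<in> ?C"
      then have "v \<in> eigensum X (A X) UNIV" using primitive[OF X] by (simp add: primitive_axis_def)
      then obtain g where g: "\<And>e. g e \<in> eigenspace X (A X) e" and vg: "v = finsum (alg X) g UNIV"
        by (auto simp: eigensum_def)
      define w where "w = finsum (alg X) g {Ev1, Ev0, EvAlpha}"
      have gC: "g e \<in> ?C" for e using g eC by blast
      \<comment> \<open>Splitting off the \<beta>-component leaves two summands, on which the action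
        of \<open>t'\<close> is prescribed.\<close>
      have UN: "UNIV = insert EvBeta {Ev1, Ev0, EvAlpha}" using UNIV_label by auto
      have wC: "w \<in> ?C" unfolding w_def using gC by (intro M.finsum_closed) auto
      have vw: "v = g EvBeta \<oplus>\<^bsub>alg X\<^esub> w"
        unfolding vg UN w_def using gC by (subst M.finsum_insert) auto
      have wE: "w \<in> eigensum X (A X) {Ev1, Ev0, EvAlpha}"
        unfolding eigensum_def w_def using g by auto
      have "t' v = \<ominus>\<^bsub>alg X\<^esub> g EvBeta \<oplus>\<^bsub>alg X\<^esub> w"
        unfolding vw using t' gC wC g wE by simp
      also have "\<dots> = t v" unfolding vw using gC wC g wE by (simp add: t_add t_plus t_beta)
      finally show "t' v = t v" .
    qed
  qed
  then show "miyamoto X (A X) \<in> Bij ?C" "f \<in> vectors \<Longrightarrow> miyamoto X (A X) (ve f X) = ve (tau f) X"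
    using tBij t_ve by simp_all
qed

end

global_interpretation family0: axis_family axis0 lam0
  by unfold_locales (rule axial_algebraD(3))

global_interpretation family1: axis_family axis1 lam1
  by unfold_locales (rule axial_algebraD(4))

lemma miyamoto_axis:
  fixes X :: "('r, 'v) axial_data"
  assumes "axial_algebra X"
  shows "miyamoto X (axis0 X) \<in> Bij (carrier (alg X))" "miyamoto X (axis1 X) \<in> Bij (carrier (alg X))"
    and "v \<in> carrier (alg X) \<Longrightarrow> miyamoto X (axis0 X) (miyamoto X (axis0 X) v) = v"
    and "v \<in> carrier (alg X) \<Longrightarrow> miyamoto X (axis1 X) (miyamoto X (axis1 X) v) = v"
    and "miyamoto X (axis0 X) (axis0 X) = axis0 X" "miyamoto X (axis1 X) (axis1 X) = axis1 X"
proof -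
  note X = assms
  note m0 = family0.miyamoto_ext(2)[OF X] and m1 = family1.miyamoto_ext(2)[OF X]
  show "miyamoto X (axis0 X) \<in> Bij (carrier (alg X))" "miyamoto X (axis1 X) \<in> Bij (carrier (alg X))"
    using X by (rule family0.miyamoto_ext family1.miyamoto_ext)+
  show "miyamoto X (axis0 X) (miyamoto X (axis0 X) v) = v" if "v \<in> carrier (alg X)"
    using m0[of "family0.lift X v"] m0[of "family0.tau (family0.lift X v)"] family0.lift_simps[OF that] X by simp
  show "miyamoto X (axis1 X) (miyamoto X (axis1 X) v) = v" if "v \<in> carrier (alg X)"
    using m1[of "family1.lift X v"] m1[of "family1.tau (family1.lift X v)"] family1.lift_simps[OF that] X by simp
  show "miyamoto X (axis0 X) (axis0 X) = axis0 X"
  proof -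
    have "family0.tau (vec axis0) = (vec axis0 :: ('r, 'v) ext)"
      by (rule family0.sig_tau_eigen(8)[of 0 0 0]) simp_all
    then show ?thesis using m0[of "vec axis0"] X by simp
  qed
  show "miyamoto X (axis1 X) (axis1 X) = axis1 X"
  proof -
    have "family1.tau (vec axis1) = (vec axis1 :: ('r, 'v) ext)"
      by (rule family1.sig_tau_eigen(8)[of 0 0 0]) simp_all
    then show ?thesis using m1[of "vec axis1"] X by simp
  qed
qed

lemma ax_properties:
  assumes X: "axial_algebra X"
  shows "ax X 0 = axis0 X" "ax X 1 = axis1 X" "ax X n \<in> carrier (alg X)"
    "miyamoto X (axis0 X) (ax X n) = ax X (- n)" "miyamoto X (axis1 X) (ax X n) = ax X (2 - n)"
proof -
  let ?C = "carrier (alg X)"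
  let ?m0 = "miyamoto X (axis0 X)" and ?m1 = "miyamoto X (axis1 X)"
  interpret G: group "BijGroup ?C" by (rule group_BijGroup)
  note m = miyamoto_axis[OF X]
  have carrier_G: "carrier (BijGroup ?C) = Bij ?C" by (simp add: BijGroup_def)
  have mC: "?m0 v \<in> ?C" "?m1 v \<in> ?C" if "v \<in> ?C" for v
    using m(1,2) that by (auto dest: Bij_imp_funcset)
  have aC: "axis0 X \<in> ?C" "axis1 X \<in> ?C"
    using family0.A_closed[OF X] family1.A_closed[OF X] by simp_all
  have mult: "(g \<otimes>\<^bsub>BijGroup ?C\<^esub> f) v = g (f v)" if "g \<in> Bij ?C" "f \<in> Bij ?C" "v \<in> ?C" for f g v
    using that by (simp add: BijGroup_def compose_def)
  have rho: "rho X \<in> Bij ?C" and rho_v: "\<And>v. v \<in> ?C \<Longrightarrow> rho X v = ?m1 (?m0 v)"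
    using G.m_closed[of ?m1 ?m0] m(1,2) mult[OF m(2,1)] by (auto simp: carrier_G rho_def)
  have pow: "rho X [^]\<^bsub>BijGroup ?C\<^esub> k \<in> Bij ?C" for k :: int
    using G.int_pow_closed[of "rho X" k] rho by (simp add: carrier_G)
  have ax_C: "ax X n \<in> ?C" for n
    using Bij_imp_funcset[OF pow] aC by (auto simp: ax_def)
  have one: "\<one>\<^bsub>BijGroup ?C\<^esub> v = v" if "v \<in> ?C" for v
    using that by (simp add: BijGroup_def)
  show ax0: "ax X 0 = axis0 X" and ax1: "ax X 1 = axis1 X"
    using aC one by (simp_all add: ax_def)
  have step: "ax X (n + 2) = ?m1 (?m0 (ax X n))" for n
  proof -
    have "rho X [^]\<^bsub>BijGroup ?C\<^esub> (1 + n div 2) = rho X \<otimes>\<^bsub>BijGroup ?C\<^esub> rho X [^]\<^bsub>BijGroup ?C\<^esub> (n div 2)"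
      using G.int_pow_mult[of "rho X" 1 "n div 2"] rho by (simp add: carrier_G)
    moreover have e: "(n + 2) div 2 = 1 + n div 2" by simp
    ultimately have "ax X (n + 2) = rho X (ax X n)"
      unfolding ax_def e using aC by (simp add: mult[OF rho pow])
    then show ?thesis using rho_v[OF ax_C] by simp
  qed
  have previous: "ax X n = ?m0 (?m1 (ax X (n + 2)))" for n
    using step[of n] m(3,4) mC ax_C by simp
  have "?m0 (ax X n) = ax X (- n) \<and> ?m1 (ax X n) = ax X (2 - n)"
  \<comment> \<open>Both reflection laws are carried together: the step upwards uses the law for
    \<open>axis0\<close> at \<open>i\<close>, the step downwards the law for
    \<open>axis1\<close>.\<close>
  proof (induction n rule: int_parity_induct)
    case 1
    show ?case using step[of 0] m(5) ax0 by simp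
  next
    case 2
    show ?case using previous[of "-1"] m(6) ax1 by simp
  next
    case (3 i)
    have "?m1 (ax X (i + 2)) = ax X (- i)"
      using step[of i] 3 m(4) ax_C by simp
    moreover have "?m0 (ax X (i + 2)) = ax X (- i - 2)"
      using previous[of "- i - 2"] step[of i] 3 by simp
    ultimately show ?case by (simp add: algebra_simps)
  next
    case (4 i)
    have i: "ax X (i - 2) = ?m0 (ax X (2 - i))" using previous[of "i - 2"] 4 by simp
    then have "?m0 (ax X (i - 2)) = ax X (2 - i)" using m(3) ax_C by simp
    moreover have "?m1 (ax X (i - 2)) = ax X (4 - i)" using step[of "2 - i"] i by simp
    ultimately show ?case by simp
  qed
  then show "ax X n \<in> ?C" "?m0 (ax X n) = ax X (- n)" "?m1 (ax X n) = ax X (2 - n)"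
    using ax_C by simp_all
qed

definition ax_ext :: "int \<Rightarrow> ('r, 'v) ext"
  where "ax_ext n = vec (\<lambda>X. ax X n)"

lemma vec_cong:
  assumes "\<And>X. axial_algebra X \<Longrightarrow> v X = w X"
  shows "vec v = vec w"
  unfolding vec_def mk_def using assms by (simp cong: restrict_cong)

lemma ax_ext_axes: "ax_ext 0 = vec axis0" "ax_ext 1 = vec axis1"
  unfolding ax_ext_def by (rule vec_cong, simp add: ax_properties)+

global_interpretation ext: dihedral "vectors :: ('r, 'v) ext set" dotx half_beta inv_beta ax_ext family0.form family1.form
proof -
  have in_V: "ax_ext n \<in> (vectors :: ('r, 'v) ext set)" for n
    by (simp add: ax_ext_def ax_properties)
  have ve_ax: "axial_algebra X \<Longrightarrow> ve (ax_ext n) X = ax X n" for X :: "('r, 'v) axial_data" and n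
    by (simp add: ax_ext_def ax_properties)
  show "dihedral (vectors :: ('r, 'v) ext set) dotx half_beta inv_beta ax_ext family0.form family1.form"
  proof (intro dihedral.intro dihedral_axioms.intro, unfold ax_ext_axes)
    show "square_zero_algebra (vectors :: ('r, 'v) ext set) dotx half_beta inv_beta" by (rule ext.square_zero_algebra_axioms)
    show "axis (vectors :: ('r, 'v) ext set) dotx half_beta inv_beta (vec axis0) family0.form" by (rule family0.axis_axioms)
    show "axis (vectors :: ('r, 'v) ext set) dotx half_beta inv_beta (vec axis1) family1.form" by (rule family1.axis_axioms)
    fix n
    show "ax_ext n \<in> (vectors :: ('r, 'v) ext set)" by (rule in_V)
    show "family0.tau (ax_ext n) = (ax_ext (- n) :: ('r, 'v) ext)"
    proof (rule vectors_eqI)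
      fix X :: "('r, 'v) axial_data" assume X: "axial_algebra X"
      show "ve (family0.tau (ax_ext n)) X = ve (ax_ext (- n)) X"
        using family0.miyamoto_ext(2)[OF X in_V, of n] X by (simp add: ve_ax ax_properties)
    qed (simp_all add: in_V)
    show "family1.tau (ax_ext n) = (ax_ext (2 - n) :: ('r, 'v) ext)"
    proof (rule vectors_eqI)
      fix X :: "('r, 'v) axial_data" assume X: "axial_algebra X"
      show "ve (family1.tau (ax_ext n)) X = ve (ax_ext (2 - n)) X"
        using family1.miyamoto_ext(2)[OF X in_V, of n] X by (simp add: ve_ax ax_properties)
    qed (simp_all add: in_V)
  qed
qed

section \<open>From the product back to a single algebra\<close>

lemma (in module) combination_add:
  assumes S: "finite S" "S \<subseteq> carrier M" and c: "\<And>x. x \<in> S \<Longrightarrow> c x \<in> carrier R"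
    and s: "s \<in> S" and r: "r \<in> carrier R"
  shows "r \<odot>\<^bsub>M\<^esub> s \<oplus>\<^bsub>M\<^esub> finsum M (\<lambda>x. c x \<odot>\<^bsub>M\<^esub> x) S =
    finsum M (\<lambda>x. (if x = s then r \<oplus> c x else c x) \<odot>\<^bsub>M\<^esub> x) S"
proof -
  have ins: "S = insert s (S - {s})" using s by blast
  have 1: "finsum M (\<lambda>x. c x \<odot>\<^bsub>M\<^esub> x) S = c s \<odot>\<^bsub>M\<^esub> s \<oplus>\<^bsub>M\<^esub> finsum M (\<lambda>x. c x \<odot>\<^bsub>M\<^esub> x) (S - {s})"
    using S c s by (subst ins, subst M.finsum_insert) (auto simp: Pi_iff)
  have 2: "finsum M (\<lambda>x. (if x = s then r \<oplus> c x else c x) \<odot>\<^bsub>M\<^esub> x) S =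
      (r \<oplus> c s) \<odot>\<^bsub>M\<^esub> s \<oplus>\<^bsub>M\<^esub> finsum M (\<lambda>x. (if x = s then r \<oplus> c x else c x) \<odot>\<^bsub>M\<^esub> x) (S - {s})"
    using S c s r by (subst ins, subst M.finsum_insert) (auto simp: Pi_iff)
  have 3: "finsum M (\<lambda>x. (if x = s then r \<oplus> c x else c x) \<odot>\<^bsub>M\<^esub> x) (S - {s}) =
      finsum M (\<lambda>x. c x \<odot>\<^bsub>M\<^esub> x) (S - {s})"
    using S c by (intro M.finsum_cong') (auto simp: Pi_iff)
  have "finsum M (\<lambda>x. c x \<odot>\<^bsub>M\<^esub> x) (S - {s}) \<in> carrier M"
    using S c by (intro M.finsum_closed) auto
  moreover have "s \<in> carrier M" "c s \<in> carrier R" using S s c by auto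
  ultimately show ?thesis
    unfolding 1 2 3 using r by (simp add: smult_l_distr M.a_assoc)
qed

text \<open>The component at \<open>X\<close> of the module \<open>L\<close> is a subalgebra
  containing both axes, hence all of the algebra, as the axes generate it. The eight generators of
  \<open>L\<close> project to the eight elements of \<open>X\<close>.\<close>

lemma spans_axial:
  fixes X :: "('r, 'v) axial_data"
  assumes X: "axial_algebra X"
  shows "spans (scal X) (alg X)
    {ax X (-2), ax X (-1), ax X 0, ax X 1, ax X 2, ax X 3, s0 X 1, s0 X 3}" (is "spans _ _ ?S")
proof -
  interpret nonassoc_comm_algebra "scal X" "alg X" by (rule axial_algebraD(1)[OF X])
  let ?a = "ax_ext :: int \<Rightarrow> ('r, 'v) ext"
  define s where "s n = dotx (?a 0) (?a n) - 2 * half_beta * (?a 0 + ?a n)" for n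
  define B where "B = {?a (- 2), ?a (- 1), ?a 0, ?a 1, ?a 2, ?a 3, s 1, s 3}"
  define L where "L = ideal.span B"
  have L_eq: "L = ideal.span (insert (ext.u 0 3) (insert (ext.u 0 1) (range ?a)))"
    unfolding L_def B_def s_def by (rule ext.L_eq[symmetric])
  have L_V: "f \<in> vectors" if "f \<in> L" for f
    using ext.L_V that unfolding L_eq .
  have L_dot: "dotx f g \<in> L" if "f \<in> L" "g \<in> L" for f g
    using ext.L_dot that unfolding L_eq .
  have ve_a: "ve (?a n) X = ax X n" for n
    using X by (simp add: ax_ext_def ax_properties)
  have ve_s: "ve (s n) X = s0 X n" for n
    using X ax_properties[OF X]
    by (simp add: s_def s0_def ve_dotx ve_a ext_minus two_half_beta ve_times emb_simps Dhat_closed ext_ops(9))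
  define S where "S = ?S"
  have S_image: "S = (\<lambda>f. ve f X) ` B"
    by (simp add: S_def B_def ve_a ve_s)
  have S: "finite S" "S \<subseteq> carrier (alg X)"
    unfolding S_image using X by (auto simp: B_def)
  let ?W = "(\<lambda>f. ve f X) ` L"
  have smult: "r \<odot>\<^bsub>alg X\<^esub> w \<in> ?W" if r: "r \<in> carrier (scal X)" and w: "w \<in> ?W" for r w
  proof -
    obtain f where f: "f \<in> L" "w = ve f X" using w by blast
    \<comment> \<open>A scalar of \<open>X\<close>, extended by zero to the other factors, is a
      scalar of the extension, under which \<open>L\<close> is closed.\<close>
    define k :: "('r, 'v) ext" where
      "k = mk 0 (\<lambda>Y. if Y = X then r else \<zero>\<^bsub>scal Y\<^esub>) (\<lambda>Y. \<zero>\<^bsub>alg Y\<^esub>)"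
    have "sc k X = r"
      unfolding k_def using r X by (subst mk_simps) (auto simp: axial_closed)
    then have "r \<odot>\<^bsub>alg X\<^esub> w = ve (k * f) X"
      using f X by (simp add: ve_times L_V)
    moreover have "k * f \<in> L" using f unfolding L_def by (intro ideal.span_scale)
    ultimately show ?thesis by blast
  qed
  have "subalgebra ?W (scal X) (alg X)"
    unfolding subalgebra_def
  proof (intro conjI ballI)
    show "submodule ?W (scal X) (alg X)"
    proof (rule submoduleI)
      show "?W \<subseteq> carrier (alg X)" using X by auto
      have "ve 0 X = \<zero>\<^bsub>alg X\<^esub>" using X by (simp add: ext_ops)
      then show "\<zero>\<^bsub>alg X\<^esub> \<in> ?W" unfolding L_def using ideal.span_zero by (metis image_eqI)
      show "\<ominus>\<^bsub>alg X\<^esub> w \<in> ?W" if w: "w \<in> ?W" for w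
      proof -
        obtain f where "f \<in> L" "w = ve f X" using w by blast
        then have "\<ominus>\<^bsub>alg X\<^esub> w = ve (- f) X" "- f \<in> L"
          using X by (simp_all add: ext_ops L_def ideal.span_neg)
        then show ?thesis by blast
      qed
      show "v \<oplus>\<^bsub>alg X\<^esub> w \<in> ?W" if "v \<in> ?W" "w \<in> ?W" for v w
      proof -
        obtain f g where "f \<in> L" "v = ve f X" "g \<in> L" "w = ve g X" using \<open>v \<in> ?W\<close> \<open>w \<in> ?W\<close> by blast
        then have "v \<oplus>\<^bsub>alg X\<^esub> w = ve (f + g) X" "f + g \<in> L"
          using X by (simp_all add: ext_ops L_def ideal.span_add)
        then show ?thesis by blast
      qed
    qed (rule smult)
    fix v w assume "v \<in> ?W" "w \<in> ?W"
    then obtain f g where "f \<in> L" "v = ve f X" "g \<in> L" "w = ve g X" by blast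
    then have "v \<otimes>\<^bsub>alg X\<^esub> w = ve (dotx f g) X" "dotx f g \<in> L"
      using X by (simp_all add: ve_dotx L_dot)
    then show "v \<otimes>\<^bsub>alg X\<^esub> w \<in> ?W" by blast
  qed
  moreover have "?a 0 \<in> L" "?a 1 \<in> L"
    unfolding L_def by (rule ideal.span_base; simp add: B_def)+
  then have "axis0 X \<in> ?W" "axis1 X \<in> ?W"
    using ve_a[of 0] ve_a[of 1] ax_properties(1,2)[OF X] by force+
  ultimately have W: "?W = carrier (alg X)"
    using X by (simp add: axial_algebra_def)
  \<comment> \<open>Coefficients are functions on the set \<open>S\<close>, in which some of the
    eight elements may coincide. Adding a multiple of one generator changes a single value of the
    function.\<close>
  have combination: "\<exists>c. (\<forall>x\<in>S. c x \<in> carrier (scal X)) \<and>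
      ve f X = finsum (alg X) (\<lambda>x. c x \<odot>\<^bsub>alg X\<^esub> x) S" if "f \<in> L" for f
    using that unfolding L_def
  proof (induction rule: ideal.span_induct_alt)
    case base
    have "finsum (alg X) (\<lambda>x. \<zero>\<^bsub>scal X\<^esub> \<odot>\<^bsub>alg X\<^esub> x) S = finsum (alg X) (\<lambda>x. \<zero>\<^bsub>alg X\<^esub>) S"
      using S(2) by (intro M.finsum_cong') (auto simp: smult_l_null)
    then show ?case
      using X by (intro exI[of _ "\<lambda>_. \<zero>\<^bsub>scal X\<^esub>"]) (simp add: ext_ops)
  next
    case (step k b f)
    then obtain c where c: "\<And>x. x \<in> S \<Longrightarrow> c x \<in> carrier (scal X)"
      "ve f X = finsum (alg X) (\<lambda>x. c x \<odot>\<^bsub>alg X\<^esub> x) S" by blast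
    have b: "ve b X \<in> S" unfolding S_image using step(1) by blast
    have "b \<in> vectors" using L_V step(1) unfolding L_def by (simp add: ideal.span_base)
    then have "ve (k * b + f) X = sc k X \<odot>\<^bsub>alg X\<^esub> ve b X \<oplus>\<^bsub>alg X\<^esub> finsum (alg X) (\<lambda>x. c x \<odot>\<^bsub>alg X\<^esub> x) S"
      using X by (simp add: ext_ops(9) ve_times c(2))
    also have "\<dots> = finsum (alg X) (\<lambda>x. (if x = ve b X then sc k X \<oplus>\<^bsub>scal X\<^esub> c x else c x) \<odot>\<^bsub>alg X\<^esub> x) S"
      using X by (intro combination_add S c b) auto
    finally show ?case
      using c(1) X by (intro exI[of _ "\<lambda>x. if x = ve b X then sc k X \<oplus>\<^bsub>scal X\<^esub> c x else c x"]) auto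
  qed
  show ?thesis
    unfolding spans_def S_def[symmetric]
  proof (intro conjI S(2) equalityI subsetI)
    fix v assume "v \<in> carrier (alg X)"
    then obtain f where "f \<in> L" "v = ve f X" using W by blast
    then show "v \<in> {finsum (alg X) (\<lambda>x. c x \<odot>\<^bsub>alg X\<^esub> x) A |c A.
        finite A \<and> A \<subseteq> S \<and> (\<forall>x\<in>A. c x \<in> carrier (scal X))}"
      using combination S(1) by blast
  next
    fix v assume "v \<in> {finsum (alg X) (\<lambda>x. c x \<odot>\<^bsub>alg X\<^esub> x) A |c A.
        finite A \<and> A \<subseteq> S \<and> (\<forall>x\<in>A. c x \<in> carrier (scal X))}"
    then obtain c A where "v = finsum (alg X) (\<lambda>x. c x \<odot>\<^bsub>alg X\<^esub> x) A" "A \<subseteq> S"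
      "\<And>x. x \<in> A \<Longrightarrow> c x \<in> carrier (scal X)" by blast
    moreover from this S(2) have "\<And>x. x \<in> A \<Longrightarrow> x \<in> carrier (alg X)" by blast
    ultimately show "v \<in> carrier (alg X)" by (auto intro!: M.finsum_closed)
  qed
qed

theorem proposition3p7:
  fixes X :: "('r::infinite, 'v::infinite) axial_data"
  assumes "universal_algebra X"
  shows "spans (scal X) (alg X)
    {ax X (-2), ax X (-1), ax X 0, ax X 1, ax X 2, ax X 3, s0 X 1, s0 X 3}"
  using assms by (intro spans_axial) (simp add: universal_algebra_def)

end
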